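(* Let $q,a,b,c,d,e,f,h$ be non-zero complex numbers with $|q|<1$ and $|q^2a^2|<|bcdef|$, and assume there are no vanishing denominator factors. Then $${}_8W_7\!\left(a;b,c,d,e,f;q,\frac{q^2a^2}{bcdef}\right)=\frac{(qa;q)_\infty}{\vartheta(h,h\frac{def}{qa};q)\,(\frac{qa}b,\frac{qa}c,\frac{qa}d,\frac{qa}e,\frac{qa}f;q)_\infty}$$ $$\times\Bigg(\frac{\vartheta(h\frac{qa}{bc},h\frac{bcdef}{q^2a^2};q)(\frac{qa}{de},\frac{qa}{df},\frac{qa}{ef},b,c,d,e,f;q)_\infty}{(\frac{q^2a^2}{bcdef},\frac{bcd}{qa},\frac{bce}{qa},\frac{bcf}{qa};q)_\infty}\,{}_4\phi_3\!\left(\tfrac{q^2a^2}{bcdef},\tfrac{qa}{bc},\tfrac qb,\tfrac qc;\tfrac{q^2a}{bcd},\tfrac{q^2a}{bce},\tfrac{q^2a}{bcf};q,q\right)$$ $$+\frac{\vartheta(hf,h\frac{de}{qa};q)(\frac{qa}{bc},\frac{qa}{bf},\frac{qa}{cf},\frac{qa}{df},\frac{qa}{ef},d,e;q)_\infty}{(\frac{qa}{bcf},\frac df,\frac ef;q)_\infty}\,{}_4\phi_3\!\left(\tfrac{qa}{de},\tfrac{bf}a,\tfrac{cf}a,f;\tfrac{bcf}a,\tfrac{qf}d,\tfrac{qf}e;q,q\right)$$ $$+\frac{\vartheta(hd,h\frac{ef}{qa};q)(\frac{qa}{bc},\frac{qa}{bd},\frac{qa}{cd},\frac{qa}{de},\frac{qa}{df},e,f;q)_\infty}{(\frac{qa}{bcd},\frac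 ed,\frac fd;q)_\infty}\,{}_4\phi_3\!\left(\tfrac{qa}{ef},\tfrac{bd}a,\tfrac{cd}a,d;\tfrac{bcd}a,\tfrac{qd}e,\tfrac{qd}f;q,q\right)$$ $$+\frac{\vartheta(he,h\frac{df}{qa};q)(\frac{qa}{bc},\frac{qa}{be},\frac{qa}{ce},\frac{qa}{de},\frac{qa}{ef},d,f;q)_\infty}{(\frac{qa}{bce},\frac de,\frac fe;q)_\infty}\,{}_4\phi_3\!\left(\tfrac{qa}{df},\tfrac{be}a,\tfrac{ce}a,e;\tfrac{bce}a,\tfrac{qe}d,\tfrac{qe}f;q,q\right)\Bigg).$$
   Context: Notation. $(a;q)_k=\prod_{j=0}^{k-1}(1-aq^j)$, $(a;q)_\infty=\prod_{j\ge0}(1-aq^j)$, $(a_1,\dots,a_r;q)_k=\prod_j(a_j;q)_k$ for $k\in\mathbb N_0\cup\{\infty\}$. In a list, $\pm x$ stands for the two entries $x,-x$. The symbol $e$ is a parameter, not Euler's number. $\vartheta(x;q)=(x,q/x;q)_\infty$ for $x\ne0$, $\vartheta(x_1,\dots,x_k;q)=\prod_j\vartheta(x_j;q)$. ${}_{r+1}\phi_r(a_1,\dots,a_{r+1};b_1,\dots,b_r;q,z)=\sum_{k\ge0}\frac{(a_1,\dots,a_{r+1};q)_k}{(q,b_1,\dots,b_r;q)_k}z^k$ for $|z|<1$, and $${}_8W_7(a;b,c,d,e,f;q,z)={}_8\phi_7\!\left(a,\pm q\sqrt a,b,c,d,e,f;\pm\sqrt a,\tfrac{qa}b,\tfrac{qa}c,\tfrac{qa}d,\tfrac{qa}e,\tfrac{qa}f;q,z\right).$$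 Convention "no vanishing denominator factors": every infinite $q$-shifted factorial and every theta function appearing in a denominator is non-zero, and no denominator parameter of any series lies in $\{q^{-k}:k\in\mathbb N_0\}$. *)

theory Defs
  imports "HOL-Analysis.Analysis"
begin

definition qpoch :: "complex \<Rightarrow> complex \<Rightarrow> nat \<Rightarrow> complex" where
  "qpoch a q k = (\<Prod>j<k. 1 - a * q ^ j)"

(* For norm q < 1 the product always converges; the library's prodinf has the usual
   value 0 when some factor vanishes. *)
definition qpoch_inf :: "complex \<Rightarrow> complex \<Rightarrow> complex" where
  "qpoch_inf a q = (\<Prod>j. 1 - a * q ^ j)"

definition qpochs :: "complex list \<Rightarrow> complex \<Rightarrow> nat \<Rightarrow> complex" where
  "qpochs as q k = (\<Prod>a\<leftarrow>as. qpoch a q k)"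

definition qpochs_inf :: "complex list \<Rightarrow> complex \<Rightarrow> complex" where
  "qpochs_inf as q = (\<Prod>a\<leftarrow>as. qpoch_inf a q)"

definition theta :: "complex \<Rightarrow> complex \<Rightarrow> complex" where
  "theta x q = qpochs_inf [x, q / x] q"

definition thetas :: "complex list \<Rightarrow> complex \<Rightarrow> complex" where
  "thetas xs q = (\<Prod>x\<leftarrow>xs. theta x q)"

(* The basic hypergeometric series of type (r+1, r), with length as = length bs + 1 = r + 1
   and norm z < 1. For other shapes the usual definition of the series has additional
   factors, which are not included here. *)
definition qhyp :: "complex list \<Rightarrow> complex list \<Rightarrow> complex \<Rightarrow> complex \<Rightarrow> complex" where
  "qhyp as bs q z = (\<Sum>k. qpochs as q k / qpochs (q # bs) q k * z ^ k)"

(* The choice of the square root is immaterial, since both signs occur. *)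
definition W87_num ::
  "complex \<Rightarrow> complex \<Rightarrow> complex \<Rightarrow> complex \<Rightarrow> complex \<Rightarrow> complex \<Rightarrow> complex \<Rightarrow> complex list" where
  "W87_num a b c d e f q = [a, q * csqrt a, - (q * csqrt a), b, c, d, e, f]"

definition W87_den ::
  "complex \<Rightarrow> complex \<Rightarrow> complex \<Rightarrow> complex \<Rightarrow> complex \<Rightarrow> complex \<Rightarrow> complex \<Rightarrow> complex list" where
  "W87_den a b c d e f q =
     [csqrt a, - csqrt a, q * a / b, q * a / c, q * a / d, q * a / e, q * a / f]"

definition W87 ::
  "complex \<Rightarrow> complex \<Rightarrow> complex \<Rightarrow> complex \<Rightarrow> complex \<Rightarrow> complex \<Rightarrow> complex \<Rightarrow> complex \<Rightarrow> complex" where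
  "W87 a b c d e f q z = qhyp (W87_num a b c d e f q) (W87_den a b c d e f q) q z"

definition admissible_den :: "complex list \<Rightarrow> complex \<Rightarrow> bool" where
  "admissible_den bs q \<longleftrightarrow> (\<forall>b \<in> set bs. \<forall>k::nat. b \<noteq> 1 / q ^ k)"

end

(* Write l = def/(qa) and g = qa/(bc). The right-hand side is, up to a factor, the sum of the
   residues with respect to dz/z, at the poles z = p q^k with p in {d, e, f, g}, of

     theta(h z, h l/z) (qa/(bz), qa/(cz)) / ((d/z, e/z, f/z, g/z) (z, z/l)).

   Its other poles are z = q^(-k) and z = l q^(-k); their residues depend on h only through
   theta(h, h l), and they add up to a Jackson integral with two 4phi3 series. That the two
   residue sums agree is obtained by truncating all infinite products after N factors, where it is
   a partial fraction identity for a rational function with equal values at 0 and infinity, and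
   letting N tend to infinity.

   The Jackson integral is evaluated by Bailey's argument: the part of the integrand that depends
   on b and c is expanded by the very-well-poised 6phi5 sum, after which every term is integrated
   by the nonterminating q-Saalschuetz sum, and the result is the 8W7 series. Both sums follow from
   first-order recurrences under a parameter shift by q. All this needs simple poles; the general
   case is a limit in which a, d, e, f are multiplied by a common factor t > 1 tending to 1. *)
theory Submission
  imports Defs "HOL-Computational_Algebra.Polynomial"
begin

subsection \<open>The \<open>q\<close>-shifted factorials\<close>

text \<open>The two theta functions split into the inner zeros q / h, h * l and the outer zeros h, q
  / (h * l). Their products q * l and q / l are free of h, and with the given l and g they make the
  inner zeros multiply to q times the inner poles, and the outer zeros to q times the outer poles.
  This double balance drives the proof: after truncation the two powers of q cancel between 0 and
  infinity, and in each residue series the balance leaves a factor q ^ k, so that these series have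
  argument q and a geometric majorant.

  At the outer poles the natural variable is w = 1 / z, running through q ^ k and q ^ k / l. The
  6phi5 expansion has 1 / w as a parameter and g * w as its argument. It terminates on the first
  lattice; on the second it converges because |g / l| < 1, which is the hypothesis on the norms.

  The obstacle is degeneracy: the theorem admits parameters for which poles merge or an auxiliary
  sum has a vanishing denominator, although both sides of the identity stay finite.\<close>

lemma tannery_sequence:
  fixes f :: "nat \<Rightarrow> nat \<Rightarrow> complex"
  assumes "\<And>k. (\<lambda>n. f n k) \<longlonglongrightarrow> g k"
    and "eventually (\<lambda>n. \<forall>k. norm (f n k) \<le> M k) sequentially" and "summable M"
  shows "(\<lambda>n. \<Sum>k. f n k) \<longlonglongrightarrow> (\<Sum>k. g k)"
proof -
  have "eventually (\<lambda>(k, n). norm (f n k) \<le> M k) (at_top \<times>\<^sub>F sequentially)"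
    unfolding eventually_prod_filter
    by (rule exI[of _ "\<lambda>_. True"], rule exI[of _ "\<lambda>n. \<forall>k. norm (f n k) \<le> M k"])
       (use assms(2) in auto)
  from tannerys_theorem[OF assms(1) this assms(3)] show ?thesis by simp
qed

text \<open>A majorant in product form is summable over pairs of indices, so the double series
  converges absolutely and Fubini applies.\<close>

lemma suminf_swap_bounded:
  fixes f :: "nat \<Rightarrow> nat \<Rightarrow> complex"
  assumes bound: "\<And>j k. norm (f j k) \<le> A j * B k"
    and A: "summable A" "\<And>j. 0 \<le> A j" and B: "summable B" "\<And>k. 0 \<le> B k"
  shows "(\<Sum>j. \<Sum>k. f j k) = (\<Sum>k. \<Sum>j. f j k)"
proof -
  have sA: "A summable_on UNIV" and sB: "B summable_on UNIV"
    using A B by (simp_all add: summable_on_UNIV_nonneg_real_iff)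
  have "(\<lambda>(j, k). A j * B k) summable_on UNIV \<times> UNIV"
    by (rule summable_on_SigmaI[where g = "\<lambda>j. A j * infsum B UNIV"])
      (simp_all add: has_sum_cmult_right has_sum_infsum summable_on_cmult_left sA sB A B)
  then have "(\<lambda>p. norm (case p of (j, k) \<Rightarrow> f j k)) summable_on UNIV \<times> UNIV"
    by (rule summable_on_comparison_test) (simp_all add: bound case_prod_unfold)
  then have sf: "(\<lambda>(j, k). f j k) summable_on UNIV \<times> UNIV"
    by (rule abs_summable_summable)
  have n1: "summable (\<lambda>k. norm (f j k))" for j
    by (rule summable_comparison_test'[where g = "\<lambda>k. A j * B k"])
      (simp_all add: bound B summable_mult)
  have n2: "summable (\<lambda>j. norm (f j k))" for k
    by (rule summable_comparison_test'[where g = "\<lambda>j. A j * B k"])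
      (simp_all add: bound A summable_mult2)
  have inner1: "norm (\<Sum>k. f j k) \<le> A j * suminf B" for j
  proof -
    have "norm (\<Sum>k. f j k) \<le> (\<Sum>k. norm (f j k))" using n1 by (rule summable_norm)
    also have "\<dots> \<le> (\<Sum>k. A j * B k)"
      by (rule suminf_le) (simp_all add: bound n1 B summable_mult)
    also have "\<dots> = A j * suminf B" using B(1) by (rule suminf_mult)
    finally show ?thesis .
  qed
  have inner2: "norm (\<Sum>j. f j k) \<le> suminf A * B k" for k
  proof -
    have "norm (\<Sum>j. f j k) \<le> (\<Sum>j. norm (f j k))" using n2 by (rule summable_norm)
    also have "\<dots> \<le> (\<Sum>j. A j * B k)"
      by (rule suminf_le) (simp_all add: bound n2 A summable_mult2)
    also have "\<dots> = suminf A * B k" using A(1) by (rule suminf_mult2[symmetric])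
    finally show ?thesis .
  qed
  have o1: "summable (\<lambda>j. norm (\<Sum>k. f j k))"
    by (rule summable_comparison_test'[where g = "\<lambda>j. A j * suminf B"])
      (simp_all add: inner1 A summable_mult2)
  have o2: "summable (\<lambda>k. norm (\<Sum>j. f j k))"
    by (rule summable_comparison_test'[where g = "\<lambda>k. suminf A * B k"])
      (simp_all add: inner2 B summable_mult)
  have iU: "infsum g UNIV = suminf g" if "summable (\<lambda>k. norm (g k))" for g :: "nat \<Rightarrow> complex"
    by (rule infsumI, rule norm_summable_imp_has_sum[OF that])
       (rule summable_sums[OF summable_norm_cancel[OF that]])
  have "(\<Sum>j. \<Sum>k. f j k) = infsum (\<lambda>j. infsum (\<lambda>k. f j k) UNIV) UNIV"
    by (simp add: iU[OF o1] iU[OF n1])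
  also have "\<dots> = infsum (\<lambda>k. infsum (\<lambda>j. f j k) UNIV) UNIV"
    by (rule infsum_swap_banach[OF sf])
  also have "\<dots> = (\<Sum>k. \<Sum>j. f j k)"
    by (simp add: iU[OF o2] iU[OF n2])
  finally show ?thesis .
qed

lemma qpoch_0 [simp]: "qpoch a q 0 = 1"
  by (simp add: qpoch_def)

lemma qpoch_Suc: "qpoch a q (Suc n) = qpoch a q n * (1 - a * q ^ n)"
  by (simp add: qpoch_def)

lemma qpoch_add: "qpoch a q (m + n) = qpoch a q m * qpoch (a * q ^ m) q n"
  by (induction n) (simp_all add: qpoch_Suc power_add mult_ac)

lemma qpoch_eq_0_iff: "qpoch a q n = 0 \<longleftrightarrow> (\<exists>k<n. a * q ^ k = 1)"
  by (auto simp: qpoch_def)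

text \<open>Reversing the order of the factors turns a start at x / q ^ k into a start at q / x. The
  part free of \<open>x\<close> stays an unevaluated product, ready to cancel against similar
  products.\<close>

lemma qpoch_div_power:
  assumes "x \<noteq> 0" "q \<noteq> 0"
  shows "qpoch (x / q ^ k) q k = x ^ k * (\<Prod>j<k. - 1 / q ^ Suc j) * qpoch (q / x) q k"
proof -
  have "qpoch (x / q ^ k) q k = (\<Prod>j<k. 1 - x / q ^ k * q ^ (k - Suc j))"
    unfolding qpoch_def by (rule prod.nat_diff_reindex[symmetric])
  also have "\<dots> = (\<Prod>j<k. x * (- 1 / q ^ Suc j) * (1 - q / x * q ^ j))"
  proof (rule prod.cong)
    fix j assume "j \<in> {..<k}"
    then have "q ^ k = q ^ ((k - Suc j) + Suc j)" by simp
    then have "q ^ k = q ^ (k - Suc j) * q ^ Suc j" unfolding power_add .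
    then have "x / q ^ k * q ^ (k - Suc j) = x / q ^ Suc j" using assms by (simp add: field_simps)
    then show "1 - x / q ^ k * q ^ (k - Suc j) = x * (- 1 / q ^ Suc j) * (1 - q / x * q ^ j)"
      using assms by (simp add: field_simps)
  qed simp
  also have "\<dots> = x ^ k * (\<Prod>j<k. - 1 / q ^ Suc j) * qpoch (q / x) q k"
    by (simp only: prod.distrib qpoch_def prod_constant card_lessThan)
  finally show ?thesis .
qed

text \<open>A bound for all finite and infinite shifted factorials of parameters of norm at most \<open>R\<close>.\<close>
definition qbound :: "complex \<Rightarrow> real \<Rightarrow> real" where
  "qbound q R = exp (R / (1 - norm q))"

lemma qbound_pos [simp]: "qbound q R > 0" "qbound q R \<ge> 0" "qbound q R \<noteq> 0"
  by (simp_all add: qbound_def)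

lemma qpochs_Nil [simp]: "qpochs [] q k = 1" and qpochs_Cons [simp]: "qpochs (a # as) q k = qpoch a q k * qpochs as q k"
  by (simp_all add: qpochs_def)

lemma qpochs_inf_Nil [simp]: "qpochs_inf [] q = 1" and qpochs_inf_Cons [simp]: "qpochs_inf (a # as) q = qpoch_inf a q * qpochs_inf as q"
  by (simp_all add: qpochs_inf_def)

lemma qpoch_inf_zero [simp]: "qpoch_inf 0 q = 1"
  by (simp add: qpoch_inf_def)

section \<open>Uniform bounds and continuity in the parameters\<close>

context
  fixes q :: complex
  assumes q1: "norm q < 1"
begin

lemma prod_norm_le_qbound:
  assumes "R \<ge> 0"
  shows "(\<Prod>j<n. 1 + R * norm q ^ j) \<le> qbound q R"
proof -
  have "(\<Prod>j<n. 1 + R * norm q ^ j) \<le> exp (\<Sum>j<n. R * norm q ^ j)"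
    by (rule prod_le_exp_sum) (use assms in auto)
  also have "(\<Sum>j<n. R * norm q ^ j) \<le> (\<Sum>j. R * norm q ^ j)"
    by (rule sum_le_suminf) (use assms q1 in \<open>auto intro: summable_mult\<close>)
  also have "(\<Sum>j. R * norm q ^ j) = R / (1 - norm q)"
    using q1 by (simp add: suminf_mult suminf_geometric)
  finally show ?thesis by (simp add: qbound_def)
qed

lemma norm_qpoch_le:
  assumes "norm a \<le> R"
  shows "norm (qpoch a q n) \<le> qbound q R"
proof -
  have "norm (qpoch a q n) \<le> (\<Prod>j<n. 1 + R * norm q ^ j)"
    unfolding qpoch_def prod_norm[symmetric]
  proof (rule prod_mono, safe)
    fix j
    have "norm (1 - a * q ^ j) \<le> 1 + norm a * norm q ^ j"
      by (metis norm_mult norm_one norm_power norm_triangle_ineq4)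
    also have "\<dots> \<le> 1 + R * norm q ^ j"
      using assms by (simp add: mult_right_mono)
    finally show "norm (1 - a * q ^ j) \<le> 1 + R * norm q ^ j" .
  qed simp
  also have "\<dots> \<le> qbound q R"
    by (rule prod_norm_le_qbound) (use assms norm_ge_zero order_trans in blast)
  finally show ?thesis .
qed

text \<open>The constant does not depend on \<open>n\<close>, so the estimate passes to the infinite
  products and yields their continuity in the parameter.\<close>

lemma qpoch_Lipschitz:
  assumes "norm a \<le> R" "norm b \<le> R"
  shows "norm (qpoch a q n - qpoch b q n) \<le> (qbound q R)\<^sup>2 / (1 - norm q) * norm (a - b)"
proof -
  have R: "R \<ge> 0" using assms(1) norm_ge_zero order_trans by blast
  define P where "P n = (\<Prod>j<n. 1 + R * norm q ^ j)" for n
  have P1: "P n \<ge> 1" for n unfolding P_def by (rule prod_ge_1) (use R in auto)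
  \<comment> \<open>The partial product \<open>P n\<close> absorbs the new factor in the induction
    step; it and the geometric sum are bounded independently of \<open>n\<close> only
    afterwards.\<close>
  have "norm (qpoch a q n - qpoch b q n) \<le> P n * (qbound q R * norm (a - b) * (\<Sum>j<n. norm q ^ j))"
  proof (induction n)
    case (Suc n)
    define S where "S = qbound q R * norm (a - b) * (\<Sum>j<n. norm q ^ j)"
    have "qpoch a q (Suc n) - qpoch b q (Suc n) =
        (qpoch a q n - qpoch b q n) * (1 - a * q ^ n) - qpoch b q n * ((a - b) * q ^ n)"
      by (simp add: qpoch_Suc algebra_simps)
    also have "norm \<dots> \<le> norm ((qpoch a q n - qpoch b q n) * (1 - a * q ^ n))
        + norm (qpoch b q n * ((a - b) * q ^ n))"
      by (rule norm_triangle_ineq4)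
    also have "norm ((qpoch a q n - qpoch b q n) * (1 - a * q ^ n)) \<le> (P n * S) * (1 + R * norm q ^ n)"
      unfolding norm_mult
    proof (rule mult_mono)
      have "norm (1 - a * q ^ n) \<le> 1 + norm a * norm q ^ n"
        by (metis norm_mult norm_one norm_power norm_triangle_ineq4)
      also have "\<dots> \<le> 1 + R * norm q ^ n"
        using assms by (simp add: mult_right_mono)
      finally show "norm (1 - a * q ^ n) \<le> 1 + R * norm q ^ n" .
      show "norm (qpoch a q n - qpoch b q n) \<le> P n * S" using Suc unfolding S_def .
      then show "0 \<le> P n * S" using norm_ge_zero order_trans by blast
    qed simp
    also have "(P n * S) * (1 + R * norm q ^ n) = P (Suc n) * S"
      by (simp add: P_def)
    also have "norm (qpoch b q n * ((a - b) * q ^ n)) \<le> qbound q R * (norm (a - b) * norm q ^ n)"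
      unfolding norm_mult norm_power by (rule mult_right_mono) (use norm_qpoch_le[OF assms(2)] in auto)
    also have "\<dots> \<le> P (Suc n) * (qbound q R * (norm (a - b) * norm q ^ n))"
      using mult_right_mono[OF P1[of "Suc n"], of "qbound q R * (norm (a - b) * norm q ^ n)"] by simp
    finally show ?case by (simp add: S_def algebra_simps)
  qed simp
  also have "\<dots> \<le> qbound q R * (qbound q R * norm (a - b) * (1 / (1 - norm q)))"
  proof (intro mult_mono mult_left_mono)
    show "P n \<le> qbound q R" unfolding P_def by (rule prod_norm_le_qbound[OF R])
    have "(\<Sum>j<n. norm q ^ j) \<le> (\<Sum>j. norm q ^ j)"
      by (rule sum_le_suminf) (use q1 in auto)
    then show "(\<Sum>j<n. norm q ^ j) \<le> 1 / (1 - norm q)" using q1 by (simp add: suminf_geometric)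
  qed (auto intro!: sum_nonneg mult_nonneg_nonneg)
  finally show ?thesis by (simp add: power2_eq_square)
qed

lemma convergent_qpoch: "convergent_prod (\<lambda>j. 1 - a * q ^ j)"
proof -
  have "summable (\<lambda>j. norm a * norm q ^ j)" using q1 by (intro summable_mult) auto
  then have "summable (\<lambda>j. norm ((1 - a * q ^ j) - 1))" by (simp add: norm_mult norm_power)
  then show ?thesis
    by (intro abs_convergent_prod_imp_convergent_prod summable_imp_abs_convergent_prod)
qed

lemma qpoch_tendsto: "(\<lambda>n. qpoch a q n) \<longlonglongrightarrow> qpoch_inf a q"
proof -
  have "(\<lambda>n. qpoch a q (Suc n)) \<longlonglongrightarrow> qpoch_inf a q"
    using convergent_prod_LIMSEQ[OF convergent_qpoch[of a]]
    by (simp add: qpoch_def qpoch_inf_def lessThan_Suc_atMost del: prod.lessThan_Suc)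
  then show ?thesis by (rule LIMSEQ_imp_Suc)
qed

lemma qpoch_inf_split: "qpoch_inf a q = qpoch a q n * qpoch_inf (a * q ^ n) q"
proof (rule LIMSEQ_unique)
  show "(\<lambda>m. qpoch a q (n + m)) \<longlonglongrightarrow> qpoch_inf a q"
    using LIMSEQ_ignore_initial_segment[OF qpoch_tendsto[of a], of n] by (simp add: add.commute)
  show "(\<lambda>m. qpoch a q (n + m)) \<longlonglongrightarrow> qpoch a q n * qpoch_inf (a * q ^ n) q"
    unfolding qpoch_add by (intro tendsto_intros qpoch_tendsto)
qed

lemma qpoch_inf_one [simp]: "qpoch_inf 1 q = 0"
  using qpoch_inf_split[of 1 1] by (simp add: qpoch_Suc)

lemma qpoch_inf_eq_0_iff: "qpoch_inf a q = 0 \<longleftrightarrow> (\<exists>k. a * q ^ k = 1)"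
proof
  assume "qpoch_inf a q = 0"
  then show "\<exists>k. a * q ^ k = 1"
    using prodinf_nonzero[OF convergent_qpoch[of a]] unfolding qpoch_inf_def by fastforce
next
  assume "\<exists>k. a * q ^ k = 1"
  then obtain k where "a * q ^ k = 1" ..
  then show "qpoch_inf a q = 0" using qpoch_inf_split[of a "Suc k"] by (simp add: qpoch_Suc)
qed

lemma norm_qpoch_inf_le:
  assumes "norm a \<le> R"
  shows "norm (qpoch_inf a q) \<le> qbound q R"
  using tendsto_norm[OF qpoch_tendsto] by (rule LIMSEQ_le_const2) (use norm_qpoch_le[OF assms] in auto)

text \<open>The infinite product is the finite one times a tail, and the tail has norm at most
  \<open>qbound q R\<close>. The resulting lower bound is uniform in \<open>n\<close>.\<close>

lemma norm_qpoch_ge: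
  assumes "norm a \<le> R"
  shows "norm (qpoch_inf a q) / qbound q R \<le> norm (qpoch a q n)"
proof -
  have "R \<ge> 0" using assms norm_ge_zero order_trans by blast
  have "norm (a * q ^ n) \<le> R * 1"
    unfolding norm_mult norm_power
    by (rule mult_mono) (use assms q1 \<open>R \<ge> 0\<close> in \<open>auto simp: power_le_one\<close>)
  then have "norm (qpoch_inf (a * q ^ n) q) \<le> qbound q R" by (intro norm_qpoch_inf_le) simp
  then have "norm (qpoch_inf a q) \<le> norm (qpoch a q n) * qbound q R"
    unfolding qpoch_inf_split[of a n] norm_mult by (intro mult_left_mono) auto
  then show ?thesis by (simp add: divide_le_eq)
qed

lemma norm_qpoch_inf_ge:
  assumes "norm a \<le> R"
  shows "norm (qpoch_inf a q) / qbound q R \<le> norm (qpoch_inf (a * q ^ n) q)"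
proof -
  have "norm (qpoch_inf a q) \<le> norm (qpoch_inf (a * q ^ n) q) * qbound q R"
    unfolding qpoch_inf_split[of a n] norm_mult
    using norm_qpoch_le[OF assms, of n] by (simp add: mult.commute mult_right_mono)
  then show ?thesis by (simp add: divide_le_eq)
qed

lemma tendsto_qpoch_inf [tendsto_intros]:
  assumes "A \<longlonglongrightarrow> a"
  shows "(\<lambda>n. qpoch_inf (A n) q) \<longlonglongrightarrow> qpoch_inf a q"
proof -
  obtain R where R: "\<And>n. norm (A n) \<le> R"
    using convergent_imp_Bseq[OF convergentI[OF assms]] by (auto simp: Bseq_def)
  have Ra: "norm a \<le> R" using tendsto_norm[OF assms] R by (intro LIMSEQ_le_const2) auto
  define C where "C = (qbound q R)\<^sup>2 / (1 - norm q)"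
  have le: "norm (qpoch_inf (A n) q - qpoch_inf a q) \<le> C * norm (A n - a)" for n
  proof (rule LIMSEQ_le_const2)
    show "(\<lambda>m. norm (qpoch (A n) q m - qpoch a q m)) \<longlonglongrightarrow> norm (qpoch_inf (A n) q - qpoch_inf a q)"
      by (intro tendsto_intros qpoch_tendsto)
  qed (use qpoch_Lipschitz[OF R Ra] in \<open>auto simp: C_def\<close>)
  have "(\<lambda>n. C * norm (A n - a)) \<longlonglongrightarrow> C * norm (a - a)"
    by (intro tendsto_intros assms)
  then have "(\<lambda>n. C * norm (A n - a)) \<longlonglongrightarrow> 0" by simp
  then have "(\<lambda>n. qpoch_inf (A n) q - qpoch_inf a q) \<longlonglongrightarrow> 0"
    by (rule Lim_null_comparison[rotated]) (simp add: le)
  then show ?thesis by (rule LIM_zero_cancel)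
qed

lemma tendsto_qpoch [tendsto_intros]:
  assumes "A \<longlonglongrightarrow> a"
  shows "(\<lambda>n. qpoch (A n) p k) \<longlonglongrightarrow> qpoch a p k"
  unfolding qpoch_def by (intro tendsto_intros assms)

lemma qpoch_q_nz: "qpoch_inf q q \<noteq> 0" "qpoch q q k \<noteq> 0"
proof -
  have "q * q ^ k \<noteq> 1" for k
  proof
    assume "q * q ^ k = 1"
    then have "norm q ^ Suc k = 1" by (metis norm_one norm_power power_Suc)
    moreover have "norm q ^ Suc k \<le> norm q"
      using q1 by (simp add: power_le_one mult_left_le)
    ultimately show False using q1 by simp
  qed
  then show "qpoch_inf q q \<noteq> 0" "qpoch q q k \<noteq> 0" by (auto simp: qpoch_inf_eq_0_iff qpoch_eq_0_iff)
qed

lemma qpochs_bounded: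
  assumes "list_all2 (\<lambda>X x. X \<longlonglongrightarrow> x) Xs xs"
  shows "\<exists>C. \<forall>n k. norm (qpochs (map (\<lambda>X. X n) Xs) q k) \<le> C"
  using assms
proof (induction rule: list_all2_induct)
  case (Cons X Xs x xs)
  from Cons obtain C where C: "\<And>n k. norm (qpochs (map (\<lambda>X. X n) Xs) q k) \<le> C" by auto
  obtain R where R: "\<And>n. norm (X n) \<le> R"
    using convergent_imp_Bseq[OF convergentI[OF Cons(1)]] by (auto simp: Bseq_def)
  have "norm (qpochs (map (\<lambda>X. X n) (X # Xs)) q k) \<le> qbound q R * C" for n k
    using norm_qpoch_le[OF R] C by (auto simp: norm_mult intro!: mult_mono)
  then show ?case by blast
qed auto

text \<open>Here \<open>n\<close> moves the parameters and \<open>k\<close> is the index of the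
  series; the bound is uniform in \<open>k\<close>. It holds only eventually, because the non-zero
  limit controls the infinite products only for large \<open>n\<close>.\<close>

lemma qpochs_bounded_below:
  assumes "list_all2 (\<lambda>X x. X \<longlonglongrightarrow> x) Xs xs" "qpochs_inf xs q \<noteq> 0"
  shows "\<exists>c>0. eventually (\<lambda>n. \<forall>k. c \<le> norm (qpochs (map (\<lambda>X. X n) Xs) q k)) sequentially"
  using assms
proof (induction rule: list_all2_induct)
  case Nil
  then show ?case by (intro exI[of _ 1]) auto
next
  case (Cons X Xs x xs)
  from Cons obtain c where c: "c > 0"
    "eventually (\<lambda>n. \<forall>k. c \<le> norm (qpochs (map (\<lambda>X. X n) Xs) q k)) sequentially" by auto
  obtain R where R: "\<And>n. norm (X n) \<le> R"
    using convergent_imp_Bseq[OF convergentI[OF Cons(1)]] by (auto simp: Bseq_def)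
  define l where "l = norm (qpoch_inf x q) / 2"
  have l: "l > 0" using Cons by (simp add: l_def)
  have "(\<lambda>n. norm (qpoch_inf (X n) q)) \<longlonglongrightarrow> norm (qpoch_inf x q)"
    by (intro tendsto_intros Cons)
  moreover have "l < norm (qpoch_inf x q)" using l by (simp add: l_def)
  ultimately have "eventually (\<lambda>n. l < norm (qpoch_inf (X n) q)) sequentially"
    by (rule order_tendstoD(1))
  then have "eventually (\<lambda>n. \<forall>k. l / qbound q R * c \<le> norm (qpochs (map (\<lambda>X. X n) (X # Xs)) q k)) sequentially"
    using c(2)
  proof eventually_elim
    case (elim n)
    have "l / qbound q R \<le> norm (qpoch (X n) q k)" for k
      using norm_qpoch_ge[OF R, of n k] elim(1)
      by (smt (verit) divide_right_mono qbound_pos(2))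
    then show ?case using elim(2) c l
      by (auto simp: norm_mult simp del: times_divide_eq_left intro!: mult_mono)
  qed
  then show ?case using l c by (intro exI[of _ "l / qbound q R * c"]) auto
qed

lemma tendsto_qpochs:
  assumes "list_all2 (\<lambda>X x. X \<longlonglongrightarrow> x) Xs xs"
  shows "(\<lambda>n. qpochs (map (\<lambda>X. X n) Xs) p k) \<longlonglongrightarrow> qpochs xs p k"
  using assms by (induction rule: list_all2_induct) (auto intro!: tendsto_intros)

lemma qpochs_nz: "qpochs_inf xs q \<noteq> 0 \<Longrightarrow> qpochs xs q k \<noteq> 0"
proof (induction xs)
  case (Cons x xs)
  then show ?case using qpoch_inf_split[of x k] by auto
qed simp

lemma qhyp_summable:
  assumes nz: "qpochs_inf ys q \<noteq> 0" and z: "norm z < 1"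
  shows "summable (\<lambda>k. qpochs xs q k / qpochs (q # ys) q k * z ^ k)"
proof -
  have const: "list_all2 (\<lambda>X x. X \<longlonglongrightarrow> x) (map (\<lambda>x _. x) zs) zs" for zs :: "complex list"
    by (simp add: list_all2_map1 list.rel_refl)
  obtain C where C: "\<And>k. norm (qpochs xs q k) \<le> C"
    using qpochs_bounded[OF const[of xs]] by (auto simp: comp_def)
  have C0: "C \<ge> 0" using C norm_ge_zero order_trans by blast
  have nz': "qpochs_inf (q # ys) q \<noteq> 0" using nz qpoch_q_nz by simp
  have "map (\<lambda>X. X n) (map (\<lambda>x _. x) zs) = zs" for n :: nat and zs :: "complex list"
    by (simp add: comp_def)
  then obtain c where c: "c > 0" "\<And>k. c \<le> norm (qpochs (q # ys) q k)"
    using qpochs_bounded_below[OF const[of "q # ys"] nz'] by (auto simp del: list.map map_map)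
  show ?thesis
  proof (rule summable_comparison_test')
    show "summable (\<lambda>k. C / c * norm z ^ k)" using z by (intro summable_mult) auto
    show "norm (qpochs xs q k / qpochs (q # ys) q k * z ^ k) \<le> C / c * norm z ^ k" for k
      unfolding norm_mult norm_divide norm_power
      using C0 c C by (intro mult_mono frac_le) auto
  qed
qed

text \<open>Dominated convergence: the numerators are bounded and the denominators bounded away from
  0, both uniformly, so a geometric series with a ratio \<open>r\<close> strictly between
  \<open>norm z\<close> and 1 dominates.\<close>

lemma tendsto_qhyp:
  assumes Xs: "list_all2 (\<lambda>X x. X \<longlonglongrightarrow> x) Xs xs" and Ys: "list_all2 (\<lambda>X x. X \<longlonglongrightarrow> x) Ys ys"
    and nz: "qpochs_inf ys q \<noteq> 0" and z: "Z \<longlonglongrightarrow> z" "norm z < 1"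
  shows "(\<lambda>n. qhyp (map (\<lambda>X. X n) Xs) (map (\<lambda>X. X n) Ys) q (Z n)) \<longlonglongrightarrow> qhyp xs ys q z"
proof -
  obtain C where C: "\<And>n k. norm (qpochs (map (\<lambda>X. X n) Xs) q k) \<le> C"
    using qpochs_bounded[OF Xs] by auto
  have C0: "C \<ge> 0" using C norm_ge_zero order_trans by blast
  have Ys': "list_all2 (\<lambda>X x. X \<longlonglongrightarrow> x) ((\<lambda>_. q) # Ys) (q # ys)" using Ys by simp
  have nz': "qpochs_inf (q # ys) q \<noteq> 0" using nz qpoch_q_nz by simp
  obtain c where c: "c > 0" "eventually (\<lambda>n. \<forall>k. c \<le> norm (qpochs (q # map (\<lambda>X. X n) Ys) q k)) sequentially"
    using qpochs_bounded_below[OF Ys' nz'] by auto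
  obtain r where r: "norm z < r" "r < 1" using z(2) dense by blast
  have r0: "r \<ge> 0" using r norm_ge_zero[of z] by linarith
  have "eventually (\<lambda>n. norm (Z n) < r) sequentially"
    using tendsto_norm[OF z(1)] r(1) by (rule order_tendstoD(2))
  show ?thesis
    unfolding qhyp_def
  proof (rule tannery_sequence[where M = "\<lambda>k. C / c * r ^ k"])
    fix k
    have "(\<lambda>n. qpochs (map (\<lambda>X. X n) ((\<lambda>_. q) # Ys)) q k) \<longlonglongrightarrow> qpochs (q # ys) q k"
      by (rule tendsto_qpochs[OF Ys'])
    then show "(\<lambda>n. qpochs (map (\<lambda>X. X n) Xs) q k / qpochs (q # map (\<lambda>X. X n) Ys) q k * Z n ^ k)
      \<longlonglongrightarrow> qpochs xs q k / qpochs (q # ys) q k * z ^ k"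
      by (intro tendsto_intros tendsto_qpochs[OF Xs] z qpochs_nz nz') simp
    show "eventually (\<lambda>n. \<forall>k. norm (qpochs (map (\<lambda>X. X n) Xs) q k / qpochs (q # map (\<lambda>X. X n) Ys) q k * Z n ^ k)
        \<le> C / c * r ^ k) sequentially"
      using c(2) \<open>eventually (\<lambda>n. norm (Z n) < r) sequentially\<close>
    proof eventually_elim
      case (elim n)
      show ?case
        unfolding norm_mult norm_divide norm_power
        using elim C0 c(1) C by (intro allI mult_mono frac_le power_mono) auto
    qed
    show "summable (\<lambda>k. C / c * r ^ k)" using r r0 by (intro summable_mult) auto
  qed
qed

end

subsection \<open>Residue sums\<close>

lemma degree_prod_linear: "finite I \<Longrightarrow> degree (\<Prod>i\<in>I. [:- r i, 1:]) = card I"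
  for r :: "'i \<Rightarrow> 'a :: field"
  by (subst degree_prod_eq_sum_degree) auto

lemma lead_coeff_prod_linear: "coeff (\<Prod>i\<in>I. [:- r i, 1:]) (card I) = 1" if "finite I"
  for r :: "'i \<Rightarrow> 'a :: field"
proof -
  have "lead_coeff (\<Prod>i\<in>I. [:- r i, 1:]) = 1" by (simp add: lead_coeff_prod)
  then show ?thesis using degree_prod_linear[OF that, of r] by simp
qed

text \<open>The sum of all residues of \<open>\<Prod>i\<in>I. (z - \<alpha> i) / (z - \<beta> i)\<close> with respect to \<open>dz / z\<close>,
  obtained by Lagrange interpolation at the poles.\<close>
lemma sum_residues_rational:
  fixes \<alpha> \<beta> :: "'i \<Rightarrow> complex"
  assumes fin: "finite I" and inj: "inj_on \<beta> I" and nz: "\<And>i. i \<in> I \<Longrightarrow> \<beta> i \<noteq> 0"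
  shows "(\<Sum>p\<in>I. (\<Prod>i\<in>I. 1 - \<alpha> i / \<beta> p) / (\<Prod>i\<in>I - {p}. 1 - \<beta> i / \<beta> p))
    = 1 - (\<Prod>i\<in>I. \<alpha> i) / (\<Prod>i\<in>I. \<beta> i)"
proof (cases "I = {}")
  case False
  define n where "n = card I"
  have n0: "n > 0" using False fin by (simp add: n_def card_gt_0_iff)
  \<comment> \<open>\<open>L p\<close> is the residue at \<open>\<beta> p\<close> with respect to
    dz. The claim \<open>A = B\<close> is the partial fraction expansion of the quotient minus 1,
    multiplied by its denominator; subtracting 1 cancels the leading terms.\<close>
  define L where "L p = (\<Prod>i\<in>I. \<beta> p - \<alpha> i) / (\<Prod>i\<in>I - {p}. \<beta> p - \<beta> i)" for p
  define A where "A = (\<Prod>i\<in>I. [:- \<alpha> i, 1:]) - (\<Prod>i\<in>I. [:- \<beta> i, 1:])"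
  define B where "B = (\<Sum>p\<in>I. smult (L p) (\<Prod>i\<in>I - {p}. [:- \<beta> i, 1:]))"
  have "degree A < n"
  proof (rule ccontr)
    assume "\<not> degree A < n"
    moreover have "degree A \<le> n"
      unfolding A_def n_def by (intro degree_diff_le) (simp_all add: degree_prod_linear fin)
    moreover have "coeff A n = 0"
      by (simp add: A_def n_def lead_coeff_prod_linear fin)
    ultimately show False using n0 by (metis degree_0 leading_coeff_0_iff less_or_eq_imp_le nat_neq_iff not_less)
  qed
  moreover have "degree B < n"
  proof -
    have "degree B \<le> n - 1"
      unfolding B_def
    proof (rule degree_sum_le[OF fin])
      fix p assume "p \<in> I"
      then show "degree (smult (L p) (\<Prod>i\<in>I - {p}. [:- \<beta> i, 1:])) \<le> n - 1"
        using fin by (intro order_trans[OF degree_smult_le]) (simp add: degree_prod_linear n_def)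
    qed
    then show ?thesis using n0 by simp
  qed
  moreover have "poly A x = poly B x" if x: "x \<in> \<beta> ` I" for x
  proof -
    obtain p where p: "p \<in> I" "x = \<beta> p" using x by auto
    have other: "(\<Prod>i\<in>I - {s}. \<beta> p - \<beta> i) = 0" if "s \<in> I" "s \<noteq> p" for s
      by (rule prod_zero) (use that p fin in \<open>auto intro: bexI[of _ p]\<close>)
    have nz': "(\<Prod>i\<in>I - {p}. \<beta> p - \<beta> i) \<noteq> 0"
      using fin inj_onD[OF inj _ p(1)] p(1) by fastforce
    have "poly B x = (\<Sum>s\<in>I. if s = p then L p * (\<Prod>i\<in>I - {p}. \<beta> p - \<beta> i) else 0)"
      unfolding B_def poly_sum by (rule sum.cong) (auto simp: poly_prod p other)
    also have "\<dots> = L p * (\<Prod>i\<in>I - {p}. \<beta> p - \<beta> i)" using p fin by simp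
    also have "\<dots> = (\<Prod>i\<in>I. \<beta> p - \<alpha> i)" using nz' by (simp add: L_def)
    also have "\<dots> = poly A x"
    proof -
      have "(\<Prod>i\<in>I. \<beta> p - \<beta> i) = 0"
        by (rule prod_zero) (use p fin in auto)
      then show ?thesis using p by (simp add: A_def poly_prod)
    qed
    finally show ?thesis by simp
  qed
  moreover have "card (\<beta> ` I) = n" using inj by (simp add: n_def card_image)
  ultimately have "A = B" by (intro poly_eqI_degree[of "\<beta> ` I"]) auto
  \<comment> \<open>Evaluating at 0 divides each residue by \<open>\<beta> p\<close>, which is the
    passage from dz to dz / z.\<close>
  then have "poly A 0 = poly B 0" by simp
  moreover have "poly A 0 = (-1) ^ n * (\<Prod>i\<in>I. \<alpha> i) - (-1) ^ n * (\<Prod>i\<in>I. \<beta> i)"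
    by (simp add: A_def poly_prod n_def prod_uminus)
  moreover have "poly B 0 = - ((-1) ^ n * (\<Prod>i\<in>I. \<beta> i) *
      (\<Sum>p\<in>I. (\<Prod>i\<in>I. 1 - \<alpha> i / \<beta> p) / (\<Prod>i\<in>I - {p}. 1 - \<beta> i / \<beta> p)))"
    unfolding B_def poly_sum sum_distrib_left sum_negf[symmetric]
  proof (rule sum.cong[OF refl])
    fix p assume p: "p \<in> I"
    have c: "card (I - {p}) = n - 1" using p fin by (simp add: n_def)
    have e: "(-1 :: complex) ^ n = - ((-1) ^ (n - 1))" using n0 by (cases n) auto
    have b: "(\<Prod>i\<in>I. \<beta> i) = \<beta> p * (\<Prod>i\<in>I - {p}. \<beta> i)" using p fin by (rule prod.remove[rotated])
    have "(\<Prod>i\<in>I. \<beta> p - \<alpha> i) = (\<Prod>i\<in>I. \<beta> p * (1 - \<alpha> i / \<beta> p))"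
      by (rule prod.cong) (use nz[OF p] in \<open>auto simp: field_simps\<close>)
    also have "\<dots> = \<beta> p ^ n * (\<Prod>i\<in>I. 1 - \<alpha> i / \<beta> p)" by (simp add: prod.distrib n_def)
    finally have 1: "(\<Prod>i\<in>I. \<beta> p - \<alpha> i) = \<beta> p ^ n * (\<Prod>i\<in>I. 1 - \<alpha> i / \<beta> p)" .
    have "(\<Prod>i\<in>I - {p}. \<beta> p - \<beta> i) = (\<Prod>i\<in>I - {p}. \<beta> p * (1 - \<beta> i / \<beta> p))"
      by (rule prod.cong) (use nz[OF p] in \<open>auto simp: field_simps\<close>)
    also have "\<dots> = \<beta> p ^ (n - 1) * (\<Prod>i\<in>I - {p}. 1 - \<beta> i / \<beta> p)"
      by (simp only: prod.distrib prod_constant c)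
    finally have 2: "(\<Prod>i\<in>I - {p}. \<beta> p - \<beta> i) = \<beta> p ^ (n - 1) * (\<Prod>i\<in>I - {p}. 1 - \<beta> i / \<beta> p)" .
    have bn: "\<beta> p ^ n = \<beta> p * \<beta> p ^ (n - 1)" using n0 by (cases n) auto
    have L: "L p = \<beta> p * ((\<Prod>i\<in>I. 1 - \<alpha> i / \<beta> p) / (\<Prod>i\<in>I - {p}. 1 - \<beta> i / \<beta> p))"
      unfolding L_def 1 2 bn using nz[OF p] by simp
    have "poly (smult (L p) (\<Prod>i\<in>I - {p}. [:- \<beta> i, 1:])) 0 = L p * ((-1) ^ (n - 1) * (\<Prod>i\<in>I - {p}. \<beta> i))"
      by (simp add: poly_prod prod_uminus c)
    then show "poly (smult (L p) (\<Prod>i\<in>I - {p}. [:- \<beta> i, 1:])) 0 = - ((-1) ^ n * (\<Prod>i\<in>I. \<beta> i) *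
        ((\<Prod>i\<in>I. 1 - \<alpha> i / \<beta> p) / (\<Prod>i\<in>I - {p}. 1 - \<beta> i / \<beta> p)))"
      unfolding L b e by simp
  qed
  ultimately have "(-1) ^ n * (\<Prod>i\<in>I. \<alpha> i) - (-1) ^ n * (\<Prod>i\<in>I. \<beta> i) = - ((-1) ^ n * (\<Prod>i\<in>I. \<beta> i) *
      (\<Sum>p\<in>I. (\<Prod>i\<in>I. 1 - \<alpha> i / \<beta> p) / (\<Prod>i\<in>I - {p}. 1 - \<beta> i / \<beta> p)))" (is "_ = - (_ * _ * ?S)")
    by simp
  then have "(-1) ^ n * ((\<Prod>i\<in>I. \<alpha> i) - (\<Prod>i\<in>I. \<beta> i)) = (-1) ^ n * (- ((\<Prod>i\<in>I. \<beta> i) * ?S))"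
    by (simp add: algebra_simps)
  then have "(\<Prod>i\<in>I. \<alpha> i) - (\<Prod>i\<in>I. \<beta> i) = - ((\<Prod>i\<in>I. \<beta> i) * ?S)"
    unfolding mult_cancel_left by simp
  moreover have "(\<Prod>i\<in>I. \<beta> i) \<noteq> 0" using fin nz by simp
  ultimately show ?thesis by (simp add: field_simps)
qed simp

text \<open>The poles are \<open>y i\<close> (\<open>i \<in> A\<close>) and \<open>1 / v i\<close> (\<open>i \<in> B\<close>); the hypothesis \<open>bal\<close> says that the
  function has the same value at \<open>0\<close> and \<open>\<infinity>\<close>.\<close>
lemma sum_residues_two_sided:
  fixes x y :: "'i \<Rightarrow> complex" and u v :: "'j \<Rightarrow> complex"
  assumes fin: "finite A" "finite B" and inj: "inj_on y A" "inj_on v B"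
    and nz: "\<And>i. i \<in> A \<Longrightarrow> x i \<noteq> 0 \<and> y i \<noteq> 0" "\<And>i. i \<in> B \<Longrightarrow> u i \<noteq> 0 \<and> v i \<noteq> 0"
    and disj: "\<And>i j. i \<in> A \<Longrightarrow> j \<in> B \<Longrightarrow> y i * v j \<noteq> 1"
    and bal: "prod x A * prod v B = prod y A * prod u B"
  shows "(\<Sum>p\<in>A. (\<Prod>i\<in>A. 1 - x i / y p) / (\<Prod>i\<in>A - {p}. 1 - y i / y p) *
            (\<Prod>i\<in>B. (1 - u i * y p) / (1 - v i * y p))) =
         (\<Sum>p\<in>B. (\<Prod>i\<in>B. 1 - u i / v p) / (\<Prod>i\<in>B - {p}. 1 - v i / v p) *
            (\<Prod>i\<in>A. (1 - x i * v p) / (1 - y i * v p)))"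
proof -
  have aux: "c * s = c * t" if "0 = s * c + - (t * c)" for s t c :: complex
    using that by (auto simp: algebra_simps)
  \<comment> \<open>The factors 1 - u z and 1 - v z are read as multiples of z - 1 / u and z - 1 /
    v, so that the one-sided lemma applies to the disjoint sum of the index sets. The constants
    split off form the common factor \<open>prod v B / prod u B\<close>.\<close>
  define \<alpha> where "\<alpha> = case_sum x (\<lambda>j. 1 / u j)"
  define \<beta> where "\<beta> = case_sum y (\<lambda>j. 1 / v j)"
  have inj': "inj_on \<beta> (A <+> B)"
  proof (rule inj_onI)
    fix s t assume st: "s \<in> A <+> B" "t \<in> A <+> B" "\<beta> s = \<beta> t"
    have d: "y i \<noteq> 1 / v j" if "i \<in> A" "j \<in> B" for i j
      using disj[OF that] nz(2)[OF that(2)] by (auto simp: field_simps)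
    show "s = t"
      using st inj_onD[OF inj(1)] inj_onD[OF inj(2)] d d[symmetric]
      by (cases s; cases t) (auto simp: \<beta>_def)
  qed
  have nz': "\<beta> i \<noteq> 0" if "i \<in> A <+> B" for i
    using that nz by (auto simp: \<beta>_def)
  \<comment> \<open>By \<open>bal\<close> the right-hand side of the one-sided lemma vanishes, so
    all residues together sum to 0.\<close>
  have "(\<Prod>i\<in>A <+> B. \<alpha> i) / (\<Prod>i\<in>A <+> B. \<beta> i) = 1"
    using bal nz fin by (simp add: prod.Plus \<alpha>_def \<beta>_def prod_dividef field_simps)
  with sum_residues_rational[OF _ inj' nz', of \<alpha>] fin
  have "0 = (\<Sum>p\<in>A <+> B. (\<Prod>i\<in>A <+> B. 1 - \<alpha> i / \<beta> p) / (\<Prod>i\<in>(A <+> B) - {p}. 1 - \<beta> i / \<beta> p))"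
    by simp
  also have "\<dots> = (\<Sum>p\<in>A. (\<Prod>i\<in>A <+> B. 1 - \<alpha> i / \<beta> (Inl p)) / (\<Prod>i\<in>(A <+> B) - {Inl p}. 1 - \<beta> i / \<beta> (Inl p)))
     + (\<Sum>p\<in>B. (\<Prod>i\<in>A <+> B. 1 - \<alpha> i / \<beta> (Inr p)) / (\<Prod>i\<in>(A <+> B) - {Inr p}. 1 - \<beta> i / \<beta> (Inr p)))"
    (is "_ = ?S1 + ?S2") using fin by (simp add: sum.Plus)
  also have "?S1 = (\<Sum>p\<in>A. ((\<Prod>i\<in>A. 1 - x i / y p) / (\<Prod>i\<in>A - {p}. 1 - y i / y p) *
            (\<Prod>i\<in>B. (1 - u i * y p) / (1 - v i * y p))) * (prod v B / prod u B))"
  proof (rule sum.cong[OF refl])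
    fix p assume p: "p \<in> A"
    have "(A <+> B) - {Inl p} = (A - {p}) <+> B" by auto
    moreover have "(\<Prod>i\<in>B. 1 - 1 / u i / y p) / (\<Prod>i\<in>B. 1 - 1 / v i / y p) =
        (\<Prod>i\<in>B. (1 - u i * y p) / (1 - v i * y p)) * (prod v B / prod u B)"
      unfolding prod_dividef[symmetric] prod.distrib[symmetric]
    proof (rule prod.cong[OF refl])
      fix i assume i: "i \<in> B"
      have *: "1 - 1 / u i / y p = - (1 - u i * y p) / (u i * y p)" "1 - 1 / v i / y p = - (1 - v i * y p) / (v i * y p)"
        using nz(2)[OF i] nz(1)[OF p] by (auto simp: field_simps)
      have aux: "(- X / (u i * y p)) / (- Y / (v i * y p)) = X / Y * (v i / u i)" for X Y
        using nz(2)[OF i] nz(1)[OF p] by simp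
      show "(1 - 1 / u i / y p) / (1 - 1 / v i / y p) = (1 - u i * y p) / (1 - v i * y p) * (v i / u i)"
        unfolding * by (rule aux)
    qed
    moreover have "(\<Prod>i\<in>A <+> B. 1 - \<alpha> i / \<beta> (Inl p)) / (\<Prod>i\<in>(A - {p}) <+> B. 1 - \<beta> i / \<beta> (Inl p)) =
         ((\<Prod>i\<in>A. 1 - x i / y p) / (\<Prod>i\<in>A - {p}. 1 - y i / y p)) *
         ((\<Prod>i\<in>B. 1 - 1 / u i / y p) / (\<Prod>i\<in>B. 1 - 1 / v i / y p))"
      using fin by (simp add: prod.Plus \<alpha>_def \<beta>_def)
    ultimately show "(\<Prod>i\<in>A <+> B. 1 - \<alpha> i / \<beta> (Inl p)) / (\<Prod>i\<in>(A <+> B) - {Inl p}. 1 - \<beta> i / \<beta> (Inl p)) =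
       ((\<Prod>i\<in>A. 1 - x i / y p) / (\<Prod>i\<in>A - {p}. 1 - y i / y p) *
            (\<Prod>i\<in>B. (1 - u i * y p) / (1 - v i * y p))) * (prod v B / prod u B)"
      by (simp only: mult.assoc)
  qed
  also have "?S2 = (\<Sum>p\<in>B. - (((\<Prod>i\<in>B. 1 - u i / v p) / (\<Prod>i\<in>B - {p}. 1 - v i / v p) *
            (\<Prod>i\<in>A. (1 - x i * v p) / (1 - y i * v p))) * (prod v B / prod u B)))"
  proof (rule sum.cong[OF refl])
    fix p assume p: "p \<in> B"
    have *: "(A <+> B) - {Inr p} = A <+> (B - {p})" by auto
    have 1: "(\<Prod>i\<in>B. 1 - v p / u i) = (\<Prod>i\<in>B. 1 - u i / v p) * (\<Prod>i\<in>B. - v p / u i)"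
      unfolding prod.distrib[symmetric]
      by (rule prod.cong) (use nz(2)[OF p] nz(2) in \<open>auto simp: field_simps\<close>)
    have 2: "(\<Prod>i\<in>B - {p}. 1 - v p / v i) = (\<Prod>i\<in>B - {p}. 1 - v i / v p) * (\<Prod>i\<in>B - {p}. - v p / v i)"
      unfolding prod.distrib[symmetric]
      by (rule prod.cong) (use nz(2)[OF p] nz(2) in \<open>auto simp: field_simps\<close>)
    \<comment> \<open>The factor \<open>i = p\<close> equals -1. Leaving it out produces the sign
      that moves the second family of residues to the other side of the equation.\<close>
    have 3: "(\<Prod>i\<in>B. - v p / v i) = - (\<Prod>i\<in>B - {p}. - v p / v i)"
      using prod.remove[OF fin(2) p, of "\<lambda>i. - v p / v i"] nz(2)[OF p] by simp
    have 4: "(\<Prod>i\<in>B. - v p / u i) = (\<Prod>i\<in>B. - v p / v i) * (prod v B / prod u B)"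
      unfolding prod_dividef[symmetric] prod.distrib[symmetric]
      by (rule prod.cong) (use nz(2) in \<open>auto simp: field_simps\<close>)
    have 5: "(\<Prod>i\<in>B - {p}. - v p / v i) \<noteq> 0" using fin nz(2) p by auto
    have 6: "(\<Prod>i\<in>B. 1 - v p / u i) / (\<Prod>i\<in>B - {p}. 1 - v p / v i) =
       - ((\<Prod>i\<in>B. 1 - u i / v p) / (\<Prod>i\<in>B - {p}. 1 - v i / v p) * (prod v B / prod u B))"
      unfolding 1 2 4 3 using 5 by simp
    have 7: "(\<Prod>i\<in>A. 1 - x i / (1 / v p)) / (\<Prod>i\<in>A. 1 - y i / (1 / v p)) =
        (\<Prod>i\<in>A. (1 - x i * v p) / (1 - y i * v p))" by (simp add: prod_dividef)
    show "(\<Prod>i\<in>A <+> B. 1 - \<alpha> i / \<beta> (Inr p)) / (\<Prod>i\<in>(A <+> B) - {Inr p}. 1 - \<beta> i / \<beta> (Inr p)) =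
       - (((\<Prod>i\<in>B. 1 - u i / v p) / (\<Prod>i\<in>B - {p}. 1 - v i / v p) *
            (\<Prod>i\<in>A. (1 - x i * v p) / (1 - y i * v p))) * (prod v B / prod u B))"
      (is "_ = ?R")
    proof -
      have "(\<Prod>i\<in>A <+> B. 1 - \<alpha> i / \<beta> (Inr p)) / (\<Prod>i\<in>(A <+> B) - {Inr p}. 1 - \<beta> i / \<beta> (Inr p)) =
         ((\<Prod>i\<in>A. 1 - x i / (1 / v p)) / (\<Prod>i\<in>A. 1 - y i / (1 / v p))) *
         ((\<Prod>i\<in>B. 1 - v p / u i) / (\<Prod>i\<in>B - {p}. 1 - v p / v i))"
        unfolding * using fin by (simp add: prod.Plus \<alpha>_def \<beta>_def)
      also have "\<dots> = ?R" unfolding 6 7 by (simp add: mult_ac)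
      finally show ?thesis .
    qed
  qed
  finally have z: "0 = (\<Sum>p\<in>A. (\<Prod>i\<in>A. 1 - x i / y p) / (\<Prod>i\<in>A - {p}. 1 - y i / y p) *
            (\<Prod>i\<in>B. (1 - u i * y p) / (1 - v i * y p))) * (prod v B / prod u B) +
      - ((\<Sum>p\<in>B. (\<Prod>i\<in>B. 1 - u i / v p) / (\<Prod>i\<in>B - {p}. 1 - v i / v p) *
            (\<Prod>i\<in>A. (1 - x i * v p) / (1 - y i * v p))) * (prod v B / prod u B))"
    unfolding sum_distrib_right[symmetric] sum_negf .
  have "prod v B / prod u B * (\<Sum>p\<in>A. (\<Prod>i\<in>A. 1 - x i / y p) / (\<Prod>i\<in>A - {p}. 1 - y i / y p) *
            (\<Prod>i\<in>B. (1 - u i * y p) / (1 - v i * y p))) =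
         prod v B / prod u B * (\<Sum>p\<in>B. (\<Prod>i\<in>B. 1 - u i / v p) / (\<Prod>i\<in>B - {p}. 1 - v i / v p) *
            (\<Prod>i\<in>A. (1 - x i * v p) / (1 - y i * v p)))"
    by (rule aux[OF z])
  moreover have "prod v B / prod u B \<noteq> 0" using nz(2) fin by simp
  ultimately show ?thesis by simp
qed


section \<open>Residues of truncated products and their limit\<close>

definition bounded2 :: "(nat \<Rightarrow> nat \<Rightarrow> complex) \<Rightarrow> bool" where
  "bounded2 F \<longleftrightarrow> (\<exists>C. \<forall>N k. norm (F N k) \<le> C)"

text \<open>With this rule a domination constant for a long product of shifted factorials is
  assembled from constants for its factors.\<close>

lemma bounded2_mult:
  assumes "bounded2 F" "bounded2 G"
  shows "bounded2 (\<lambda>N k. F N k * G N k)"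
proof -
  obtain A B where *: "\<And>N k. norm (F N k) \<le> A" "\<And>N k. norm (G N k) \<le> B"
    using assms by (auto simp: bounded2_def)
  have "A \<ge> 0" using *(1) norm_ge_zero order_trans by blast
  then have "norm (F N k * G N k) \<le> A * B" for N k
    unfolding norm_mult by (intro mult_mono *) auto
  then show ?thesis by (auto simp: bounded2_def)
qed

lemma bounded2_prod:
  fixes m :: nat
  assumes "\<And>i. i < m \<Longrightarrow> bounded2 (F i)"
  shows "bounded2 (\<lambda>N k. \<Prod>i<m. F i N k)"
  using assms
proof (induction m)
  case 0
  show ?case by (auto simp: bounded2_def)
next
  case (Suc m)
  then show ?case by (simp add: bounded2_mult)
qed

text \<open>The residues at \<open>y p * q ^ k\<close> of
  \<open>\<Prod>i (x i / z; q)\<^sub>\<infinity> / (y i / z; q)\<^sub>\<infinity> * \<Prod>i (u i * z; q)\<^sub>\<infinity> / (v i * z; q)\<^sub>\<infinity>\<close> and of its truncation.\<close>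

definition residue_term ::
  "complex \<Rightarrow> nat \<Rightarrow> (nat \<Rightarrow> complex) \<Rightarrow> (nat \<Rightarrow> complex) \<Rightarrow> nat \<Rightarrow> (nat \<Rightarrow> complex) \<Rightarrow> (nat \<Rightarrow> complex) \<Rightarrow> nat \<Rightarrow> nat \<Rightarrow> complex"
  where "residue_term q m x y n u v p k = q ^ k *
    (\<Prod>i<m. qpoch (q * y p / x i) q k * qpoch_inf (x i / y p) q *
        (inverse (qpoch (q * y p / y i) q k) * inverse (if i = p then qpoch_inf q q else qpoch_inf (y i / y p) q))) *
    (\<Prod>i<n. qpoch_inf (u i * y p * q ^ k) q * inverse (qpoch_inf (v i * y p * q ^ k) q))"

definition residue_trunc ::
  "complex \<Rightarrow> nat \<Rightarrow> (nat \<Rightarrow> complex) \<Rightarrow> (nat \<Rightarrow> complex) \<Rightarrow> nat \<Rightarrow> (nat \<Rightarrow> complex) \<Rightarrow> (nat \<Rightarrow> complex) \<Rightarrow> nat \<Rightarrow> nat \<Rightarrow> nat \<Rightarrow> complex"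
  where "residue_trunc q m x y n u v N p k = q ^ k *
    ((\<Prod>i<m. qpoch (q * y p / x i) q k * qpoch (x i / y p) q (N - k) *
        (inverse (qpoch (q * y p / y i) q k) * inverse (if i = p then qpoch q q (N - k - 1) else qpoch (y i / y p) q (N - k)))) *
    (\<Prod>i<n. qpoch (u i * y p * q ^ k) q N * inverse (qpoch (v i * y p * q ^ k) q N)))"

context
  fixes q :: complex
  assumes q0: "q \<noteq> 0" and q1: "norm q < 1"
begin

lemma bounded2_qpoch:
  "bounded2 (\<lambda>N k. qpoch a q (s N k))"
  "bounded2 (\<lambda>N k. qpoch (a * q ^ r N k) q (s N k))"
proof -
  show "bounded2 (\<lambda>N k. qpoch a q (s N k))"
    unfolding bounded2_def using norm_qpoch_le[OF q1 order_refl] by blast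
  have "norm (a * q ^ k) \<le> norm a" for k
    using q1 by (simp add: norm_mult norm_power mult_left_le power_le_one)
  then show "bounded2 (\<lambda>N k. qpoch (a * q ^ r N k) q (s N k))"
    unfolding bounded2_def using norm_qpoch_le[OF q1] by blast
qed

lemma bounded2_inverse_qpoch:
  assumes "qpoch_inf a q \<noteq> 0"
  shows "bounded2 (\<lambda>N k. inverse (qpoch a q (s N k)))"
    "bounded2 (\<lambda>N k. inverse (qpoch (a * q ^ r N k) q (s N k)))"
proof -
  define c where "c = norm (qpoch_inf a q) / qbound q (norm a)"
  have c: "c > 0" using assms by (simp add: c_def)
  have 1: "c \<le> norm (qpoch a q n)" for n
    unfolding c_def by (rule norm_qpoch_ge[OF q1 order_refl])
  show "bounded2 (\<lambda>N k. inverse (qpoch a q (s N k)))"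
    unfolding bounded2_def norm_inverse
    by (intro exI[of _ "inverse c"] allI le_imp_inverse_le 1 c)
  have 2: "c / qbound q (norm a) \<le> norm (qpoch (a * q ^ k) q n)" for n k
  proof -
    have "norm (a * q ^ k) \<le> norm a"
      using q1 by (simp add: norm_mult norm_power mult_left_le power_le_one)
    then have "norm (qpoch_inf (a * q ^ k) q) / qbound q (norm a) \<le> norm (qpoch (a * q ^ k) q n)"
      by (rule norm_qpoch_ge[OF q1])
    moreover have "c \<le> norm (qpoch_inf (a * q ^ k) q)"
      unfolding c_def by (rule norm_qpoch_inf_ge[OF q1 order_refl])
    ultimately show ?thesis
      by (meson divide_right_mono order_trans qbound_pos(2))
  qed
  show "bounded2 (\<lambda>N k. inverse (qpoch (a * q ^ r N k) q (s N k)))"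
    unfolding bounded2_def norm_inverse
    by (intro exI[of _ "inverse (c / qbound q (norm a))"] allI le_imp_inverse_le 2) (use c in simp)
qed

text \<open>This is the family of factors to which the pole itself belongs, without the factor that
  vanishes there; hence one factor fewer than \<open>N - k\<close> in the second part.\<close>

lemma prod_remove_power:
  assumes "k < N"
  shows "(\<Prod>j\<in>{..<N} - {k}. 1 - q ^ j / q ^ k) = qpoch (1 / q ^ k) q k * qpoch q q (N - k - 1)"
proof -
  have eq: "{..<N} - {k} = {..<k} \<union> {k<..<N}" using assms by auto
  have "(\<Prod>j\<in>{..<N} - {k}. 1 - q ^ j / q ^ k) =
      (\<Prod>j<k. 1 - q ^ j / q ^ k) * (\<Prod>j\<in>{k<..<N}. 1 - q ^ j / q ^ k)"
    unfolding eq by (rule prod.union_disjoint) auto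
  also have "(\<Prod>j\<in>{k<..<N}. 1 - q ^ j / q ^ k) = (\<Prod>j<N - k - 1. 1 - q * q ^ j)"
  proof (rule prod.reindex_bij_witness[of _ "\<lambda>j. j + k + 1" "\<lambda>j. j - k - 1"])
    fix j assume "j \<in> {k<..<N}"
    then have j: "j = Suc (j - k - 1) + k" by auto
    have "q ^ j = q ^ Suc (j - k - 1) * q ^ k"
      unfolding power_add[symmetric] j[symmetric] ..
    then show "1 - q * q ^ (j - k - 1) = 1 - q ^ j / q ^ k" using q0 by simp
  qed auto
  finally show ?thesis by (simp add: qpoch_def)
qed

lemma qpoch_div_power_split:
  assumes "k \<le> N" "x \<noteq> 0"
  shows "qpoch (x / q ^ k) q N = x ^ k * (\<Prod>j<k. - 1 / q ^ Suc j) * qpoch (q / x) q k * qpoch x q (N - k)"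
proof -
  have "qpoch (x / q ^ k) q (k + (N - k)) = qpoch (x / q ^ k) q k * qpoch x q (N - k)"
    unfolding qpoch_add using q0 by simp
  then show ?thesis using assms qpoch_div_power[OF assms(2) q0] by simp
qed

text \<open>At the pole \<open>y p * q ^ k\<close> the first \<open>k\<close> factors of each inner
  product are reflected by \<open>qpoch_div_power\<close>, and the other \<open>N - k\<close> remain
  as they are. The reflection contributes powers of \<open>x i / y p\<close> and
  \<open>y i / y p\<close> whose quotients multiply to \<open>q ^ k\<close> by
  \<open>bal\<close>.\<close>

lemma residue_trunc_eq:
  assumes p: "p < m" and k: "k < N"
    and nz: "\<And>i. i < m \<Longrightarrow> x i \<noteq> 0 \<and> y i \<noteq> 0" and bal: "prod x {..<m} = q * prod y {..<m}"
  shows "(\<Prod>(i, j)\<in>{..<m} \<times> {..<N}. 1 - x i * q ^ j / (y p * q ^ k)) /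
    (\<Prod>(i, j)\<in>{..<m} \<times> {..<N} - {(p, k)}. 1 - y i * q ^ j / (y p * q ^ k)) *
    (\<Prod>(i, j)\<in>{..<n} \<times> {..<N}. (1 - u i * q ^ j * (y p * q ^ k)) / (1 - v i * q ^ j * (y p * q ^ k)))
   = residue_trunc q m x y n u v N p k"
proof -
  let ?own = "\<lambda>i. if i = p then qpoch q q (N - k - 1) else qpoch (y i / y p) q (N - k)"
  let ?num = "\<lambda>i. qpoch (q * y p / x i) q k * qpoch (x i / y p) q (N - k)"
  define e where "e = (\<Prod>j<k. - 1 / q ^ Suc j)"
  have e0: "e \<noteq> 0" using q0 by (simp add: e_def)
  have yp: "y p \<noteq> 0" using nz[OF p] by simp
  have P: "(\<Prod>j<N. 1 - s * q ^ j / (t * q ^ k)) =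
      (s / t) ^ k * e * (qpoch (q * t / s) q k * qpoch (s / t) q (N - k))" if "s \<noteq> 0" "t \<noteq> 0" for s t
  proof -
    have "(\<Prod>j<N. 1 - s * q ^ j / (t * q ^ k)) = qpoch (s / t / q ^ k) q N"
      by (simp add: qpoch_def)
    also have "\<dots> = (s / t) ^ k * e * qpoch (q / (s / t)) q k * qpoch (s / t) q (N - k)"
      unfolding e_def by (rule qpoch_div_power_split) (use that k in auto)
    finally show ?thesis by (simp add: mult.assoc)
  qed
  have X: "(\<Prod>j<N. 1 - x i * q ^ j / (y p * q ^ k)) =
      (x i / y p) ^ k * e * ?num i" if "i < m" for i
    using P[of "x i" "y p"] nz[OF that] yp by simp
  define S where "S i = (if i = p then {..<N} - {k} else {..<N})" for i
  have Y: "(\<Prod>j\<in>S i. 1 - y i * q ^ j / (y p * q ^ k)) =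
      (y i / y p) ^ k * e * (qpoch (q * y p / y i) q k * ?own i)"
    if "i < m" for i
  proof (cases "i = p")
    case True
    then have "(\<Prod>j\<in>S i. 1 - y i * q ^ j / (y p * q ^ k)) = (\<Prod>j\<in>{..<N} - {k}. 1 - q ^ j / q ^ k)"
      using yp by (simp add: S_def)
    then show ?thesis
      unfolding prod_remove_power[OF k] qpoch_div_power[of 1, OF one_neq_zero q0] using True yp by (simp add: e_def)
  next
    case False
    then show ?thesis
      using P[of "y i" "y p"] nz[OF that] yp by (simp add: S_def)
  qed
  have set: "{..<m} \<times> {..<N} - {(p, k)} = Sigma {..<m} S"
    by (auto simp: S_def split: if_splits)
  have U: "(\<Prod>j<N. (1 - u i * q ^ j * (y p * q ^ k)) / (1 - v i * q ^ j * (y p * q ^ k))) =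
      qpoch (u i * y p * q ^ k) q N * inverse (qpoch (v i * y p * q ^ k) q N)" for i
    by (simp add: qpoch_def prod_dividef mult_ac flip: divide_inverse)
  have "(\<Prod>i<m. (x i / y p) ^ k * e * ?num i) /
     (\<Prod>i<m. (y i / y p) ^ k * e * (qpoch (q * y p / y i) q k * ?own i))
    = (\<Prod>i<m. (x i / y i) ^ k * (?num i *
        (inverse (qpoch (q * y p / y i) q k) * inverse (?own i))))"
    unfolding prod_dividef[symmetric]
  proof (rule prod.cong[OF refl])
    fix i assume "i \<in> {..<m}"
    then have "y i \<noteq> 0" using nz by auto
    then have aux: "(x i / y p) ^ k * e * A / ((y i / y p) ^ k * e * (B * C)) = (x i / y i) ^ k * (A * (inverse B * inverse C))" for A B C
    proof -
      have *: "(x i / y p) ^ k = (x i / y i) ^ k * (y i / y p) ^ k"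
        using \<open>y i \<noteq> 0\<close> by (simp flip: power_mult_distrib)
      have "R * W * e * A / (W * e * (B * C)) = R * (A * (inverse B * inverse C))" if "W \<noteq> 0" for R W
        using that e0 by (simp add: divide_inverse mult_ac)
      then show ?thesis unfolding * using \<open>y i \<noteq> 0\<close> yp by simp
    qed
    show "(x i / y p) ^ k * e * ?num i /
      ((y i / y p) ^ k * e * (qpoch (q * y p / y i) q k * ?own i)) =
      (x i / y i) ^ k * (?num i *
        (inverse (qpoch (q * y p / y i) q k) * inverse (?own i)))"
      by (rule aux)
  qed
  moreover have "(\<Prod>i<m. (x i / y i) ^ k) = q ^ k"
  proof -
    have "prod y {..<m} \<noteq> 0" using nz by simp
    then have "(\<Prod>i<m. x i / y i) = q" using bal by (simp add: prod_dividef)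
    then show ?thesis by (simp flip: prod_power_distrib)
  qed
  ultimately have R: "(\<Prod>i<m. \<Prod>j<N. 1 - x i * q ^ j / (y p * q ^ k)) / (\<Prod>i<m. \<Prod>j\<in>S i. 1 - y i * q ^ j / (y p * q ^ k)) =
     q ^ k * (\<Prod>i<m. ?num i *
        (inverse (qpoch (q * y p / y i) q k) * inverse (?own i)))"
    using prod.cong[OF refl X, of "{..<m}"] prod.cong[OF refl Y, of "{..<m}"]
    by (simp only: prod.distrib lessThan_iff)
  have "(\<Prod>(i, j)\<in>{..<m} \<times> {..<N}. 1 - x i * q ^ j / (y p * q ^ k)) = (\<Prod>i<m. \<Prod>j<N. 1 - x i * q ^ j / (y p * q ^ k))"
    by (rule prod.cartesian_product[symmetric])
  moreover have "(\<Prod>(i, j)\<in>Sigma {..<m} S. 1 - y i * q ^ j / (y p * q ^ k)) = (\<Prod>i<m. \<Prod>j\<in>S i. 1 - y i * q ^ j / (y p * q ^ k))"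
    by (rule prod.Sigma[symmetric]) (auto simp: S_def)
  moreover have "(\<Prod>(i, j)\<in>{..<n} \<times> {..<N}. (1 - u i * q ^ j * (y p * q ^ k)) / (1 - v i * q ^ j * (y p * q ^ k))) =
     (\<Prod>i<n. qpoch (u i * y p * q ^ k) q N * inverse (qpoch (v i * y p * q ^ k) q N))"
    unfolding U[symmetric] by (rule prod.cartesian_product[symmetric])
  ultimately show ?thesis
    unfolding set residue_trunc_def by (simp only: R mult.assoc)
qed

text \<open>The factor \<open>q ^ k\<close> coming from the balance is the summable majorant; all
  other factors are bounded uniformly in \<open>N\<close> and \<open>k\<close>, since no infinite
  product in a denominator vanishes.\<close>

lemma residue_trunc_tendsto:
  assumes p: "p < m"
    and y: "\<And>i. i < m \<Longrightarrow> i \<noteq> p \<Longrightarrow> qpoch_inf (y i / y p) q \<noteq> 0 \<and> qpoch_inf (y p / y i) q \<noteq> 0"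
    and yp: "y p \<noteq> 0"
    and v: "\<And>i. i < n \<Longrightarrow> qpoch_inf (v i * y p) q \<noteq> 0"
  shows "(\<lambda>N. \<Sum>k<N. residue_trunc q m x y n u v N p k) \<longlonglongrightarrow> (\<Sum>k. residue_term q m x y n u v p k)"
proof -
  have yq: "qpoch_inf (q * y p / y i) q \<noteq> 0" if "i < m" for i
  proof (cases "i = p")
    case True
    then show ?thesis using qpoch_q_nz[OF q1] yp by simp
  next
    case False
    then show ?thesis
      using y[OF that] qpoch_inf_split[OF q1, of "y p / y i" 1] by (auto simp: mult_ac)
  qed
  define F where "F N k = (\<Prod>i<m. qpoch (q * y p / x i) q k * qpoch (x i / y p) q (N - k) *
        (inverse (qpoch (q * y p / y i) q k) * inverse (if i = p then qpoch q q (N - k - 1) else qpoch (y i / y p) q (N - k)))) *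
    (\<Prod>i<n. qpoch (u i * y p * q ^ k) q N * inverse (qpoch (v i * y p * q ^ k) q N))" for N k
  have "bounded2 F"
    unfolding F_def
  proof (intro bounded2_mult bounded2_prod bounded2_qpoch)
    fix i assume i: "i < m"
    show "bounded2 (\<lambda>N k. inverse (qpoch (q * y p / y i) q k))"
      by (rule bounded2_inverse_qpoch[OF yq[OF i]])
    show "bounded2 (\<lambda>N k. inverse (if i = p then qpoch q q (N - k - 1) else qpoch (y i / y p) q (N - k)))"
      by (cases "i = p") (simp_all add: bounded2_inverse_qpoch y[OF i] qpoch_q_nz[OF q1])
  next
    fix i assume i: "i < n"
    show "bounded2 (\<lambda>N k. inverse (qpoch (v i * y p * q ^ k) q N))"
      by (rule bounded2_inverse_qpoch[OF v[OF i]])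
  qed
  then obtain C where C: "\<And>N k. norm (F N k) \<le> C" by (auto simp: bounded2_def)
  have C0: "C \<ge> 0" using C norm_ge_zero order_trans by blast
  \<comment> \<open>The finite sum is extended by zeros to a series over all \<open>k\<close>, the
    form that dominated convergence requires.\<close>
  have lim: "(\<lambda>N. \<Sum>k. if k < N then residue_trunc q m x y n u v N p k else 0) \<longlonglongrightarrow>
     (\<Sum>k. residue_term q m x y n u v p k)"
  proof (rule tannery_sequence[where M = "\<lambda>k. C * norm q ^ k"])
    fix k
    have sub: "(\<lambda>N. qpoch a q (N - l)) \<longlonglongrightarrow> qpoch_inf a q" for a l
      by (rule LIMSEQ_offset[where k = l]) (simp add: qpoch_tendsto q1)
    have inv: "(\<lambda>N. inverse (if i = p then qpoch q q (N - k - 1) else qpoch (y i / y p) q (N - k)))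
        \<longlonglongrightarrow> inverse (if i = p then qpoch_inf q q else qpoch_inf (y i / y p) q)" if "i < m" for i
      using sub[of q "k + 1"] sub[of "y i / y p" k] y[OF that] qpoch_q_nz[OF q1]
      by (cases "i = p") (auto intro!: tendsto_inverse)
    have v': "qpoch_inf (v i * y p * q ^ k) q \<noteq> 0" if "i < n" for i
      using v[OF that] qpoch_inf_split[OF q1, of "v i * y p" k] by auto
    have "(\<lambda>N. residue_trunc q m x y n u v N p k) \<longlonglongrightarrow> residue_term q m x y n u v p k"
      unfolding residue_trunc_def residue_term_def mult.assoc[of "q ^ k"]
      by (intro tendsto_intros sub inv qpoch_tendsto q1 v') auto
    moreover have "eventually (\<lambda>N. residue_trunc q m x y n u v N p k =
        (if k < N then residue_trunc q m x y n u v N p k else 0)) sequentially"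
      using eventually_gt_at_top[of k] by eventually_elim simp
    ultimately show "(\<lambda>N. if k < N then residue_trunc q m x y n u v N p k else 0) \<longlonglongrightarrow> residue_term q m x y n u v p k"
      by (rule Lim_transform_eventually)
    have "norm (residue_trunc q m x y n u v N p k) \<le> C * norm q ^ k" for N k
      unfolding residue_trunc_def F_def[symmetric] norm_mult norm_power
      using mult_right_mono[OF C[of N k], of "norm q ^ k"] by (simp add: mult.commute)
    then show "eventually (\<lambda>N. \<forall>k. norm (if k < N then residue_trunc q m x y n u v N p k else 0)
        \<le> C * norm q ^ k) sequentially"
      using C0 by (intro always_eventually) auto
    show "summable (\<lambda>k. C * norm q ^ k)" using q1 by (intro summable_mult) auto
  qed
  have "(\<Sum>k. if k < N then residue_trunc q m x y n u v N p k else 0) = (\<Sum>k<N. residue_trunc q m x y n u v N p k)" for N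
    using suminf_finite[of "{..<N}" "\<lambda>k. if k < N then residue_trunc q m x y n u v N p k else 0"] by simp
  with lim show ?thesis by simp
qed

text \<open>Two coinciding points would make a quotient \<open>s i / s j\<close> a power of q with
  exponent at most 0, which is a zero of the infinite product. For equal indices q would be a root
  of unity. Applied to \<open>y\<close> and \<open>v\<close>, this makes the poles simple.\<close>

lemma mult_power_eq_cancel:
  fixes s :: "nat \<Rightarrow> complex"
  assumes eq: "s i * q ^ k = s j * q ^ l" and ij: "i < m" "j < m" and s0: "\<And>i. i < m \<Longrightarrow> s i \<noteq> 0"
    and s: "\<And>i j. i < m \<Longrightarrow> j < m \<Longrightarrow> i \<noteq> j \<Longrightarrow> qpoch_inf (s i / s j) q \<noteq> 0"
  shows "i = j \<and> k = l"
proof -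
  have main: "i = j \<and> k = l" if eq: "s i * q ^ k = s j * q ^ l" and ij: "i < m" "j < m" and le: "l \<le> k" for i j k l
  proof -
    have "q ^ k = q ^ ((k - l) + l)" using le by simp
    then have "q ^ k = q ^ (k - l) * q ^ l" unfolding power_add .
    then have "s i * q ^ (k - l) = s j" using eq q0 by simp
    then have e: "s i / s j * q ^ (k - l) = 1" using s0[OF ij(2)] by (simp add: field_simps)
    then have "qpoch_inf (s i / s j) q = 0" using qpoch_inf_eq_0_iff[OF q1] by blast
    then have i: "i = j" using s ij by blast
    then have "q ^ (k - l) = 1" using e s0[OF ij(2)] by simp
    then have n: "norm q ^ (k - l) = 1" by (metis norm_one norm_power)
    have "k - l = 0"
    proof (rule ccontr)
      assume "k - l \<noteq> 0"
      then have "norm q ^ (k - l) < 1 ^ (k - l)" using q1 by (intro power_strict_mono) auto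
      then show False using n by simp
    qed
    then show ?thesis using i le by simp
  qed
  show ?thesis
  proof (cases "l \<le> k")
    case True
    then show ?thesis using main[OF eq ij] by simp
  next
    case False
    then show ?thesis using main[OF eq[symmetric] ij(2,1)] by simp
  qed
qed

text \<open>With \<open>N\<close> factors of every product, the poles are indexed by pairs of a
  family and an exponent below \<open>N\<close>, and \<open>sum_residues_two_sided\<close> applies
  to these pairs. Both sides then converge as \<open>N\<close> grows.\<close>

theorem sum_residue_series:
  fixes x y u v :: "nat \<Rightarrow> complex"
  assumes nz: "\<And>i. i < m \<Longrightarrow> x i \<noteq> 0 \<and> y i \<noteq> 0" "\<And>i. i < n \<Longrightarrow> u i \<noteq> 0 \<and> v i \<noteq> 0"
    and bal: "prod x {..<m} = q * prod y {..<m}" "prod u {..<n} = q * prod v {..<n}"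
    and y: "\<And>i j. i < m \<Longrightarrow> j < m \<Longrightarrow> i \<noteq> j \<Longrightarrow> qpoch_inf (y i / y j) q \<noteq> 0"
    and v: "\<And>i j. i < n \<Longrightarrow> j < n \<Longrightarrow> i \<noteq> j \<Longrightarrow> qpoch_inf (v i / v j) q \<noteq> 0"
    and vy: "\<And>i j. i < m \<Longrightarrow> j < n \<Longrightarrow> qpoch_inf (v j * y i) q \<noteq> 0"
  shows "(\<Sum>p<m. \<Sum>k. residue_term q m x y n u v p k) = (\<Sum>p<n. \<Sum>k. residue_term q n u v m x y p k)"
proof (rule LIMSEQ_unique)
  show "(\<lambda>N. \<Sum>p<m. \<Sum>k<N. residue_trunc q m x y n u v N p k) \<longlonglongrightarrow> (\<Sum>p<m. \<Sum>k. residue_term q m x y n u v p k)"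
    by (intro tendsto_sum residue_trunc_tendsto) (use nz y vy in auto)
  have "(\<lambda>N. \<Sum>p<n. \<Sum>k<N. residue_trunc q n u v m x y N p k) \<longlonglongrightarrow> (\<Sum>p<n. \<Sum>k. residue_term q n u v m x y p k)"
    by (intro tendsto_sum residue_trunc_tendsto) (use nz v vy in \<open>auto simp: mult.commute\<close>)
  moreover have "(\<lambda>N. \<Sum>p<m. \<Sum>k<N. residue_trunc q m x y n u v N p k) = (\<lambda>N. \<Sum>p<n. \<Sum>k<N. residue_trunc q n u v m x y N p k)"
  proof
    fix N
    let ?inner = "\<lambda>p k. (\<Prod>(i, j)\<in>{..<m} \<times> {..<N}. 1 - x i * q ^ j / (y p * q ^ k)) /
        (\<Prod>(i, j)\<in>{..<m} \<times> {..<N} - {(p, k)}. 1 - y i * q ^ j / (y p * q ^ k)) *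
        (\<Prod>(i, j)\<in>{..<n} \<times> {..<N}. (1 - u i * q ^ j * (y p * q ^ k)) / (1 - v i * q ^ j * (y p * q ^ k)))"
    let ?outer = "\<lambda>p k. (\<Prod>(i, j)\<in>{..<n} \<times> {..<N}. 1 - u i * q ^ j / (v p * q ^ k)) /
        (\<Prod>(i, j)\<in>{..<n} \<times> {..<N} - {(p, k)}. 1 - v i * q ^ j / (v p * q ^ k)) *
        (\<Prod>(i, j)\<in>{..<m} \<times> {..<N}. (1 - x i * q ^ j * (v p * q ^ k)) / (1 - y i * q ^ j * (v p * q ^ k)))"
    have "(\<Sum>p<m. \<Sum>k<N. residue_trunc q m x y n u v N p k) =
      (\<Sum>(p, k)\<in>{..<m} \<times> {..<N}. ?inner p k)"
      unfolding sum.cartesian_product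
    proof (rule sum.cong[OF refl])
      fix t assume "t \<in> {..<m} \<times> {..<N}"
      then obtain p k where t: "t = (p, k)" "p < m" "k < N" by auto
      show "(case t of (p, k) \<Rightarrow> residue_trunc q m x y n u v N p k) =
        (case t of (p, k) \<Rightarrow> ?inner p k)"
        unfolding t prod.case by (rule residue_trunc_eq[symmetric]) (fact t nz bal)+
    qed
    also have "\<dots> = (\<Sum>(p, k)\<in>{..<n} \<times> {..<N}. ?outer p k)"
      unfolding case_prod_unfold prod.collapse
    proof (rule sum_residues_two_sided)
      show "inj_on (\<lambda>t. y (fst t) * q ^ snd t) ({..<m} \<times> {..<N})"
      proof (rule inj_onI)
        fix s t assume "s \<in> {..<m} \<times> {..<N}" "t \<in> {..<m} \<times> {..<N}" "y (fst s) * q ^ snd s = y (fst t) * q ^ snd t"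
        then have "fst s = fst t \<and> snd s = snd t"
          by (intro mult_power_eq_cancel[of y _ _ _ _ m]) (use nz y in auto)
        then show "s = t" by (simp add: prod_eq_iff)
      qed
      show "inj_on (\<lambda>t. v (fst t) * q ^ snd t) ({..<n} \<times> {..<N})"
      proof (rule inj_onI)
        fix s t assume "s \<in> {..<n} \<times> {..<N}" "t \<in> {..<n} \<times> {..<N}" "v (fst s) * q ^ snd s = v (fst t) * q ^ snd t"
        then have "fst s = fst t \<and> snd s = snd t"
          by (intro mult_power_eq_cancel[of v _ _ _ _ n]) (use nz v in auto)
        then show "s = t" by (simp add: prod_eq_iff)
      qed
      show "y (fst s) * q ^ snd s * (v (fst t) * q ^ snd t) \<noteq> 1" if "s \<in> {..<m} \<times> {..<N}" "t \<in> {..<n} \<times> {..<N}" for s t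
      proof
        assume "y (fst s) * q ^ snd s * (v (fst t) * q ^ snd t) = 1"
        then have "v (fst t) * y (fst s) * q ^ (snd s + snd t) = 1" by (simp add: power_add mult_ac)
        then have "qpoch_inf (v (fst t) * y (fst s)) q = 0" using qpoch_inf_eq_0_iff[OF q1] by blast
        then show False using vy that by auto
      qed
      \<comment> \<open>Truncation raises both balance relations to the power \<open>N\<close>, so
        each side of the required identity gains the same factor \<open>q ^ N\<close>.\<close>
      have pw: "(\<Prod>t\<in>{..<m} \<times> {..<N}. s (fst t) * q ^ snd t) = prod s {..<m} ^ N * (\<Prod>j<N. q ^ j) ^ m"
        for s :: "nat \<Rightarrow> complex" and m
      proof -
        have "(\<Prod>t\<in>{..<m} \<times> {..<N}. s (fst t) * q ^ snd t) = (\<Prod>i<m. \<Prod>j<N. s i * q ^ j)"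
          by (simp add: prod.cartesian_product case_prod_unfold)
        also have "\<dots> = prod s {..<m} ^ N * (\<Prod>j<N. q ^ j) ^ m"
          by (simp add: prod.distrib power_mult flip: prod_power_distrib)
        finally show ?thesis .
      qed
      show "(\<Prod>t\<in>{..<m} \<times> {..<N}. x (fst t) * q ^ snd t) * (\<Prod>t\<in>{..<n} \<times> {..<N}. v (fst t) * q ^ snd t) =
        (\<Prod>t\<in>{..<m} \<times> {..<N}. y (fst t) * q ^ snd t) * (\<Prod>t\<in>{..<n} \<times> {..<N}. u (fst t) * q ^ snd t)"
        unfolding pw bal by (simp only: power_mult_distrib mult_ac)
    qed (use nz q0 in \<open>simp_all add: mem_Times_iff\<close>)
    also have "\<dots> = (\<Sum>p<n. \<Sum>k<N. residue_trunc q n u v m x y N p k)"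
      unfolding sum.cartesian_product
    proof (rule sum.cong[OF refl])
      fix t assume "t \<in> {..<n} \<times> {..<N}"
      then obtain p k where t: "t = (p, k)" "p < n" "k < N" by auto
      show "(case t of (p, k) \<Rightarrow> ?outer p k) =
        (case t of (p, k) \<Rightarrow> residue_trunc q n u v m x y N p k)"
        unfolding t prod.case by (rule residue_trunc_eq) (fact t nz bal)+
    qed
    finally show "(\<Sum>p<m. \<Sum>k<N. residue_trunc q m x y n u v N p k) = (\<Sum>p<n. \<Sum>k<N. residue_trunc q n u v m x y N p k)" .
  qed
  ultimately show "(\<lambda>N. \<Sum>p<m. \<Sum>k<N. residue_trunc q m x y n u v N p k) \<longlonglongrightarrow> (\<Sum>p<n. \<Sum>k. residue_term q n u v m x y p k)"
    by (simp only:)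
qed

end

subsection \<open>The nonterminating \<open>q\<close>-Saalschuetz sum\<close>

text \<open>Half of a Jackson \<open>q\<close>-integral, without the usual factor \<open>1 - q\<close>.\<close>

definition jackson_half :: "complex \<Rightarrow> complex \<Rightarrow> (complex \<Rightarrow> complex) \<Rightarrow> complex" where
  "jackson_half q c G = (\<Sum>k. q ^ k * c * G (q ^ k * c))"

definition jackson :: "complex \<Rightarrow> complex \<Rightarrow> (complex \<Rightarrow> complex) \<Rightarrow> complex" where
  "jackson q l G = jackson_half q 1 G - jackson_half q (1 / l) G"

text \<open>The integrand of the nonterminating q-Saalschuetz sum for the Jackson integral from 1 /
  l to 1. The parameter \<open>d * e * f / l\<close> in the numerator expresses the balancing
  condition.\<close>

definition saal :: "complex \<Rightarrow> complex \<Rightarrow> complex \<Rightarrow> complex \<Rightarrow> complex \<Rightarrow> complex \<Rightarrow> complex" where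
  "saal q l d e f w = qpoch_inf (q * w) q * qpoch_inf (q * l * w) q * qpoch_inf (d * e * f / l * w) q *
     inverse (qpoch_inf (d * w) q * qpoch_inf (e * w) q * qpoch_inf (f * w) q)"

text \<open>The factor (d w; q) in a denominator has no zero on the lattices q ^ k and q ^ k /
  l.\<close>

definition regular :: "complex \<Rightarrow> complex \<Rightarrow> complex \<Rightarrow> bool" where
  "regular q l d \<longleftrightarrow> qpoch_inf d q \<noteq> 0 \<and> qpoch_inf (d / l) q \<noteq> 0"

context
  fixes q :: complex
  assumes q0: "q \<noteq> 0" and q1: "norm q < 1"
begin

lemma tendsto_mult_power: "(\<lambda>k. a * q ^ k * b) \<longlonglongrightarrow> 0"
proof -
  have "(\<lambda>k. a * q ^ k * b) \<longlonglongrightarrow> a * 0 * b"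
    by (intro tendsto_intros LIMSEQ_power_zero q1)
  then show ?thesis by simp
qed

lemma qpoch_inf_power_tendsto: "(\<lambda>k. qpoch_inf (a * q ^ k * b) q) \<longlonglongrightarrow> 1"
  using tendsto_qpoch_inf[OF q1 tendsto_mult_power] by (simp add: qpoch_inf_zero)

lemma summable_power_mult_tendsto:
  assumes "X \<longlonglongrightarrow> (x :: complex)"
  shows "summable (\<lambda>k. q ^ k * c * X k)"
proof -
  obtain K where K: "\<And>n. norm (X n) \<le> K"
    using convergent_imp_Bseq[OF convergentI[OF assms]] by (auto simp: Bseq_def)
  show ?thesis
  proof (rule summable_comparison_test')
    show "summable (\<lambda>k. norm q ^ k * (norm c * K))" using q1 by (intro summable_mult2) auto
    show "norm (q ^ k * c * X k) \<le> norm q ^ k * (norm c * K)" for k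
      unfolding norm_mult norm_power mult.assoc by (intro mult_left_mono K) auto
  qed
qed

lemma bounded2_qpoch_inf: "bounded2 (\<lambda>n k. qpoch_inf (a * q ^ s n k) q)"
proof -
  have "norm (a * q ^ k) \<le> norm a" for k
    using q1 by (simp add: norm_mult norm_power mult_left_le power_le_one)
  then show ?thesis unfolding bounded2_def using norm_qpoch_inf_le[OF q1] by blast
qed

lemma bounded2_inverse_qpoch_inf:
  assumes "qpoch_inf a q \<noteq> 0"
  shows "bounded2 (\<lambda>n k. inverse (qpoch_inf (a * q ^ s n k) q))"
  unfolding bounded2_def norm_inverse
  by (intro exI[of _ "inverse (norm (qpoch_inf a q) / qbound q (norm a))"] allI le_imp_inverse_le
       norm_qpoch_inf_ge[OF q1 order_refl]) (use assms in simp)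

lemma qpoch_inf_step: "qpoch_inf a q = (1 - a) * qpoch_inf (q * a) q"
  using qpoch_inf_split[OF q1, of a 1] by (simp add: qpoch_Suc mult.commute)

lemma qpoch_inf_shift_nz:
  assumes "qpoch_inf a q \<noteq> 0"
  shows "qpoch_inf (a * q ^ k) q \<noteq> 0" "qpoch_inf (q ^ k * a) q \<noteq> 0"
  using assms qpoch_inf_split[OF q1, of a k] by (auto simp: mult.commute)

lemma saal_commute: "saal q l d e f = saal q l e d f" "saal q l d e f = saal q l d f e"
  by (auto simp: saal_def fun_eq_iff mult_ac)

lemma saal_summable:
  assumes "qpoch_inf (d * c) q \<noteq> 0" "qpoch_inf (e * c) q \<noteq> 0" "qpoch_inf (f * c) q \<noteq> 0"
  shows "summable (\<lambda>k. q ^ k * c * saal q l d e f (q ^ k * c))"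
proof -
  have *: "(\<lambda>k. qpoch_inf (a * (q ^ k * c)) q) \<longlonglongrightarrow> 1" for a
    using qpoch_inf_power_tendsto[of a c] by (simp add: mult.assoc)
  have "(\<lambda>k. saal q l d e f (q ^ k * c)) \<longlonglongrightarrow> 1 * 1 * 1 * inverse (1 * 1 * 1)"
    unfolding saal_def by (intro tendsto_intros *) auto
  then show ?thesis by (rule summable_power_mult_tendsto)
qed

text \<open>Summing the \<open>q\<close>-difference of \<open>(w, l w, d e f w / l) / (d w, e w, f w)\<close>.\<close>
lemma saal_half_recurrence:
  assumes l: "l \<noteq> 0" and nz: "qpoch_inf (d * c) q \<noteq> 0" "qpoch_inf (e * c) q \<noteq> 0" "qpoch_inf (f * c) q \<noteq> 0"
    and c: "qpoch_inf c q * qpoch_inf (l * c) q = 0"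
  shows "l * (1 - d) * (1 - d / l) * jackson_half q c (saal q l d e f) -
     l * (1 - d * e / l) * (1 - d * f / l) * jackson_half q c (saal q l (d * q) e f) = - d"
proof -
  define C where "C = d * e * f / l"
  define \<alpha> where "\<alpha> = l * (1 - d) * (1 - d / l)"
  define \<beta> where "\<beta> = l * (1 - d * e / l) * (1 - d * f / l)"
  have \<alpha>: "\<alpha> = (1 - d) * (l - d)" and lC: "l * C = d * e * f"
    using l by (simp_all add: \<alpha>_def C_def field_simps)
  have l\<beta>: "l * \<beta> = (l - d * e) * (l - d * f)"
    using l by (simp add: \<beta>_def field_simps)
  define V where "V w = qpoch_inf w q * qpoch_inf (l * w) q * qpoch_inf (C * w) q *
     inverse (qpoch_inf (d * w) q * qpoch_inf (e * w) q * qpoch_inf (f * w) q)" for w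
  have dq: "qpoch_inf (d * q * c) q \<noteq> 0"
    using qpoch_inf_shift_nz(1)[OF nz(1), of 1] by (simp add: mult_ac)
  have point: "\<alpha> * (w * saal q l d e f w) - \<beta> * (w * saal q l (d * q) e f w) = d * (V w - V (q * w))"
    if w: "qpoch_inf (d * w) q \<noteq> 0" "qpoch_inf (e * w) q \<noteq> 0" "qpoch_inf (f * w) q \<noteq> 0" for w
  proof -
    have st: "qpoch_inf (a * w) q = (1 - a * w) * qpoch_inf (a * (q * w)) q" for a
      using qpoch_inf_step[of "a * w"] by (simp add: mult_ac)
    have nz': "1 - d * w \<noteq> 0" "1 - e * w \<noteq> 0" "1 - f * w \<noteq> 0" "qpoch_inf (d * (q * w)) q \<noteq> 0"
      "qpoch_inf (e * (q * w)) q \<noteq> 0" "qpoch_inf (f * (q * w)) q \<noteq> 0"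
      using w st by auto
    define D where "D = inverse ((1 - d * w) * (1 - e * w) * (1 - f * w))"
    define P where "P = qpoch_inf (q * w) q * qpoch_inf (l * (q * w)) q * qpoch_inf (C * (q * w)) q *
      inverse (qpoch_inf (d * (q * w)) q * qpoch_inf (e * (q * w)) q * qpoch_inf (f * (q * w)) q)"
    have 1: "saal q l d e f w = P * D * (1 - C * w)"
      unfolding saal_def P_def D_def st[of d] st[of e] st[of f] C_def[symmetric] st[of C]
      by (simp add: mult_ac)
    have 2: "saal q l (d * q) e f w = P * D * (1 - d * w)"
    proof -
      have a: "d * q * e * f / l * w = C * (q * w)" "d * q * w = d * (q * w)" by (simp_all add: C_def)
      have b: "inverse ((1 - e * w) * (1 - f * w)) = D * (1 - d * w)"
      proof -
        have "inverse (Y * Z) = inverse (X * Y * Z) * X" if "X \<noteq> 0" for X Y Z :: complex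
          using that by simp
        then show ?thesis unfolding D_def using nz'(1) by blast
      qed
      have "saal q l (d * q) e f w = P * inverse ((1 - e * w) * (1 - f * w))"
        unfolding saal_def P_def st[of e] st[of f] a by (simp add: mult_ac)
      then show ?thesis unfolding b by (simp add: mult_ac)
    qed
    have 3: "V w = P * D * ((1 - w) * (1 - l * w) * (1 - C * w))"
      unfolding V_def P_def D_def st[of d] st[of e] st[of f] st[of l] st[of C] qpoch_inf_step[of w]
      by (simp add: mult_ac)
    have 4: "V (q * w) = P * D * ((1 - d * w) * (1 - e * w) * (1 - f * w))"
    proof -
      have "D * ((1 - d * w) * (1 - e * w) * (1 - f * w)) = 1"
        unfolding D_def by (rule left_inverse) (use nz' in simp)
      then have "P * D * ((1 - d * w) * (1 - e * w) * (1 - f * w)) = P" by (simp only: mult.assoc mult_1_right)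
      then show ?thesis by (simp add: V_def P_def)
    qed
    \<comment> \<open>With the common factor \<open>P * D\<close> removed, a polynomial identity in
      \<open>w\<close> remains. It is checked after multiplication by \<open>l\<close>, which clears
      the divisions in \<open>C\<close> and \<open>\<beta>\<close>.\<close>
    have 5: "\<alpha> * (w * (1 - C * w)) - \<beta> * (w * (1 - d * w)) =
      d * ((1 - w) * (1 - l * w) * (1 - C * w) - (1 - d * w) * (1 - e * w) * (1 - f * w))" (is "?lhs = ?rhs")
    proof -
      have "l * ?lhs = \<alpha> * w * (l - l * C * w) - l * \<beta> * (w * (1 - d * w))"
        by (simp add: algebra_simps)
      also have "\<dots> = d * ((1 - w) * (1 - l * w) * (l - l * C * w) - l * ((1 - d * w) * (1 - e * w) * (1 - f * w)))"
        unfolding lC l\<beta> \<alpha> by (simp add: algebra_simps)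
      also have "\<dots> = l * ?rhs" by (simp add: algebra_simps)
      finally show ?thesis using l by simp
    qed
    have "\<alpha> * (w * saal q l d e f w) - \<beta> * (w * saal q l (d * q) e f w) =
        P * D * (\<alpha> * (w * (1 - C * w)) - \<beta> * (w * (1 - d * w)))"
      unfolding 1 2 by (simp add: algebra_simps)
    also have "\<dots> = P * D * (d * ((1 - w) * (1 - l * w) * (1 - C * w) - (1 - d * w) * (1 - e * w) * (1 - f * w)))"
      unfolding 5 ..
    also have "\<dots> = d * (V w - V (q * w))" unfolding 3 4 by (simp add: algebra_simps)
    finally show ?thesis .
  qed
  have lim: "(\<lambda>k. V (q ^ k * c)) \<longlonglongrightarrow> 1"
  proof -
    have *: "(\<lambda>k. qpoch_inf (a * (q ^ k * c)) q) \<longlonglongrightarrow> 1" for a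
      using qpoch_inf_power_tendsto[of a c] by (simp add: mult.assoc)
    have "(\<lambda>k. V (q ^ k * c)) \<longlonglongrightarrow> 1 * 1 * 1 * inverse (1 * 1 * 1)"
      unfolding V_def by (intro tendsto_mult tendsto_inverse * *[of 1, unfolded mult_1]) simp
    then show ?thesis by simp
  qed
  have "(\<lambda>k. d * (V (q ^ k * c) - V (q ^ Suc k * c))) sums (d * (V (q ^ 0 * c) - 1))"
    by (intro sums_mult telescope_sums' lim)
  \<comment> \<open>\<open>V\<close> vanishes at the starting point of the lattice and tends to 1
    along it, so the telescoping sum is \<open>- d\<close> for either end point of the
    integral.\<close>
  moreover have "V c = 0" using c by (auto simp: V_def)
  ultimately have "(\<lambda>k. d * (V (q ^ k * c) - V (q * (q ^ k * c)))) sums (- d)" by (simp add: mult.assoc)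
  moreover have "d * (V (q ^ k * c) - V (q * (q ^ k * c))) =
      \<alpha> * (q ^ k * c * saal q l d e f (q ^ k * c)) - \<beta> * (q ^ k * c * saal q l (d * q) e f (q ^ k * c))" for k
    by (rule point[symmetric]) (use qpoch_inf_shift_nz[OF nz(1)] qpoch_inf_shift_nz[OF nz(2)] qpoch_inf_shift_nz[OF nz(3)] in \<open>auto simp: mult_ac\<close>)
  ultimately have "(\<lambda>k. \<alpha> * (q ^ k * c * saal q l d e f (q ^ k * c)) - \<beta> * (q ^ k * c * saal q l (d * q) e f (q ^ k * c))) sums (- d)" by simp
  moreover have "(\<lambda>k. \<alpha> * (q ^ k * c * saal q l d e f (q ^ k * c)) - \<beta> * (q ^ k * c * saal q l (d * q) e f (q ^ k * c)))
     sums (\<alpha> * jackson_half q c (saal q l d e f) - \<beta> * jackson_half q c (saal q l (d * q) e f))"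
    unfolding jackson_half_def
    by (intro sums_diff sums_mult summable_sums saal_summable nz dq)
  ultimately show ?thesis unfolding \<alpha>_def[symmetric] \<beta>_def[symmetric] by (rule sums_unique2[symmetric])
qed

context
  fixes l :: complex
  assumes l0: "l \<noteq> 0"
begin

lemma regular_0 [simp]: "regular q l 0"
  by (simp add: regular_def)

lemma regular_power: "regular q l d \<Longrightarrow> regular q l (d * q ^ n)"
  unfolding regular_def using qpoch_inf_shift_nz(1)[of d n] qpoch_inf_shift_nz(1)[of "d / l" n] by simp

text \<open>The two halves of the integral satisfy the same inhomogeneous recurrence, and the term
  \<open>- d\<close> cancels in their difference.\<close>

lemma saal_recurrence:
  assumes "regular q l d" "regular q l e" "regular q l f"
  shows "(1 - d) * (1 - d / l) * jackson q l (saal q l d e f) =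
    (1 - d * e / l) * (1 - d * f / l) * jackson q l (saal q l (d * q) e f)"
proof -
  have "l * (1 - d) * (1 - d / l) * jackson_half q 1 (saal q l d e f) -
     l * (1 - d * e / l) * (1 - d * f / l) * jackson_half q 1 (saal q l (d * q) e f) = - d"
    by (rule saal_half_recurrence) (use assms l0 in \<open>simp_all add: regular_def qpoch_inf_one[OF q1]\<close>)
  moreover have "l * (1 - d) * (1 - d / l) * jackson_half q (1 / l) (saal q l d e f) -
     l * (1 - d * e / l) * (1 - d * f / l) * jackson_half q (1 / l) (saal q l (d * q) e f) = - d"
    by (rule saal_half_recurrence) (use assms l0 in \<open>simp_all add: regular_def qpoch_inf_one[OF q1]\<close>)
  moreover have "l * (X * X' * (a - c)) = l * (Y * Y' * (b - b'))"
    if "l * X * X' * a - l * Y * Y' * b = z" "l * X * X' * c - l * Y * Y' * b' = z" for X X' Y Y' a b c b' z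
  proof -
    have "l * (X * X' * (a - c)) - l * (Y * Y' * (b - b')) = (l * X * X' * a - l * Y * Y' * b) - (l * X * X' * c - l * Y * Y' * b')"
      by (simp add: algebra_simps)
    then show ?thesis using that by simp
  qed
  ultimately have "l * ((1 - d) * (1 - d / l) * jackson q l (saal q l d e f)) =
    l * ((1 - d * e / l) * (1 - d * f / l) * jackson q l (saal q l (d * q) e f))"
    unfolding jackson_def by blast
  then show ?thesis using l0 by simp
qed

lemma saal_recurrence_iter:
  assumes "regular q l d" "regular q l e" "regular q l f"
  shows "qpoch d q n * qpoch (d / l) q n * jackson q l (saal q l d e f) =
    qpoch (d * e / l) q n * qpoch (d * f / l) q n * jackson q l (saal q l (d * q ^ n) e f)"
proof (induction n)
  case (Suc n)
  have r: "(1 - d * q ^ n) * (1 - d / l * q ^ n) * jackson q l (saal q l (d * q ^ n) e f) =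
    (1 - d * e / l * q ^ n) * (1 - d * f / l * q ^ n) * jackson q l (saal q l (d * q ^ Suc n) e f)"
    using saal_recurrence[OF regular_power[OF assms(1), of n] assms(2,3)] by (simp add: mult_ac)
  have "qpoch d q (Suc n) * qpoch (d / l) q (Suc n) * jackson q l (saal q l d e f) =
    (1 - d * q ^ n) * (1 - d / l * q ^ n) * (qpoch d q n * qpoch (d / l) q n * jackson q l (saal q l d e f))"
    by (simp add: qpoch_Suc mult_ac)
  also have "\<dots> = qpoch (d * e / l) q n * qpoch (d * f / l) q n *
     ((1 - d * q ^ n) * (1 - d / l * q ^ n) * jackson q l (saal q l (d * q ^ n) e f))"
    unfolding Suc by (simp add: mult_ac)
  also have "\<dots> = qpoch (d * e / l) q (Suc n) * qpoch (d * f / l) q (Suc n) * jackson q l (saal q l (d * q ^ Suc n) e f)"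
    unfolding r by (simp add: qpoch_Suc mult_ac)
  finally show ?case .
qed simp

lemma jackson_half_saal_tendsto:
  assumes nz: "qpoch_inf (d * c) q \<noteq> 0" "qpoch_inf (e * c) q \<noteq> 0" "qpoch_inf (f * c) q \<noteq> 0"
  shows "(\<lambda>n. jackson_half q c (saal q l (d * q ^ n) e f)) \<longlonglongrightarrow> jackson_half q c (saal q l 0 e f)"
proof -
  define B where "B n k = saal q l (d * q ^ n) e f (q ^ k * c)" for n k
  have eq: "B = (\<lambda>n k. qpoch_inf (q * c * q ^ k) q * qpoch_inf (q * l * c * q ^ k) q * qpoch_inf (d * e * f / l * c * q ^ (n + k)) q *
     (inverse (qpoch_inf (d * c * q ^ (n + k)) q) * inverse (qpoch_inf (e * c * q ^ k) q) * inverse (qpoch_inf (f * c * q ^ k) q)))"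
  proof (intro ext)
    fix n k
    have "q * (q ^ k * c) = q * c * q ^ k" "q * l * (q ^ k * c) = q * l * c * q ^ k"
      "d * q ^ n * e * f / l * (q ^ k * c) = d * e * f / l * c * q ^ (n + k)"
      "d * q ^ n * (q ^ k * c) = d * c * q ^ (n + k)" "e * (q ^ k * c) = e * c * q ^ k" "f * (q ^ k * c) = f * c * q ^ k"
      by (simp_all add: power_add)
    note arg = this
    show "B n k = qpoch_inf (q * c * q ^ k) q * qpoch_inf (q * l * c * q ^ k) q * qpoch_inf (d * e * f / l * c * q ^ (n + k)) q *
      (inverse (qpoch_inf (d * c * q ^ (n + k)) q) * inverse (qpoch_inf (e * c * q ^ k) q) * inverse (qpoch_inf (f * c * q ^ k) q))"
      unfolding B_def saal_def arg inverse_mult_distrib ..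
  qed
  have "bounded2 B"
    unfolding eq by (intro bounded2_mult bounded2_qpoch_inf bounded2_inverse_qpoch_inf nz)
  then obtain K where K: "\<And>n k. norm (B n k) \<le> K" by (auto simp: bounded2_def)
  show ?thesis
    unfolding jackson_half_def
  proof (rule tannery_sequence[where M = "\<lambda>k. norm q ^ k * (norm c * K)"])
    fix k
    have w: "qpoch_inf (e * (q ^ k * c)) q \<noteq> 0" "qpoch_inf (f * (q ^ k * c)) q \<noteq> 0"
      using qpoch_inf_shift_nz[OF nz(2), of k] qpoch_inf_shift_nz[OF nz(3), of k] by (simp_all add: mult_ac)
    have 1: "(\<lambda>n. qpoch_inf (d * q ^ n * (q ^ k * c)) q) \<longlonglongrightarrow> qpoch_inf (0 * (q ^ k * c)) q"
      using qpoch_inf_power_tendsto[of d "q ^ k * c"] by simp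
    have 2: "(\<lambda>n. qpoch_inf (d * q ^ n * e * f / l * (q ^ k * c)) q) \<longlonglongrightarrow> qpoch_inf (0 * e * f / l * (q ^ k * c)) q"
      using qpoch_inf_power_tendsto[of d "e * f / l * (q ^ k * c)"] by (simp add: mult.assoc)
    show "(\<lambda>n. q ^ k * c * saal q l (d * q ^ n) e f (q ^ k * c)) \<longlonglongrightarrow> q ^ k * c * saal q l 0 e f (q ^ k * c)"
      unfolding saal_def by (intro tendsto_mult tendsto_const tendsto_inverse 1 2) (use w in simp)
    show "eventually (\<lambda>n. \<forall>k. norm (q ^ k * c * saal q l (d * q ^ n) e f (q ^ k * c)) \<le> norm q ^ k * (norm c * K)) sequentially"
      unfolding norm_mult norm_power mult.assoc B_def[symmetric]
      by (intro always_eventually allI mult_left_mono K) auto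
    show "summable (\<lambda>k. norm q ^ k * (norm c * K))" using q1 by (intro summable_mult2) auto
  qed
qed

text \<open>Under iteration \<open>d * q ^ n\<close> tends to 0 while the coefficients become
  infinite products, so one parameter is replaced by 0.\<close>

lemma saal_reduce:
  assumes "regular q l d" "regular q l e" "regular q l f"
  shows "qpoch_inf d q * qpoch_inf (d / l) q * jackson q l (saal q l d e f) =
    qpoch_inf (d * e / l) q * qpoch_inf (d * f / l) q * jackson q l (saal q l 0 e f)"
proof (rule LIMSEQ_unique)
  show "(\<lambda>n. qpoch d q n * qpoch (d / l) q n * jackson q l (saal q l d e f)) \<longlonglongrightarrow>
     qpoch_inf d q * qpoch_inf (d / l) q * jackson q l (saal q l d e f)"
    by (intro tendsto_intros qpoch_tendsto q1)
  show "(\<lambda>n. qpoch d q n * qpoch (d / l) q n * jackson q l (saal q l d e f)) \<longlonglongrightarrow>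
    qpoch_inf (d * e / l) q * qpoch_inf (d * f / l) q * jackson q l (saal q l 0 e f)"
    unfolding saal_recurrence_iter[OF assms] unfolding jackson_def
    by (intro tendsto_intros qpoch_tendsto q1 jackson_half_saal_tendsto)
       (use assms in \<open>auto simp: regular_def\<close>)
qed

text \<open>The value at \<open>d = e = f = 0\<close> comes from the parameters \<open>q, 0, 0\<close>, where the integrand is a
  \<open>q\<close>-difference.\<close>
lemma saal_zero:
  assumes ql: "qpoch_inf (q / l) q \<noteq> 0"
  shows "jackson q l (saal q l 0 0 0) = - (qpoch_inf q q * qpoch_inf (q / l) q * qpoch_inf l q / l)"
proof -
  have half: "jackson_half q c (saal q l q 0 0) = - (1 / l) * (qpoch_inf (l * c) q - 1)"
    if c: "qpoch_inf (q * c) q \<noteq> 0" for c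
  proof -
    have "(\<lambda>k. qpoch_inf (l * (q ^ k * c)) q) \<longlonglongrightarrow> 1"
      using qpoch_inf_power_tendsto[of l c] by (simp add: mult.assoc)
    then have s: "(\<lambda>k. - (1 / l) * (qpoch_inf (l * (q ^ k * c)) q - qpoch_inf (l * (q ^ Suc k * c)) q)) sums
       (- (1 / l) * (qpoch_inf (l * (q ^ 0 * c)) q - 1))"
      by (intro sums_mult telescope_sums')
    have "- (1 / l) * (qpoch_inf (l * (q ^ k * c)) q - qpoch_inf (l * (q ^ Suc k * c)) q) =
       q ^ k * c * saal q l q 0 0 (q ^ k * c)" for k
    proof -
      have nz: "qpoch_inf (q * (q ^ k * c)) q \<noteq> 0"
        using qpoch_inf_shift_nz[OF c, of k] by (simp add: mult_ac)
      have "saal q l q 0 0 (q ^ k * c) = qpoch_inf (l * (q ^ Suc k * c)) q"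
        using nz by (simp add: saal_def qpoch_inf_zero mult_ac)
      moreover have "qpoch_inf (l * (q ^ k * c)) q = (1 - l * (q ^ k * c)) * qpoch_inf (l * (q ^ Suc k * c)) q"
        using qpoch_inf_step[of "l * (q ^ k * c)"] by (simp add: mult_ac)
      ultimately show ?thesis using l0 by (simp add: field_simps)
    qed
    then show ?thesis using sums_unique[OF s] by (simp add: jackson_half_def)
  qed
  have "jackson q l (saal q l q 0 0) = - (qpoch_inf l q / l)"
    unfolding jackson_def using half[of 1] half[of "1 / l"] qpoch_q_nz[OF q1] ql l0
    by (simp add: qpoch_inf_one[OF q1] field_simps)
  moreover have "qpoch_inf q q * qpoch_inf (q / l) q * jackson q l (saal q l q 0 0) = jackson q l (saal q l 0 0 0)"
    using saal_reduce[of q 0 0] qpoch_q_nz[OF q1] ql by (simp add: regular_def qpoch_inf_zero)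
  ultimately show ?thesis by (simp add: mult_ac)
qed

text \<open>The integrand is symmetric in d, e and f, so the three parameters are reduced to 0 one
  after another until \<open>saal_zero\<close> gives the value.\<close>

theorem nonterminating_q_Saalschuetz:
  assumes "regular q l d" "regular q l e" "regular q l f" "qpoch_inf (q / l) q \<noteq> 0"
  shows "qpoch_inf d q * qpoch_inf (d / l) q * (qpoch_inf e q * qpoch_inf (e / l) q) *
      (qpoch_inf f q * qpoch_inf (f / l) q) * jackson q l (saal q l d e f) =
    - (qpoch_inf (d * e / l) q * qpoch_inf (d * f / l) q * qpoch_inf (e * f / l) q *
       (qpoch_inf q q * qpoch_inf (q / l) q * qpoch_inf l q / l))"
proof -
  have 2: "qpoch_inf e q * qpoch_inf (e / l) q * jackson q l (saal q l 0 e f) =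
    qpoch_inf (e * f / l) q * jackson q l (saal q l 0 0 f)"
    using saal_reduce[of e 0 f] assms saal_commute(1)[of l 0 e f] by (simp add: qpoch_inf_zero)
  have 3: "qpoch_inf f q * qpoch_inf (f / l) q * jackson q l (saal q l 0 0 f) = jackson q l (saal q l 0 0 0)"
    using saal_reduce[of f 0 0] assms saal_commute[of l 0 0 f] saal_commute[of l 0 f 0] by (simp add: qpoch_inf_zero)
  have "qpoch_inf d q * qpoch_inf (d / l) q * (qpoch_inf e q * qpoch_inf (e / l) q) *
      (qpoch_inf f q * qpoch_inf (f / l) q) * jackson q l (saal q l d e f) =
     (qpoch_inf e q * qpoch_inf (e / l) q) * (qpoch_inf f q * qpoch_inf (f / l) q) *
     (qpoch_inf d q * qpoch_inf (d / l) q * jackson q l (saal q l d e f))" by (simp add: mult_ac)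
  also have "\<dots> = qpoch_inf (d * e / l) q * qpoch_inf (d * f / l) q * (qpoch_inf f q * qpoch_inf (f / l) q) *
     (qpoch_inf e q * qpoch_inf (e / l) q * jackson q l (saal q l 0 e f))"
    unfolding saal_reduce[OF assms(1-3)] by (simp add: mult_ac)
  also have "\<dots> = qpoch_inf (d * e / l) q * qpoch_inf (d * f / l) q * qpoch_inf (e * f / l) q *
     (qpoch_inf f q * qpoch_inf (f / l) q * jackson q l (saal q l 0 0 f))"
    unfolding 2 by (simp add: mult_ac)
  also have "\<dots> = - (qpoch_inf (d * e / l) q * qpoch_inf (d * f / l) q * qpoch_inf (e * f / l) q *
       (qpoch_inf q q * qpoch_inf (q / l) q * qpoch_inf l q / l))"
    unfolding 3 saal_zero[OF assms(4)] by simp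
  finally show ?thesis .
qed

end

end

subsection \<open>The sum of the very-well-poised \<open>6\<phi>5\<close> series\<close>

text \<open>The terms of a very-well-poised series, without the square roots of \<open>a\<close>.\<close>
definition vwp_term :: "complex \<Rightarrow> complex \<Rightarrow> complex list \<Rightarrow> complex \<Rightarrow> nat \<Rightarrow> complex" where
  "vwp_term q a bs z k = (1 - a * q ^ (2 * k)) / (1 - a) *
     (qpochs (a # bs) q k / qpochs (q # map (\<lambda>b. q * a / b) bs) q k) * z ^ k"

text \<open>The second alternative covers terminating series outside the disc of convergence.\<close>
definition vwp_convergent :: "complex \<Rightarrow> complex \<Rightarrow> complex \<Rightarrow> bool" where
  "vwp_convergent q d z \<longleftrightarrow> norm z < 1 \<or> (\<exists>m. d * q ^ m = 1)"

context
  fixes q :: complex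
  assumes q0: "q \<noteq> 0" and q1: "norm q < 1"
begin

text \<open>The telescoping relation of \<open>vwp6_term_recurrence\<close> divided by its common
  factor, with \<open>x\<close> in place of \<open>q ^ k\<close>. The base q has been eliminated
  through \<open>q * a = b * c * d * z\<close>.\<close>

lemma vwp_certificate:
  fixes a b c d x z :: complex
  shows "(1 - z) * (1 - a * x\<^sup>2) * ((1 - c * d * z * x) * (1 - b * d * z * x) * (1 - b * c * z * x)) -
     x * (1 - a * x) * (1 - b * c * d * z * x\<^sup>2) * ((1 - d * z) * (1 - c * z) * (1 - b * z)) =
    (1 - x) * (1 - a * z * x) * ((1 - c * d * z * x) * (1 - b * d * z * x) * (1 - b * c * z * x)) -
     (1 - b * c * d * z * z * x) * ((1 - a * x) * (1 - b * x) * (1 - c * x) * (1 - d * x)) * z"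
  by algebra

text \<open>Creative telescoping for the step from (a, z) to (a q, z q) with b, c, d fixed.
  \<open>G\<close> is the certificate; its factor \<open>1 - q ^ k\<close> makes it vanish at
  \<open>k = 0\<close>.\<close>

lemma vwp6_term_recurrence:
  assumes az: "q * a = b * c * d * z" and nz: "b \<noteq> 0" "c \<noteq> 0" "d \<noteq> 0" and a: "qpoch_inf a q \<noteq> 0"
    and den: "qpoch_inf (q * a / b) q \<noteq> 0" "qpoch_inf (q * a / c) q \<noteq> 0" "qpoch_inf (q * a / d) q \<noteq> 0"
  defines "G k \<equiv> - ((1 - q ^ k) * (1 - a * z * q ^ k) / (1 - a) *
     ((1 - q * a / b) * (1 - q * a / c) * (1 - q * a / d)) *
     (qpochs [a, b, c, d] q k / qpochs [q, q * a / b, q * a / c, q * a / d] q k * z ^ k))"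
  shows "(1 - q * a / b) * (1 - q * a / c) * (1 - q * a / d) * (1 - z) * vwp_term q a [b, c, d] z k -
     (1 - q * a) * (1 - d * z) * (1 - c * z) * (1 - b * z) * vwp_term q (a * q) [b, c, d] (z * q) k
     = G (Suc k) - G k"
proof -
  have aux: "u = - (R * Y) \<Longrightarrow> v = - (R * X) \<Longrightarrow> u - v = R * (X - Y)" for u v R X Y :: complex
    by (simp add: algebra_simps)
  have aux': "R * X = s \<Longrightarrow> R * Y = t \<Longrightarrow> R * (X - Y) = s - t" for s t R X Y :: complex
    by (simp add: algebra_simps)
  define x where "x = q ^ k"
  \<comment> \<open>By \<open>az\<close> the denominator parameters are products of b, c, d and z.
    The simultaneous shift of \<open>a\<close> and \<open>z\<close> multiplies them by q and
    preserves the relation.\<close>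
  have e: "q * a / b = c * d * z" "q * a / c = b * d * z" "q * a / d = b * c * z"
    "q * (a * q) / b = c * d * z * q" "q * (a * q) / c = b * d * z * q" "q * (a * q) / d = b * c * z * q"
    using az nz by (simp_all add: field_simps)
  have one: "1 - u * q ^ k \<noteq> 0" if "qpoch_inf u q \<noteq> 0" for u k
    using that qpoch_inf_eq_0_iff[OF q1, of u] by auto
  have nzx: "1 - a \<noteq> 0" "1 - a * q \<noteq> 0" "1 - a * x \<noteq> 0" "1 - q * x \<noteq> 0"
    "1 - c * d * z \<noteq> 0" "1 - b * d * z \<noteq> 0" "1 - b * c * z \<noteq> 0"
    "1 - c * d * z * x \<noteq> 0" "1 - b * d * z * x \<noteq> 0" "1 - b * c * z * x \<noteq> 0"
    using one[OF a, of 0] one[OF a, of 1] one[OF a, of k] one[OF qpoch_q_nz(1)[OF q1], of k]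
      one[OF den(1), of 0] one[OF den(2), of 0] one[OF den(3), of 0]
      one[OF den(1), of k] one[OF den(2), of k] one[OF den(3), of k] by (simp_all add: e x_def)
  define A where "A = (1 - c * d * z) * (1 - b * d * z) * (1 - b * c * z)"
  define X where "X = (1 - c * d * z * x) * (1 - b * d * z * x) * (1 - b * c * z * x)"
  have AX: "A \<noteq> 0" "X \<noteq> 0" using nzx by (auto simp: A_def X_def)
  define \<tau> where "\<tau> k = qpochs [a, b, c, d] q k / qpochs [q, c * d * z, b * d * z, b * c * z] q k * z ^ k" for k
  have shift: "qpoch (u * q) q k = qpoch u q k * (1 - u * x) / (1 - u)" if "1 - u \<noteq> 0" for u
    using qpoch_add[of u q 1 k] qpoch_Suc[of u q k] that by (simp add: qpoch_Suc x_def)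
  have t1: "vwp_term q a [b, c, d] z k = (1 - a * x\<^sup>2) / (1 - a) * \<tau> k"
    by (simp add: vwp_term_def e \<tau>_def x_def power_mult power2_eq_square mult.commute[of 2] power_mult)
  have t2: "vwp_term q (a * q) [b, c, d] (z * q) k = x * (1 - a * x) * (1 - b * c * d * z * x\<^sup>2) / (1 - q * a) * A / X / (1 - a) * \<tau> k"
  proof -
    have "qpochs (q # map (\<lambda>b. q * (a * q) / b) [b, c, d]) q k =
       qpochs [q, c * d * z, b * d * z, b * c * z] q k * (X / A)"
      using nzx AX by (simp add: e shift A_def X_def) (simp add: mult_ac)
    moreover have "qpochs [a * q, b, c, d] q k = qpochs [a, b, c, d] q k * ((1 - a * x) / (1 - a))"
      using nzx by (simp add: shift)
    moreover have "a * q * q ^ (2 * k) = b * c * d * z * x\<^sup>2"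
      using az by (simp add: x_def power_mult mult_ac)
    ultimately show ?thesis
      unfolding vwp_term_def \<tau>_def by (simp add: power_mult_distrib x_def mult_ac)
  qed
  have t3: "\<tau> (Suc k) = \<tau> k * ((1 - a * x) * (1 - b * x) * (1 - c * x) * (1 - d * x) * z) / ((1 - q * x) * X)"
    by (simp add: \<tau>_def qpoch_Suc X_def x_def mult_ac)
  have G: "G k = - ((1 - q ^ k) * (1 - a * z * q ^ k) / (1 - a) * A * \<tau> k)" for k
    by (simp add: G_def e A_def \<tau>_def)
  have qq: "q ^ Suc k = q * x" by (simp add: x_def)
  have azq: "a * z * (q * x) = b * c * d * z * z * x" using az by (simp add: mult_ac)
  have "G (Suc k) - G k = A * \<tau> k / (1 - a) / X *
     ((1 - x) * (1 - a * z * x) * X -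
     (1 - b * c * d * z * z * x) * ((1 - a * x) * (1 - b * x) * (1 - c * x) * (1 - d * x)) * z)"
  proof -
    have "G (Suc k) = - (A * \<tau> k / (1 - a) / X * ((1 - b * c * d * z * z * x) * ((1 - a * x) * (1 - b * x) * (1 - c * x) * (1 - d * x)) * z))"
      unfolding G qq t3 azq using nzx by simp
    moreover have "G k = - (A * \<tau> k / (1 - a) / X * ((1 - x) * (1 - a * z * x) * X))"
      unfolding G x_def[symmetric] using AX by simp
    ultimately show ?thesis by (rule aux)
  qed
  also have "\<dots> = A * \<tau> k / (1 - a) / X *
     ((1 - z) * (1 - a * x\<^sup>2) * X -
     x * (1 - a * x) * (1 - b * c * d * z * x\<^sup>2) * ((1 - d * z) * (1 - c * z) * (1 - b * z)))"
    unfolding X_def vwp_certificate ..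
  also have "\<dots> = A * (1 - z) * vwp_term q a [b, c, d] z k -
     (1 - q * a) * (1 - d * z) * (1 - c * z) * (1 - b * z) * vwp_term q (a * q) [b, c, d] (z * q) k"
  proof -
    have "A * \<tau> k / (1 - a) / X * ((1 - z) * (1 - a * x\<^sup>2) * X) = A * (1 - z) * vwp_term q a [b, c, d] z k"
      unfolding t1 using AX by simp
    moreover have "A * \<tau> k / (1 - a) / X * (x * (1 - a * x) * (1 - b * c * d * z * x\<^sup>2) * ((1 - d * z) * (1 - c * z) * (1 - b * z)))
      = (1 - q * a) * (1 - d * z) * (1 - c * z) * (1 - b * z) * vwp_term q (a * q) [b, c, d] (z * q) k"
      unfolding t2 using nzx(2) by (simp add: mult_ac)
    ultimately show ?thesis by (rule aux')
  qed
  finally show ?thesis unfolding e A_def ..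
qed

text \<open>One constant serves all shifts \<open>a * q ^ n\<close>, as needed for the limit in
  \<open>n\<close>. The second estimate controls the certificate of the telescoping.\<close>

lemma vwp6_bound:
  assumes a: "qpoch_inf a q \<noteq> 0"
    and den: "qpoch_inf (q * a / b) q \<noteq> 0" "qpoch_inf (q * a / c) q \<noteq> 0" "qpoch_inf (q * a / d) q \<noteq> 0"
  shows "\<exists>C\<ge>0. \<forall>n k w. norm (vwp_term q (a * q ^ n) [b, c, d] w k) \<le> C * norm w ^ k
    \<and> norm (qpochs [a, b, c, d] q k / qpochs [q, q * a / b, q * a / c, q * a / d] q k) \<le> C"
proof -
  define F where "F n k = qpoch (a * q ^ (n + 2 * k)) q 1 * inverse (qpoch (a * q ^ n) q 1) *
     (qpoch (a * q ^ n) q k * qpoch b q k * qpoch c q k * qpoch d q k *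
      (inverse (qpoch q q k) * inverse (qpoch (q * a / b * q ^ n) q k) *
       inverse (qpoch (q * a / c * q ^ n) q k) * inverse (qpoch (q * a / d * q ^ n) q k)))" for n k
  have "bounded2 F"
    unfolding F_def by (intro bounded2_mult bounded2_qpoch bounded2_inverse_qpoch q0 q1 a den qpoch_q_nz)
  then obtain C where C: "\<And>n k. norm (F n k) \<le> C" by (auto simp: bounded2_def)
  define F' where "F' n k = (qpoch a q k * qpoch b q k * qpoch c q k * qpoch d q k *
      (inverse (qpoch q q k) * inverse (qpoch (q * a / b) q k) *
       inverse (qpoch (q * a / c) q k) * inverse (qpoch (q * a / d) q k)))" for n k :: nat
  have "bounded2 F'"
    unfolding F'_def by (intro bounded2_mult bounded2_qpoch bounded2_inverse_qpoch q0 q1 a den qpoch_q_nz)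
  then obtain C' where C': "\<And>n k. norm (F' n k) \<le> C'" by (auto simp: bounded2_def)
  have 1: "vwp_term q (a * q ^ n) [b, c, d] w k = F n k * w ^ k" for n k w
  proof -
    have *: "q * (a * q ^ n) / u = q * a / u * q ^ n" for u by simp
    have "q ^ n * q ^ (2 * k) = q ^ (n + 2 * k)" by (simp add: power_add)
    then show ?thesis
      unfolding vwp_term_def F_def list.map *
      by (simp add: qpoch_Suc divide_inverse mult.assoc)
  qed
  have 2: "qpochs [a, b, c, d] q k / qpochs [q, q * a / b, q * a / c, q * a / d] q k = F' 0 k" for k
    by (simp add: F'_def divide_inverse mult.assoc)
  show ?thesis
  proof (intro exI[of _ "max C C'"] conjI allI)
    have "0 \<le> C" using C norm_ge_zero order_trans by blast
    then show "0 \<le> max C C'" by simp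
    fix n k w
    have "norm (F n k) \<le> max C C'" using C[of n k] by simp
    then show "norm (vwp_term q (a * q ^ n) [b, c, d] w k) \<le> max C C' * norm w ^ k"
      unfolding 1 norm_mult norm_power by (intro mult_right_mono) auto
    show "norm (qpochs [a, b, c, d] q k / qpochs [q, q * a / b, q * a / c, q * a / d] q k) \<le> max C C'"
      unfolding 2 using C'[of 0 k] by simp
  qed
qed

text \<open>Cutting the geometric majorant off where \<open>qpoch d q k\<close> vanishes gives one
  majorant for the convergent and for the terminating case.\<close>

lemma vwp_convergent_summable:
  assumes "vwp_convergent q d z"
  shows "summable (\<lambda>k. if qpoch d q k = 0 then 0 else C * norm z ^ k)"
proof (cases "norm z < 1")
  case True
  show ?thesis
  proof (rule summable_comparison_test')
    show "summable (\<lambda>k. \<bar>C\<bar> * norm z ^ k)" using True by (intro summable_mult) auto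
    show "norm (if qpoch d q k = 0 then 0 else C * norm z ^ k) \<le> \<bar>C\<bar> * norm z ^ k" for k
      by (simp add: abs_mult)
  qed
next
  case False
  then obtain m where m: "d * q ^ m = 1" using assms by (auto simp: vwp_convergent_def)
  show ?thesis
  proof (rule summable_finite[of "{..m}"])
    fix k assume "k \<notin> {..m}"
    then have "qpoch d q k = 0" using m by (auto simp: qpoch_eq_0_iff not_le)
    then show "(if qpoch d q k = 0 then 0 else C * norm z ^ k) = 0" by simp
  qed simp
qed

lemma vwp_term_eq_0: "qpoch d q k = 0 \<Longrightarrow> vwp_term q a [b, c, d] z k = 0"
  by (simp add: vwp_term_def)

lemma vwp6_summable:
  assumes a: "qpoch_inf a q \<noteq> 0"
    and den: "qpoch_inf (q * a / b) q \<noteq> 0" "qpoch_inf (q * a / c) q \<noteq> 0" "qpoch_inf (q * a / d) q \<noteq> 0"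
    and conv: "vwp_convergent q d z"
  shows "summable (vwp_term q a [b, c, d] z)"
proof -
  obtain C where C: "C \<ge> 0" "\<And>n k. norm (vwp_term q (a * q ^ n) [b, c, d] z k) \<le> C * norm z ^ k"
    using vwp6_bound[OF a den] by blast
  show ?thesis
  proof (rule summable_comparison_test'[OF vwp_convergent_summable[OF conv, of C]])
    show "norm (vwp_term q a [b, c, d] z k) \<le> (if qpoch d q k = 0 then 0 else C * norm z ^ k)" for k
      using C(2)[of 0 k] vwp_term_eq_0[of d k] by simp
  qed
qed

text \<open>Summing the telescoping relation leaves no boundary terms: the certificate is 0 at
  \<open>k = 0\<close> and tends to 0.\<close>

lemma vwp6_recurrence:
  assumes az: "q * a = b * c * d * z" and nz: "b \<noteq> 0" "c \<noteq> 0" "d \<noteq> 0" and a: "qpoch_inf a q \<noteq> 0"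
    and den: "qpoch_inf (q * a / b) q \<noteq> 0" "qpoch_inf (q * a / c) q \<noteq> 0" "qpoch_inf (q * a / d) q \<noteq> 0"
    and conv: "vwp_convergent q d z" "vwp_convergent q d (z * q)"
  shows "(1 - q * a / b) * (1 - q * a / c) * (1 - q * a / d) * (1 - z) * (\<Sum>k. vwp_term q a [b, c, d] z k) =
     (1 - q * a) * (1 - d * z) * (1 - c * z) * (1 - b * z) * (\<Sum>k. vwp_term q (a * q) [b, c, d] (z * q) k)"
proof -
  define R where "R k = qpochs [a, b, c, d] q k / qpochs [q, q * a / b, q * a / c, q * a / d] q k" for k
  define G where "G k = - ((1 - q ^ k) * (1 - a * z * q ^ k) / (1 - a) *
     ((1 - q * a / b) * (1 - q * a / c) * (1 - q * a / d)) * (R k * z ^ k))" for k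
  have rec: "(1 - q * a / b) * (1 - q * a / c) * (1 - q * a / d) * (1 - z) * vwp_term q a [b, c, d] z k -
     (1 - q * a) * (1 - d * z) * (1 - c * z) * (1 - b * z) * vwp_term q (a * q) [b, c, d] (z * q) k
     = G (Suc k) - G k" for k
    unfolding G_def R_def by (rule vwp6_term_recurrence[OF az nz a den])
  obtain C where C: "C \<ge> 0" "\<And>k. norm (R k) \<le> C"
    using vwp6_bound[OF a den] unfolding R_def by blast
  have "(\<lambda>k. R k * z ^ k) \<longlonglongrightarrow> 0"
  proof (rule Lim_null_comparison)
    show "(\<lambda>k. if qpoch d q k = 0 then 0 else C * norm z ^ k) \<longlonglongrightarrow> 0"
      by (rule summable_LIMSEQ_zero[OF vwp_convergent_summable[OF conv(1)]])
    have "norm (R k * z ^ k) \<le> (if qpoch d q k = 0 then 0 else C * norm z ^ k)" for k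
    proof (cases "qpoch d q k = 0")
      case False
      then show ?thesis using mult_right_mono[OF C(2)[of k], of "norm z ^ k"] by (simp add: norm_mult norm_power)
    qed (simp add: R_def)
    then show "eventually (\<lambda>k. norm (R k * z ^ k) \<le> (if qpoch d q k = 0 then 0 else C * norm z ^ k)) sequentially"
      by simp
  qed
  moreover have "(\<lambda>k. q ^ k) \<longlonglongrightarrow> 0" by (rule LIMSEQ_power_zero[OF q1])
  ultimately have "G \<longlonglongrightarrow> - ((1 - 0) * (1 - a * z * 0) * inverse (1 - a) *
     ((1 - q * a / b) * (1 - q * a / c) * (1 - q * a / d)) * 0)"
    unfolding G_def divide_inverse[of _ "1 - a"]
    by (intro tendsto_minus tendsto_mult tendsto_diff tendsto_const)
  then have "G \<longlonglongrightarrow> 0" by simp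
  then have "(\<lambda>k. G (Suc k) - G k) sums (0 - G 0)" by (rule telescope_sums)
  moreover have "G 0 = 0" by (simp add: G_def)
  ultimately have "(\<lambda>k. G (Suc k) - G k) sums 0" by simp
  moreover have den': "qpoch_inf (q * (a * q) / u) q \<noteq> 0" if "qpoch_inf (q * a / u) q \<noteq> 0" for u
    using qpoch_inf_shift_nz(1)[OF q0 q1 that, of 1] by (simp add: mult_ac)
  have "(\<lambda>k. (1 - q * a / b) * (1 - q * a / c) * (1 - q * a / d) * (1 - z) * vwp_term q a [b, c, d] z k -
     (1 - q * a) * (1 - d * z) * (1 - c * z) * (1 - b * z) * vwp_term q (a * q) [b, c, d] (z * q) k) sums
     ((1 - q * a / b) * (1 - q * a / c) * (1 - q * a / d) * (1 - z) * (\<Sum>k. vwp_term q a [b, c, d] z k) -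
     (1 - q * a) * (1 - d * z) * (1 - c * z) * (1 - b * z) * (\<Sum>k. vwp_term q (a * q) [b, c, d] (z * q) k))"
    by (intro sums_diff sums_mult summable_sums vwp6_summable a den den' conv)
       (use qpoch_inf_shift_nz(1)[OF q0 q1 a, of 1] in simp)
  ultimately have "(1 - q * a / b) * (1 - q * a / c) * (1 - q * a / d) * (1 - z) * (\<Sum>k. vwp_term q a [b, c, d] z k) -
     (1 - q * a) * (1 - d * z) * (1 - c * z) * (1 - b * z) * (\<Sum>k. vwp_term q (a * q) [b, c, d] (z * q) k) = 0"
    unfolding rec by (rule sums_unique2[symmetric])
  then show ?thesis by simp
qed

text \<open>Iterating \<open>a \<mapsto> a q\<close> drives the argument of the series to \<open>0\<close>.\<close>
theorem vwp6_sum: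
  assumes az: "q * a = b * c * d * z" and nz: "b \<noteq> 0" "c \<noteq> 0" "d \<noteq> 0" and a: "qpoch_inf a q \<noteq> 0"
    and den: "qpoch_inf (q * a / b) q \<noteq> 0" "qpoch_inf (q * a / c) q \<noteq> 0" "qpoch_inf (q * a / d) q \<noteq> 0"
    and conv: "vwp_convergent q d z"
  shows "qpoch_inf (q * a / b) q * qpoch_inf (q * a / c) q * qpoch_inf (q * a / d) q * qpoch_inf z q *
      (\<Sum>k. vwp_term q a [b, c, d] z k) =
    qpoch_inf (q * a) q * qpoch_inf (d * z) q * qpoch_inf (c * z) q * qpoch_inf (b * z) q"
proof -
  define S where "S n = (\<Sum>k. vwp_term q (a * q ^ n) [b, c, d] (z * q ^ n) k)" for n
  have norm_le: "norm (z * q ^ n) \<le> norm z" for n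
    using q1 by (simp add: norm_mult norm_power mult_left_le power_le_one)
  have conv': "vwp_convergent q d (z * q ^ n)" for n
    using conv norm_le[of n] unfolding vwp_convergent_def by (meson le_less_trans)
  have shift: "q * (a * q ^ n) / u = q * a / u * q ^ n" for u n by simp
  have step: "(1 - q * a / b * q ^ n) * (1 - q * a / c * q ^ n) * (1 - q * a / d * q ^ n) * (1 - z * q ^ n) * S n =
     (1 - q * a * q ^ n) * (1 - d * z * q ^ n) * (1 - c * z * q ^ n) * (1 - b * z * q ^ n) * S (Suc n)" for n
  proof -
    have e: "q * (a * q ^ n) = b * c * d * (z * q ^ n)" using az by (simp add: mult.assoc[symmetric])
    have den': "qpoch_inf (q * (a * q ^ n) / b) q \<noteq> 0" "qpoch_inf (q * (a * q ^ n) / c) q \<noteq> 0"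
      "qpoch_inf (q * (a * q ^ n) / d) q \<noteq> 0"
      unfolding shift by (rule qpoch_inf_shift_nz(1)[OF q0 q1] den)+
    have conv'': "vwp_convergent q d (z * q ^ n * q)"
      using conv'[of "Suc n"] by (simp add: mult_ac)
    have "(1 - q * (a * q ^ n) / b) * (1 - q * (a * q ^ n) / c) * (1 - q * (a * q ^ n) / d) * (1 - z * q ^ n) * S n =
      (1 - q * (a * q ^ n)) * (1 - d * (z * q ^ n)) * (1 - c * (z * q ^ n)) * (1 - b * (z * q ^ n)) *
        (\<Sum>k. vwp_term q (a * q ^ n * q) [b, c, d] (z * q ^ n * q) k)"
      unfolding S_def
      by (rule vwp6_recurrence[OF e nz qpoch_inf_shift_nz(1)[OF q0 q1 a] den' conv' conv''])
    moreover have "(\<Sum>k. vwp_term q (a * q ^ n * q) [b, c, d] (z * q ^ n * q) k) = S (Suc n)"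
      by (simp add: S_def mult_ac)
    ultimately show ?thesis by (simp add: mult.assoc)
  qed
  have iter: "qpoch (q * a / b) q n * qpoch (q * a / c) q n * qpoch (q * a / d) q n * qpoch z q n * S 0 =
     qpoch (q * a) q n * qpoch (d * z) q n * qpoch (c * z) q n * qpoch (b * z) q n * S n" for n
  proof (induction n)
    case (Suc n)
    have "qpoch (q * a / b) q (Suc n) * qpoch (q * a / c) q (Suc n) * qpoch (q * a / d) q (Suc n) * qpoch z q (Suc n) * S 0 =
      ((1 - q * a / b * q ^ n) * (1 - q * a / c * q ^ n) * (1 - q * a / d * q ^ n) * (1 - z * q ^ n)) *
       (qpoch (q * a / b) q n * qpoch (q * a / c) q n * qpoch (q * a / d) q n * qpoch z q n * S 0)"
      by (simp add: qpoch_Suc mult_ac)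
    also have "\<dots> = (qpoch (q * a) q n * qpoch (d * z) q n * qpoch (c * z) q n * qpoch (b * z) q n) *
      ((1 - q * a / b * q ^ n) * (1 - q * a / c * q ^ n) * (1 - q * a / d * q ^ n) * (1 - z * q ^ n) * S n)"
      unfolding Suc by (simp add: mult_ac)
    also have "\<dots> = qpoch (q * a) q (Suc n) * qpoch (d * z) q (Suc n) * qpoch (c * z) q (Suc n) * qpoch (b * z) q (Suc n) * S (Suc n)"
      unfolding step by (simp add: qpoch_Suc mult_ac)
    finally show ?case .
  qed simp
  have "S \<longlonglongrightarrow> (\<Sum>k. if k = 0 then 1 else 0)"
  proof -
    obtain C where C: "C \<ge> 0" "\<And>w n k. norm (vwp_term q (a * q ^ n) [b, c, d] w k) \<le> C * norm w ^ k"
      using vwp6_bound[OF a den] by blast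
    show ?thesis
      unfolding S_def
    proof (rule tannery_sequence[where M = "\<lambda>k. if qpoch d q k = 0 then 0 else C * norm z ^ k"])
      show "summable (\<lambda>k. if qpoch d q k = 0 then 0 else C * norm z ^ k)"
        by (rule vwp_convergent_summable[OF conv])
      have "norm (vwp_term q (a * q ^ n) [b, c, d] (z * q ^ n) k) \<le> (if qpoch d q k = 0 then 0 else C * norm z ^ k)" for n k
      proof (cases "qpoch d q k = 0")
        case False
        have "norm (vwp_term q (a * q ^ n) [b, c, d] (z * q ^ n) k) \<le> C * norm (z * q ^ n) ^ k" by (rule C)
        also have "\<dots> \<le> C * norm z ^ k" using C(1) norm_le by (intro mult_left_mono power_mono) auto
        finally show ?thesis using False by simp
      qed (simp add: vwp_term_eq_0)
      then show "eventually (\<lambda>n. \<forall>k. norm (vwp_term q (a * q ^ n) [b, c, d] (z * q ^ n) k)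
          \<le> (if qpoch d q k = 0 then 0 else C * norm z ^ k)) sequentially" by simp
      fix k
      show "(\<lambda>n. vwp_term q (a * q ^ n) [b, c, d] (z * q ^ n) k) \<longlonglongrightarrow> (if k = 0 then 1 else 0)"
      proof (cases "k = 0")
        case True
        have "1 - a * q ^ n \<noteq> 0" for n using a qpoch_inf_eq_0_iff[OF q1, of a] by auto
        then show ?thesis using True by (simp add: vwp_term_def)
      next
        case False
        have "(\<lambda>n. C * norm (z * q ^ n) ^ k) \<longlonglongrightarrow> C * norm (z * 0) ^ k"
          by (intro tendsto_intros LIMSEQ_power_zero q1)
        then have "(\<lambda>n. C * norm (z * q ^ n) ^ k) \<longlonglongrightarrow> 0" using False by (simp add: power_0_left)
        then have "(\<lambda>n. vwp_term q (a * q ^ n) [b, c, d] (z * q ^ n) k) \<longlonglongrightarrow> 0"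
          by (rule Lim_null_comparison[rotated]) (simp add: C)
        then show ?thesis using False by simp
      qed
    qed
  qed
  moreover have "(\<Sum>k. if k = 0 then 1 else 0 :: complex) = 1"
    using suminf_finite[of "{0}" "\<lambda>k. if k = 0 then 1 else 0 :: complex"] by simp
  ultimately have S1: "S \<longlonglongrightarrow> 1" by simp
  have "qpoch_inf (q * a / b) q * qpoch_inf (q * a / c) q * qpoch_inf (q * a / d) q * qpoch_inf z q * S 0 =
    qpoch_inf (q * a) q * qpoch_inf (d * z) q * qpoch_inf (c * z) q * qpoch_inf (b * z) q * 1"
  proof (rule LIMSEQ_unique)
    show "(\<lambda>n. qpoch (q * a / b) q n * qpoch (q * a / c) q n * qpoch (q * a / d) q n * qpoch z q n * S 0) \<longlonglongrightarrow>
       qpoch_inf (q * a / b) q * qpoch_inf (q * a / c) q * qpoch_inf (q * a / d) q * qpoch_inf z q * S 0"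
      by (intro tendsto_mult tendsto_const qpoch_tendsto q1)
    show "(\<lambda>n. qpoch (q * a / b) q n * qpoch (q * a / c) q n * qpoch (q * a / d) q n * qpoch z q n * S 0) \<longlonglongrightarrow>
       qpoch_inf (q * a) q * qpoch_inf (d * z) q * qpoch_inf (c * z) q * qpoch_inf (b * z) q * 1"
      unfolding iter by (intro tendsto_mult S1 qpoch_tendsto q1)
  qed
  then show ?thesis by (simp add: S_def)
qed

end

subsection \<open>Bailey's transformation\<close>

text \<open>The terms are x ^ j * r ^ (j (j - 1) / 2), and the quotient of consecutive terms tends
  to 0. Such majorants arise below from products of differences of powers of q.\<close>

lemma summable_prod_geometric:
  fixes x r :: real
  assumes x: "x \<ge> 0" and r: "0 \<le> r" "r < 1"
  shows "summable (\<lambda>j. \<Prod>i<j. x * r ^ i)"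
proof -
  have "(\<lambda>j. x * r ^ j) \<longlonglongrightarrow> x * 0"
    by (intro tendsto_intros LIMSEQ_power_zero) (use r in auto)
  then have "(\<lambda>j. x * r ^ j) \<longlonglongrightarrow> 0" by simp
  then have "eventually (\<lambda>j. x * r ^ j < 1 / 2) sequentially" by (rule order_tendstoD(2)) simp
  then obtain N where N: "\<And>j. j \<ge> N \<Longrightarrow> x * r ^ j < 1 / 2" by (auto simp: eventually_sequentially)
  show ?thesis
  proof (rule summable_ratio_test[of "1 / 2" N])
    fix j assume "N \<le> j"
    have p: "0 \<le> (\<Prod>i<j. x * r ^ i)" using x r by (intro prod_nonneg) auto
    have "(\<Prod>i<j. x * r ^ i) * (x * r ^ j) \<le> (\<Prod>i<j. x * r ^ i) * (1 / 2)"
      using N[OF \<open>N \<le> j\<close>] p by (intro mult_left_mono) auto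
    moreover have p': "0 \<le> (\<Prod>i<Suc j. x * r ^ i)" using x r by (intro prod_nonneg) auto
    ultimately show "norm (\<Prod>i<Suc j. x * r ^ i) \<le> 1 / 2 * norm (\<Prod>i<j. x * r ^ i)"
      unfolding real_norm_def abs_of_nonneg[OF p] abs_of_nonneg[OF p'] by simp
  qed simp
qed

context
  fixes q :: complex
  assumes q0: "q \<noteq> 0" and q1: "norm q < 1"
begin

text \<open>The bound \<open>A j\<close> holds on the whole lattice; together with the weights
  \<open>q ^ k\<close> it gives a majorant in product form.\<close>

lemma jackson_half_sum_swap:
  assumes G: "\<And>k. G (q ^ k * c) = (\<Sum>j. \<psi> j (q ^ k * c))"
    and bound: "\<And>j k. norm (\<psi> j (q ^ k * c)) \<le> A j" and A: "summable A" "\<And>j. 0 \<le> A j"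
  shows "jackson_half q c G = (\<Sum>j. jackson_half q c (\<psi> j))"
    and "summable (\<lambda>j. jackson_half q c (\<psi> j))"
proof -
  have sB: "summable (\<lambda>k. norm q ^ k * norm c)" using q1 by (intro summable_mult2) auto
  have b: "norm (q ^ k * c * \<psi> j (q ^ k * c)) \<le> A j * (norm q ^ k * norm c)" for j k
    unfolding norm_mult norm_power
    using mult_right_mono[OF bound[of j k], of "norm q ^ k * norm c"] by (simp add: mult.commute)
  have sj: "summable (\<lambda>j. \<psi> j (q ^ k * c))" for k
    by (rule summable_comparison_test'[OF A(1)]) (rule bound)
  have "jackson_half q c G = (\<Sum>k. \<Sum>j. q ^ k * c * \<psi> j (q ^ k * c))"
    unfolding jackson_half_def G by (simp add: suminf_mult sj)
  also have "\<dots> = (\<Sum>j. \<Sum>k. q ^ k * c * \<psi> j (q ^ k * c))"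
    by (rule suminf_swap_bounded[symmetric, OF b A sB]) simp
  finally show "jackson_half q c G = (\<Sum>j. jackson_half q c (\<psi> j))" by (simp add: jackson_half_def)
  show "summable (\<lambda>j. jackson_half q c (\<psi> j))"
  proof (rule summable_comparison_test')
    show "summable (\<lambda>j. A j * (\<Sum>k. norm q ^ k * norm c))" using A by (intro summable_mult2) auto
    fix j
    have sn: "summable (\<lambda>k. norm (q ^ k * c * \<psi> j (q ^ k * c)))"
      by (rule summable_comparison_test'[where g = "\<lambda>k. A j * (norm q ^ k * norm c)"])
         (use b sB in \<open>simp_all add: summable_mult\<close>)
    have "norm (jackson_half q c (\<psi> j)) \<le> (\<Sum>k. norm (q ^ k * c * \<psi> j (q ^ k * c)))"
      unfolding jackson_half_def by (rule summable_norm[OF sn])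
    also have "\<dots> \<le> (\<Sum>k. A j * (norm q ^ k * norm c))"
      by (rule suminf_le) (use b sn sB in \<open>simp_all add: summable_mult\<close>)
    also have "\<dots> = A j * (\<Sum>k. norm q ^ k * norm c)" using sB by (rule suminf_mult)
    finally show "norm (jackson_half q c (\<psi> j)) \<le> A j * (\<Sum>k. norm q ^ k * norm c)" .
  qed
qed

text \<open>This clears the denominators of the factor (1 / w; q) of index \<open>j\<close> in a
  6phi5 term: the power of \<open>w\<close> comes from the argument \<open>g * w\<close>.\<close>

lemma prod_minus_powers:
  assumes "w \<noteq> 0"
  shows "(\<Prod>i<j. w - q ^ i) = qpoch (1 / w) q j * w ^ j"
  using assms by (induction j) (simp_all add: qpoch_Suc field_simps)

lemma qpoch_inf_prod_minus_powers:
  "qpoch_inf (q * w) q = (\<Prod>i<j. 1 - q * w * q ^ i) * qpoch_inf (q * (w * q ^ j)) q"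
  using qpoch_inf_split[OF q1, of "q * w" j] by (simp add: qpoch_def mult_ac)

text \<open>After the shift by \<open>q ^ j\<close> the polynomial supplies just the factors that
  complete the tail in \<open>qpoch_inf_prod_minus_powers\<close> to an infinite product.\<close>

lemma prod_minus_powers_shift:
  "(\<Prod>i<j. w * q ^ j - q ^ i) = (\<Prod>i<j. - (q ^ i)) * (\<Prod>i<j. 1 - q * w * q ^ i)"
proof -
  have "(\<Prod>i<j. 1 - q * w * q ^ i) = (\<Prod>i<j. 1 - q * w * q ^ (j - Suc i))"
    by (rule prod.nat_diff_reindex[symmetric])
  then have "(\<Prod>i<j. - (q ^ i)) * (\<Prod>i<j. 1 - q * w * q ^ i) = (\<Prod>i<j. - (q ^ i) * (1 - q * w * q ^ (j - Suc i)))"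
    by (simp only: prod.distrib)
  also have "\<dots> = (\<Prod>i<j. w * q ^ j - q ^ i)"
  proof (rule prod.cong[OF refl])
    fix i assume "i \<in> {..<j}"
    then have "q ^ j = q ^ (Suc i + (j - Suc i))" by simp
    then have "q ^ j = q * q ^ i * q ^ (j - Suc i)" by (simp add: power_add)
    then show "- (q ^ i) * (1 - q * w * q ^ (j - Suc i)) = w * q ^ j - q ^ i" by (simp add: algebra_simps)
  qed
  finally show ?thesis ..
qed

section \<open>Expansion of the integrand by the 6phi5 sum\<close>

context
  fixes a b c d e f g l :: complex
  assumes nz: "a \<noteq> 0" "b \<noteq> 0" "c \<noteq> 0" "d \<noteq> 0" "e \<noteq> 0" "f \<noteq> 0"
    and l: "l = d * e * f / (q * a)" and g: "g = q * a / (b * c)"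
    and a: "qpoch_inf a q \<noteq> 0"
    and bcdef: "qpoch_inf (q * a / b) q \<noteq> 0" "qpoch_inf (q * a / c) q \<noteq> 0" "qpoch_inf (q * a / d) q \<noteq> 0"
       "qpoch_inf (q * a / e) q \<noteq> 0" "qpoch_inf (q * a / f) q \<noteq> 0"
    and reg: "regular q l d" "regular q l e" "regular q l f" "regular q l g"
    and al: "qpoch_inf (q * a / l) q \<noteq> 0"
    and ll: "qpoch_inf l q \<noteq> 0" "qpoch_inf (q / l) q \<noteq> 0"
    and conv: "norm (g / l) < 1"
begin

lemma l_nz: "l \<noteq> 0" and g_nz: "g \<noteq> 0"
  using nz q0 by (auto simp: l g)

text \<open>The part without \<open>h\<close> of the residue at an outer pole z = 1 / w; the factors
  with \<open>q * w\<close> and \<open>q * l * w\<close> come from the residue at that pole.\<close>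

definition bailey_integrand :: "complex \<Rightarrow> complex" where
  "bailey_integrand w = qpoch_inf (q * w) q * qpoch_inf (q * l * w) q *
     (qpoch_inf (q * a / b * w) q * qpoch_inf (q * a / c * w) q) *
     inverse (qpoch_inf (d * w) q * qpoch_inf (e * w) q * qpoch_inf (f * w) q * qpoch_inf (g * w) q)"

definition coeff6 :: "nat \<Rightarrow> complex" where
  "coeff6 j = (1 - a * q ^ (2 * j)) / (1 - a) *
     (qpochs [a, b, c] q j / qpochs [q, q * a / b, q * a / c] q j)"

definition expansion_term :: "nat \<Rightarrow> complex \<Rightarrow> complex" where
  "expansion_term j w = qpoch_inf (q * w) q * qpoch_inf (q * l * w) q * qpoch_inf (q * a * q ^ j * w) q *
     inverse (qpoch_inf (d * w) q * qpoch_inf (e * w) q * qpoch_inf (f * w) q) * (\<Prod>i<j. w - q ^ i)"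

text \<open>The factor independent of \<open>w\<close> that is left when the 6phi5 sum is solved for
  the product (q a w / b, q a w / c; q) / (g w; q).\<close>

definition expansion_const :: complex where
  "expansion_const = qpoch_inf (q * a / b) q * qpoch_inf (q * a / c) q /
     (qpoch_inf (q * a) q * qpoch_inf g q)"

abbreviation expansion :: "nat \<Rightarrow> complex \<Rightarrow> complex" where
  "expansion j w \<equiv> expansion_const * coeff6 j * g ^ j * expansion_term j w"

text \<open>The 6phi5 sum with third parameter 1 / w and argument \<open>g * w\<close> evaluates the
  quotient of infinite products that contains b and c. The product in \<open>q * a * w\<close> is
  absorbed into the terms and turns into a tail.\<close>

lemma bailey_integrand_expand:
  assumes w: "w \<noteq> 0" and aw: "qpoch_inf (q * a * w) q \<noteq> 0" and gw: "qpoch_inf (g * w) q \<noteq> 0"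
    and cw: "vwp_convergent q (1 / w) (g * w)"
  shows "bailey_integrand w = (\<Sum>j. expansion j w)"
proof -
  define S where "S = (\<Sum>j. vwp_term q a [b, c, 1 / w] (g * w) j)"
  have z: "q * a = b * c * (1 / w) * (g * w)" using w nz by (simp add: g)
  have aw': "qpoch_inf (q * a / (1 / w)) q \<noteq> 0" using aw by simp
  have "qpoch_inf (q * a / b) q * qpoch_inf (q * a / c) q * qpoch_inf (q * a / (1 / w)) q * qpoch_inf (g * w) q * S =
    qpoch_inf (q * a) q * qpoch_inf (1 / w * (g * w)) q * qpoch_inf (c * (g * w)) q * qpoch_inf (b * (g * w)) q"
    unfolding S_def by (rule vwp6_sum[OF q0 q1 z _ _ _ a bcdef(1,2) aw' cw]) (use nz w in auto)
  moreover have "1 / w * (g * w) = g" "c * (g * w) = q * a / b * w" "b * (g * w) = q * a / c * w" "q * a / (1 / w) = q * a * w"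
    using w nz by (simp_all add: g)
  ultimately have sum: "qpoch_inf (q * a / b) q * qpoch_inf (q * a / c) q * qpoch_inf (q * a * w) q * qpoch_inf (g * w) q * S =
    qpoch_inf (q * a) q * qpoch_inf g q * qpoch_inf (q * a / b * w) q * qpoch_inf (q * a / c * w) q" by simp
  have qa: "qpoch_inf (q * a) q \<noteq> 0" using qpoch_inf_shift_nz(2)[OF q0 q1 a, of 1] by simp
  have gn: "qpoch_inf g q \<noteq> 0" using reg(4) by (simp add: regular_def)
  have quot: "qpoch_inf (q * a / b * w) q * qpoch_inf (q * a / c * w) q * inverse (qpoch_inf (g * w) q) =
     expansion_const * (qpoch_inf (q * a * w) q * S)"
    using sum qa gn gw unfolding expansion_const_def by (simp add: field_simps)
  define P where "P = qpoch_inf (q * w) q * qpoch_inf (q * l * w) q *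
     inverse (qpoch_inf (d * w) q * qpoch_inf (e * w) q * qpoch_inf (f * w) q)"
  have sm: "summable (\<lambda>j. vwp_term q a [b, c, 1 / w] (g * w) j)"
    by (rule vwp6_summable[OF q0 q1 a bcdef(1,2) aw' cw])
  have summand: "expansion j w =
     P * expansion_const * qpoch_inf (q * a * w) q * vwp_term q a [b, c, 1 / w] (g * w) j" for j
  proof -
    have s: "qpoch_inf (q * a * w) q = qpoch (q * a * w) q j * qpoch_inf (q * a * q ^ j * w) q"
      using qpoch_inf_split[OF q1, of "q * a * w" j] by (simp add: mult_ac)
    then have "qpoch (q * a * w) q j \<noteq> 0" using aw by auto
    then have "qpoch_inf (q * a * w) q * vwp_term q a [b, c, 1 / w] (g * w) j =
       coeff6 j * g ^ j * (qpoch_inf (q * a * q ^ j * w) q * (\<Prod>i<j. w - q ^ i))"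
      unfolding vwp_term_def coeff6_def prod_minus_powers[OF w]
      by (simp add: s power_mult_distrib)
    note E = this
    have "expansion j w =
      P * expansion_const * (coeff6 j * g ^ j * (qpoch_inf (q * a * q ^ j * w) q * (\<Prod>i<j. w - q ^ i)))"
      unfolding expansion_term_def P_def by (simp only: mult_ac)
    then show ?thesis unfolding E[symmetric] by (simp only: mult.assoc)
  qed
  have "bailey_integrand w = P * (qpoch_inf (q * a / b * w) q * qpoch_inf (q * a / c * w) q * inverse (qpoch_inf (g * w) q))"
    unfolding bailey_integrand_def P_def inverse_mult_distrib by (simp only: mult_ac)
  also have "\<dots> = P * expansion_const * qpoch_inf (q * a * w) q * S" unfolding quot by (simp only: mult_ac)
  also have "\<dots> = (\<Sum>j. expansion j w)"
    unfolding S_def summand by (rule suminf_mult[OF sm, symmetric])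
  finally show ?thesis .
qed

lemma coeff6_bounded: "bounded2 (\<lambda>n j. coeff6 j)"
proof -
  have eq: "(\<lambda>n j. coeff6 j) = (\<lambda>n j. qpoch (a * q ^ (2 * j)) q 1 * inverse (qpoch a q 1) *
     (qpoch a q j * qpoch b q j * qpoch c q j * (inverse (qpoch q q j) * inverse (qpoch (q * a / b) q j) * inverse (qpoch (q * a / c) q j))))"
    by (intro ext) (simp add: coeff6_def qpoch_Suc divide_inverse mult.assoc)
  show ?thesis unfolding eq
    by (intro bounded2_mult bounded2_qpoch bounded2_inverse_qpoch q0 q1 a bcdef qpoch_q_nz)
qed

text \<open>Apart from the displayed product, all factors of an expansion term are bounded uniformly
  in the index and along the lattice, so that product decides about convergence.\<close>

lemma expansion_bound:
  assumes nzc: "qpoch_inf (d * x) q \<noteq> 0" "qpoch_inf (e * x) q \<noteq> 0" "qpoch_inf (f * x) q \<noteq> 0"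
    and prod: "\<And>j k. norm (g ^ j * (\<Prod>i<j. q ^ k * x - q ^ i)) \<le> A j"
  shows "\<exists>C\<ge>0. \<forall>j k. norm (expansion j (q ^ k * x)) \<le> C * A j"
proof -
  define F where "F k j = qpoch_inf (q * x * q ^ k) q * qpoch_inf (q * l * x * q ^ k) q * qpoch_inf (q * a * x * q ^ (j + k)) q *
     (inverse (qpoch_inf (d * x * q ^ k) q) * inverse (qpoch_inf (e * x * q ^ k) q) * inverse (qpoch_inf (f * x * q ^ k) q))" for k j
  have "bounded2 (\<lambda>k j. coeff6 j * F k j)"
    unfolding F_def by (intro bounded2_mult bounded2_qpoch_inf bounded2_inverse_qpoch_inf q0 q1 nzc coeff6_bounded)
  then obtain C where C: "\<And>k j. norm (coeff6 j * F k j) \<le> C" by (auto simp: bounded2_def)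
  have C0: "C \<ge> 0" using C norm_ge_zero order_trans by blast
  have eq: "expansion j (q ^ k * x) =
     expansion_const * ((coeff6 j * F k j) * (g ^ j * (\<Prod>i<j. q ^ k * x - q ^ i)))" for j k
  proof -
    have "q * x * q ^ k = q * (q ^ k * x)" "q * l * x * q ^ k = q * l * (q ^ k * x)" "q * a * x * q ^ (j + k) = q * a * q ^ j * (q ^ k * x)"
      "d * x * q ^ k = d * (q ^ k * x)" "e * x * q ^ k = e * (q ^ k * x)" "f * x * q ^ k = f * (q ^ k * x)"
      by (simp_all add: power_add)
    note arg = this
    show ?thesis unfolding F_def arg expansion_term_def inverse_mult_distrib by (simp only: mult_ac)
  qed
  have "norm (expansion j (q ^ k * x)) \<le> norm expansion_const * C * A j" for j k
  proof -
    have "norm ((coeff6 j * F k j) * (g ^ j * (\<Prod>i<j. q ^ k * x - q ^ i))) \<le> C * A j"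
      unfolding norm_mult[of "coeff6 j * F k j"] by (intro mult_mono C prod C0) auto
    then have "norm expansion_const * norm ((coeff6 j * F k j) * (g ^ j * (\<Prod>i<j. q ^ k * x - q ^ i))) \<le> norm expansion_const * (C * A j)"
      by (intro mult_left_mono) auto
    then show ?thesis unfolding eq norm_mult[of expansion_const] by (simp only: mult.assoc)
  qed
  then show ?thesis using C0 by (intro exI[of _ "norm expansion_const * C"]) auto
qed

text \<open>The two lattices behave differently. On q ^ k the product vanishes for j > k and is
  otherwise bounded by powers of q with quadratically growing exponent, whatever g is. On q ^ k / l
  the decay comes from (g / l) ^ j, and \<open>conv\<close> is used.\<close>

lemma expansion_majorant:
  assumes "x = 1 \<or> x = 1 / l"
  shows "\<exists>A. (\<forall>j k. norm (g ^ j * (\<Prod>i<j. q ^ k * x - q ^ i)) \<le> A j) \<and> summable A \<and> (\<forall>j. 0 \<le> A j) \<and>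
    (\<forall>k. vwp_convergent q (1 / (q ^ k * x)) (g * (q ^ k * x)))"
  using assms
proof
  assume x: "x = 1"
  define A where "A j = (\<Prod>i<j. 2 * norm g * norm q ^ i)" for j
  have prod: "norm (g ^ j * (\<Prod>i<j. q ^ k * 1 - q ^ i)) \<le> A j" for j k
  proof (cases "j \<le> k")
    case True
    have "norm (g ^ j * (\<Prod>i<j. q ^ k * 1 - q ^ i)) = (\<Prod>i<j. norm g * norm (q ^ k - q ^ i))"
      by (simp add: norm_mult norm_power prod.distrib prod_norm)
    also have "\<dots> \<le> A j"
      unfolding A_def
    proof (rule prod_mono, intro conjI)
      fix i assume "i \<in> {..<j}"
      then have "i \<le> k" using True by simp
      have "norm (q ^ k - q ^ i) \<le> norm q ^ k + norm q ^ i" by (metis norm_power norm_triangle_ineq4)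
      also have "norm q ^ k \<le> norm q ^ i" using q1 \<open>i \<le> k\<close> by (intro power_decreasing) auto
      finally have "norm (q ^ k - q ^ i) \<le> 2 * norm q ^ i" by simp
      then have "norm g * norm (q ^ k - q ^ i) \<le> norm g * (2 * norm q ^ i)" by (intro mult_left_mono) auto
      then show "norm g * norm (q ^ k - q ^ i) \<le> 2 * norm g * norm q ^ i" by (simp add: mult_ac)
    qed auto
    finally show ?thesis .
  next
    case False
    then have z: "(\<Prod>i<j. q ^ k * 1 - q ^ i) = 0" by (intro prod_zero) auto
    have "A j \<ge> 0" unfolding A_def by (intro prod_nonneg) auto
    then show ?thesis unfolding z by simp
  qed
  have A: "summable A" "\<And>j. 0 \<le> A j"
    unfolding A_def using q1 by (auto intro!: summable_prod_geometric prod_nonneg)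
  have cx: "vwp_convergent q (1 / (q ^ k * 1)) (g * (q ^ k * 1))" for k
    unfolding vwp_convergent_def using q0 by (intro disjI2 exI[of _ k]) simp
  show ?thesis unfolding x using prod A cx by blast
next
  assume x: "x = 1 / l"
  define A where "A j = norm (g / l) ^ j * qbound q (norm l)" for j
  have prod: "norm (g ^ j * (\<Prod>i<j. q ^ k * (1 / l) - q ^ i)) \<le> A j" for j k
  proof -
    have "norm (g ^ j * (\<Prod>i<j. q ^ k * (1 / l) - q ^ i)) = norm (g / l) ^ j * (\<Prod>i<j. norm (q ^ k - l * q ^ i))"
    proof -
      have "(\<Prod>i<j. q ^ k * (1 / l) - q ^ i) = (\<Prod>i<j. (q ^ k - l * q ^ i) * (1 / l))"
        by (rule prod.cong) (use l_nz in \<open>auto simp: field_simps\<close>)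
      also have "\<dots> = (\<Prod>i<j. q ^ k - l * q ^ i) * (1 / l) ^ j"
        by (simp only: prod.distrib prod_constant card_lessThan)
      finally have "g ^ j * (\<Prod>i<j. q ^ k * (1 / l) - q ^ i) = (g / l) ^ j * (\<Prod>i<j. q ^ k - l * q ^ i)"
        by (simp add: power_divide)
      then show ?thesis by (simp add: norm_mult norm_power prod_norm)
    qed
    also have "\<dots> \<le> norm (g / l) ^ j * (\<Prod>i<j. 1 + norm l * norm q ^ i)"
    proof (intro mult_left_mono prod_mono conjI)
      fix i
      have "norm (q ^ k - l * q ^ i) \<le> norm q ^ k + norm l * norm q ^ i"
        by (metis norm_mult norm_power norm_triangle_ineq4)
      also have "norm q ^ k \<le> 1" using q1 by (simp add: power_le_one)
      finally show "norm (q ^ k - l * q ^ i) \<le> 1 + norm l * norm q ^ i" by simp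
    qed auto
    also have "\<dots> \<le> A j" unfolding A_def
      by (intro mult_left_mono prod_norm_le_qbound q1) auto
    finally show ?thesis .
  qed
  have A: "summable A" "\<And>j. 0 \<le> A j"
    unfolding A_def using conv by (auto intro!: summable_mult2 summable_geometric)
  have cx: "vwp_convergent q (1 / (q ^ k * (1 / l))) (g * (q ^ k * (1 / l)))" for k
  proof -
    have "norm (g * (q ^ k * (1 / l))) = norm (g / l) * norm q ^ k" by (simp add: norm_mult norm_power norm_divide)
    also have "\<dots> \<le> norm (g / l) * 1" using q1 by (intro mult_left_mono) (auto simp: power_le_one)
    also have "\<dots> < 1" using conv by simp
    finally show ?thesis unfolding vwp_convergent_def by simp
  qed
  show ?thesis unfolding x using prod A cx by blast
qed

lemma half_swap:
  assumes x: "x = 1 \<or> x = 1 / l"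
  shows "jackson_half q x bailey_integrand = (\<Sum>j. jackson_half q x (expansion j))"
    "summable (\<lambda>j. jackson_half q x (expansion j))"
proof -
  note regd = reg[unfolded regular_def]
  obtain A where prod: "\<And>j k. norm (g ^ j * (\<Prod>i<j. q ^ k * x - q ^ i)) \<le> A j"
    and A: "summable A" "\<And>j. 0 \<le> A j" and cx: "\<And>k. vwp_convergent q (1 / (q ^ k * x)) (g * (q ^ k * x))"
    using expansion_majorant[OF x] by blast
  have qa: "qpoch_inf (q * a * x) q \<noteq> 0"
    using x al qpoch_inf_shift_nz(2)[OF q0 q1 a, of 1] by auto
  obtain C where C: "C \<ge> 0" "\<And>j k. norm (expansion j (q ^ k * x)) \<le> C * A j"
    using expansion_bound[of x A] prod regd x by auto
  have expand: "bailey_integrand (q ^ k * x) = (\<Sum>j. expansion j (q ^ k * x))" for k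
  proof (rule bailey_integrand_expand)
    show "q ^ k * x \<noteq> 0" using q0 l_nz x by auto
    show "qpoch_inf (q * a * (q ^ k * x)) q \<noteq> 0"
      using qpoch_inf_shift_nz(1)[OF q0 q1 qa, of k] by (simp add: mult_ac)
    have "qpoch_inf (g * x) q \<noteq> 0" using regd x by auto
    then show "qpoch_inf (g * (q ^ k * x)) q \<noteq> 0"
      using qpoch_inf_shift_nz(1)[OF q0 q1, of "g * x" k] by (simp add: mult_ac)
  qed (rule cx)
  have sA: "summable (\<lambda>j. C * A j)" by (rule summable_mult[OF A(1)])
  have A0: "0 \<le> C * A j" for j using C(1) A(2) by simp
  note swap = jackson_half_sum_swap[where A = "\<lambda>j. C * A j" and G = bailey_integrand and c = x
    and \<psi> = expansion, OF expand C(2) sA A0]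
  show "jackson_half q x bailey_integrand = (\<Sum>j. jackson_half q x (expansion j))"
    by (rule swap(1))
  show "summable (\<lambda>j. jackson_half q x (expansion j))"
    by (rule swap(2))
qed

section \<open>Integration of the expansion term by term\<close>

definition sign_power :: "nat \<Rightarrow> complex" where
  "sign_power j = (\<Prod>i<j. - (q ^ i))"

text \<open>The shift by \<open>q ^ j\<close> produces a Saalschuetz integrand with d, e, f and l
  all multiplied by \<open>q ^ j\<close>. It is balanced because d e f / l = q a.\<close>

lemma expansion_term_shift:
  "expansion_term j (w * q ^ j) = sign_power j * saal q (l * q ^ j) (d * q ^ j) (e * q ^ j) (f * q ^ j) w"
proof -
  have 1: "d * q ^ j * (e * q ^ j) * (f * q ^ j) / (l * q ^ j) * w = q * a * q ^ j * (w * q ^ j)"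
    using nz q0 by (simp add: l)
  have 2: "q * (l * q ^ j) * w = q * l * (w * q ^ j)" "d * q ^ j * w = d * (w * q ^ j)"
    "e * q ^ j * w = e * (w * q ^ j)" "f * q ^ j * w = f * (w * q ^ j)" by simp_all
  show ?thesis
    unfolding expansion_term_def saal_def 1 2 prod_minus_powers_shift
      qpoch_inf_prod_minus_powers[of w j] sign_power_def by (simp only: mult_ac)
qed

lemma shifted_regular:
  assumes "regular q l x"
  shows "qpoch_inf (x * q ^ j) q \<noteq> 0" "qpoch_inf (x * q ^ j * (1 / (l * q ^ j))) q \<noteq> 0"
    "regular q (l * q ^ j) (x * q ^ j)"
proof -
  have l': "l * q ^ j \<noteq> 0" using l_nz q0 by simp
  show 1: "qpoch_inf (x * q ^ j) q \<noteq> 0" "qpoch_inf (x * q ^ j * (1 / (l * q ^ j))) q \<noteq> 0"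
    using assms qpoch_inf_shift_nz(1)[OF q0 q1, of x j] q0 by (simp_all add: regular_def)
  then show "regular q (l * q ^ j) (x * q ^ j)" by (simp add: regular_def)
qed

text \<open>On the lattice q ^ k the product in the expansion term kills the first \<open>j\<close>
  points, so the sum starts at q ^ j. On the other lattice nothing is lost, since 1 / l is q ^ j
  times 1 / (l q ^ j). Thus the end points fit the parameter l q ^ j.\<close>

lemma expansion_term_half_sums:
  "(\<lambda>k. q ^ k * 1 * expansion_term j (q ^ k * 1)) sums
     (q ^ j * sign_power j * jackson_half q 1 (saal q (l * q ^ j) (d * q ^ j) (e * q ^ j) (f * q ^ j)))"
  "(\<lambda>k. q ^ k * (1 / l) * expansion_term j (q ^ k * (1 / l))) sums
     (q ^ j * sign_power j * jackson_half q (1 / (l * q ^ j)) (saal q (l * q ^ j) (d * q ^ j) (e * q ^ j) (f * q ^ j)))"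
proof -
  define S where "S = saal q (l * q ^ j) (d * q ^ j) (e * q ^ j) (f * q ^ j)"
  have s: "(\<lambda>k. q ^ j * sign_power j * (q ^ k * x * S (q ^ k * x))) sums (q ^ j * sign_power j * jackson_half q x S)"
    if "x = 1 \<or> x = 1 / (l * q ^ j)" for x
    unfolding jackson_half_def S_def
    by (intro sums_mult summable_sums saal_summable q0 q1)
       (use that shifted_regular[OF reg(1), of j] shifted_regular[OF reg(2), of j] shifted_regular[OF reg(3), of j] in auto)
  have e: "q ^ j * sign_power j * (q ^ k * 1 * S (q ^ k * 1)) = q ^ (k + j) * 1 * expansion_term j (q ^ (k + j) * 1)" for k
    using expansion_term_shift[of j "q ^ k"] by (simp add: S_def power_add)
  have "(\<lambda>k. q ^ (k + j) * 1 * expansion_term j (q ^ (k + j) * 1)) sums (q ^ j * sign_power j * jackson_half q 1 S)"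
    using s[of 1] unfolding e by simp
  moreover have "expansion_term j (q ^ k) = 0" if "k < j" for k
    using that unfolding expansion_term_def by auto
  ultimately show "(\<lambda>k. q ^ k * 1 * expansion_term j (q ^ k * 1)) sums (q ^ j * sign_power j * jackson_half q 1 (saal q (l * q ^ j) (d * q ^ j) (e * q ^ j) (f * q ^ j)))"
    unfolding S_def[symmetric] by (subst sums_zero_iff_shift[of j, symmetric]) simp_all
  have e': "q ^ j * sign_power j * (q ^ k * (1 / (l * q ^ j)) * S (q ^ k * (1 / (l * q ^ j)))) =
     q ^ k * (1 / l) * expansion_term j (q ^ k * (1 / l))" for k
  proof -
    have "q ^ k * (1 / l) = q ^ k * (1 / (l * q ^ j)) * q ^ j" using q0 by simp
    then show ?thesis using q0 expansion_term_shift[of j "q ^ k * (1 / (l * q ^ j))"] by (simp add: S_def)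
  qed
  show "(\<lambda>k. q ^ k * (1 / l) * expansion_term j (q ^ k * (1 / l))) sums
     (q ^ j * sign_power j * jackson_half q (1 / (l * q ^ j)) (saal q (l * q ^ j) (d * q ^ j) (e * q ^ j) (f * q ^ j)))"
    using s[OF disjI2[OF refl]] unfolding e' unfolding S_def .
qed

text \<open>The value of the Saalschuetz integral for \<open>j = 0\<close>.\<close>

definition saal_const :: complex where
  "saal_const = - (qpoch_inf (q * a / f) q * qpoch_inf (q * a / e) q * qpoch_inf (q * a / d) q *
      (qpoch_inf q q * qpoch_inf (q / l) q * qpoch_inf l q / l)) /
    (qpoch_inf d q * qpoch_inf (d / l) q * (qpoch_inf e q * qpoch_inf (e / l) q) * (qpoch_inf f q * qpoch_inf (f / l) q))"

text \<open>Multiplying d, e, f and l by \<open>q ^ j\<close> splits finite shifted factorials off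
  the value for \<open>j = 0\<close>. They are the factors with d, e and f of the very-well-poised
  term; all other factors collapse to (1 / l) ^ j.\<close>

lemma saal_shifted_value:
  "q ^ j * sign_power j * jackson q (l * q ^ j) (saal q (l * q ^ j) (d * q ^ j) (e * q ^ j) (f * q ^ j)) =
    saal_const * (qpoch d q j * qpoch e q j * qpoch f q j /
      (qpoch (q * a / d) q j * qpoch (q * a / e) q j * qpoch (q * a / f) q j)) * (1 / l) ^ j"
proof -
  note regd = reg[unfolded regular_def]
  have l': "l * q ^ j \<noteq> 0" using l_nz q0 by simp
  define J where "J = jackson q (l * q ^ j) (saal q (l * q ^ j) (d * q ^ j) (e * q ^ j) (f * q ^ j))"
  define \<epsilon> where "\<epsilon> = (\<Prod>i<j. - 1 / q ^ Suc i)"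
  have ql: "qpoch_inf (q / (l * q ^ j)) q = (q / l) ^ j * \<epsilon> * qpoch l q j * qpoch_inf (q / l) q"
    using qpoch_inf_split[OF q1, of "q / l / q ^ j" j] qpoch_div_power[of "q / l" q j] q0 l_nz
    by (simp add: \<epsilon>_def)
  have lsp: "qpoch_inf l q = qpoch l q j * qpoch_inf (l * q ^ j) q" by (rule qpoch_inf_split[OF q1])
  have \<epsilon>0: "\<epsilon> \<noteq> 0" using q0 by (simp add: \<epsilon>_def)
  have ql0: "qpoch_inf (q / (l * q ^ j)) q \<noteq> 0"
    unfolding ql using q0 l_nz \<epsilon>0 ll lsp by auto
  \<comment> \<open>\<open>sign_power j\<close> is (-1) ^ j q ^ (j (j - 1) / 2), and \<epsilon>
    comes from reflecting the product in q / (l q ^ j). They cancel factor by factor, up to a power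
    of q.\<close>
  have sgn: "sign_power j * \<epsilon> * (q / l) ^ j = (1 / l) ^ j"
  proof -
    have "sign_power j * \<epsilon> = (\<Prod>i<j. 1 / q)"
      unfolding sign_power_def \<epsilon>_def prod.distrib[symmetric]
      by (rule prod.cong) (use q0 in auto)
    then have "sign_power j * \<epsilon> * (q / l) ^ j = (1 / q * (q / l)) ^ j" by (simp only: prod_constant card_lessThan power_mult_distrib)
    then show ?thesis using q0 by simp
  qed
  have qa: "d * q ^ j * (e * q ^ j) / (l * q ^ j) = q * a / f * q ^ j" "d * q ^ j * (f * q ^ j) / (l * q ^ j) = q * a / e * q ^ j"
    "e * q ^ j * (f * q ^ j) / (l * q ^ j) = q * a / d * q ^ j" "d * q ^ j / (l * q ^ j) = d / l"
    "e * q ^ j / (l * q ^ j) = e / l" "f * q ^ j / (l * q ^ j) = f / l"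
    using nz q0 by (simp_all add: l field_simps)
  have S: "qpoch_inf (d * q ^ j) q * qpoch_inf (d / l) q * (qpoch_inf (e * q ^ j) q * qpoch_inf (e / l) q) *
      (qpoch_inf (f * q ^ j) q * qpoch_inf (f / l) q) * J =
    - (qpoch_inf (q * a / f * q ^ j) q * qpoch_inf (q * a / e * q ^ j) q * qpoch_inf (q * a / d * q ^ j) q *
       (qpoch_inf q q * qpoch_inf (q / (l * q ^ j)) q * qpoch_inf (l * q ^ j) q / (l * q ^ j)))"
    using nonterminating_q_Saalschuetz[OF q0 q1 l' shifted_regular(3)[OF reg(1)] shifted_regular(3)[OF reg(2)]
      shifted_regular(3)[OF reg(3)] ql0] unfolding qa J_def .
  have step: "q ^ j * sign_power j * (qpoch_inf q q * qpoch_inf (q / (l * q ^ j)) q * qpoch_inf (l * q ^ j) q / (l * q ^ j)) =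
     (1 / l) ^ j * (qpoch_inf q q * qpoch_inf (q / l) q * qpoch_inf l q / l)"
  proof -
    have "q ^ j * sign_power j * (qpoch_inf q q * qpoch_inf (q / (l * q ^ j)) q * qpoch_inf (l * q ^ j) q / (l * q ^ j)) =
       (sign_power j * \<epsilon> * (q / l) ^ j) * (qpoch_inf q q * qpoch_inf (q / l) q * qpoch_inf l q / l)"
      unfolding ql lsp using q0 by simp
    then show ?thesis unfolding sgn .
  qed
  \<comment> \<open>Field algebra with the shifted factorials as variables: \<open>A\<close>,
    \<open>B\<close>, \<open>C\<close>, \<open>U\<close>, \<open>V\<close>, \<open>T\<close> stand
    for finite parts and \<open>P\<close>, \<open>Q\<close>, \<open>R\<close>, \<open>u\<close>,
    \<open>v\<close>, \<open>t\<close> for the corresponding tails.\<close>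
  have general: "s * J = - (A * P * (B * Q) * (C * R) * W) / (U * u * X * (V * v * Y) * (T * t * Z)) * (U * V * T / (C * B * A)) * L"
    if "u * X * (v * Y) * (t * Z) * J = - (P * Q * R * N)" "s * N = L * W" "A \<noteq> 0" "B \<noteq> 0" "C \<noteq> 0"
      "U \<noteq> 0" "u \<noteq> 0" "V \<noteq> 0" "v \<noteq> 0" "T \<noteq> 0" "t \<noteq> 0" "X \<noteq> 0" "Y \<noteq> 0" "Z \<noteq> 0"
    for s J A P B Q C R W U u X V v Y T t Z L N :: complex
  proof -
    define M where "M = u * X * (v * Y) * (t * Z)"
    have M: "M \<noteq> 0" using that by (simp add: M_def)
    have "M * (s * J) = s * (M * J)" by simp
    also have "\<dots> = s * (- (P * Q * R * N))" using that(1) unfolding M_def by simp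
    also have "\<dots> = - (P * Q * R * (s * N))" by simp
    also have "\<dots> = - (P * Q * R * (L * W))" unfolding that(2) ..
    finally have MJ: "M * (s * J) = - (P * Q * R * (L * W))" .
    have "s * J = M * (s * J) / M" using M by simp
    then have "s * J = - (P * Q * R * (L * W)) / M" unfolding MJ .
    then show ?thesis using that(3-) unfolding M_def by simp (simp add: mult_ac)
  qed
  have spl: "qpoch_inf u q = qpoch u q j * qpoch_inf (u * q ^ j) q" for u by (rule qpoch_inf_split[OF q1])
  have nzs: "qpoch u q j \<noteq> 0" "qpoch_inf (u * q ^ j) q \<noteq> 0" if "qpoch_inf u q \<noteq> 0" for u
    using that spl[of u] by auto
  show ?thesis
    unfolding J_def[symmetric] saal_const_def spl[of "q * a / f"] spl[of "q * a / e"] spl[of "q * a / d"] spl[of d] spl[of e] spl[of f]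
    by (rule general[OF S step]) (use nzs regd bcdef in auto)
qed

text \<open>The 6phi5 coefficients supply the factors with b and c, the Saalschuetz values those
  with d, e and f. The argument g / l is composed of g ^ j from the expansion and l ^ (-j) from the
  integrals.\<close>

theorem jackson_bailey_integrand:
  "jackson q l bailey_integrand = expansion_const * saal_const * (\<Sum>j. vwp_term q a [b, c, d, e, f] (g / l) j)"
proof -
  note jd = jackson_half_def
  define K where "K j = expansion_const * coeff6 j * g ^ j" for j
  define S where "S j = saal q (l * q ^ j) (d * q ^ j) (e * q ^ j) (f * q ^ j)" for j
  have h: "jackson_half q 1 (\<lambda>w. K j * expansion_term j w) = K j * (q ^ j * sign_power j * jackson_half q 1 (S j))"
    "jackson_half q (1 / l) (\<lambda>w. K j * expansion_term j w) = K j * (q ^ j * sign_power j * jackson_half q (1 / (l * q ^ j)) (S j))" for j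
    using sums_unique[OF sums_mult[OF expansion_term_half_sums(1)[of j], of "K j"]]
      sums_unique[OF sums_mult[OF expansion_term_half_sums(2)[of j], of "K j"]]
    unfolding jd[of q _ "\<lambda>w. K j * expansion_term j w"] S_def by (simp_all add: mult_ac)
  have "jackson q l bailey_integrand =
    (\<Sum>j. jackson_half q 1 (\<lambda>w. K j * expansion_term j w)) - (\<Sum>j. jackson_half q (1 / l) (\<lambda>w. K j * expansion_term j w))"
    unfolding jackson_def half_swap(1)[OF disjI1[OF refl]] half_swap(1)[OF disjI2[OF refl]] K_def ..
  also have "\<dots> = (\<Sum>j. jackson_half q 1 (\<lambda>w. K j * expansion_term j w) - jackson_half q (1 / l) (\<lambda>w. K j * expansion_term j w))"
    by (rule suminf_diff[OF half_swap(2)[OF disjI1[OF refl], folded K_def] half_swap(2)[OF disjI2[OF refl], folded K_def]])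
  also have "\<dots> = (\<Sum>j. expansion_const * saal_const * vwp_term q a [b, c, d, e, f] (g / l) j)"
  proof (rule suminf_cong)
    fix j
    have "jackson_half q 1 (\<lambda>w. K j * expansion_term j w) - jackson_half q (1 / l) (\<lambda>w. K j * expansion_term j w)
      = K j * (q ^ j * sign_power j * jackson q (l * q ^ j) (S j))"
      unfolding h jackson_def by (simp add: right_diff_distrib)
    also have "\<dots> = K j * (saal_const * (qpoch d q j * qpoch e q j * qpoch f q j /
      (qpoch (q * a / d) q j * qpoch (q * a / e) q j * qpoch (q * a / f) q j)) * (1 / l) ^ j)"
      unfolding S_def saal_shifted_value ..
    also have "\<dots> = expansion_const * saal_const * vwp_term q a [b, c, d, e, f] (g / l) j"
      unfolding K_def coeff6_def vwp_term_def by (simp add: power_divide) (simp add: mult_ac)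
    finally show "jackson_half q 1 (\<lambda>w. K j * expansion_term j w) - jackson_half q (1 / l) (\<lambda>w. K j * expansion_term j w) =
      expansion_const * saal_const * vwp_term q a [b, c, d, e, f] (g / l) j" .
  qed
  also have "\<dots> = expansion_const * saal_const * (\<Sum>j. vwp_term q a [b, c, d, e, f] (g / l) j)"
  proof (rule suminf_mult)
    have b1: "bounded2 (\<lambda>n j. coeff6 j * (qpoch d q j * qpoch e q j * qpoch f q j * (inverse (qpoch (q * a / d) q j) *
        inverse (qpoch (q * a / e) q j) * inverse (qpoch (q * a / f) q j))))"
      by (intro bounded2_mult bounded2_qpoch bounded2_inverse_qpoch q0 q1 bcdef coeff6_bounded)
    then obtain C where C: "\<And>j. norm (coeff6 j * (qpoch d q j * qpoch e q j * qpoch f q j * (inverse (qpoch (q * a / d) q j) *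
        inverse (qpoch (q * a / e) q j) * inverse (qpoch (q * a / f) q j)))) \<le> C" by (auto simp: bounded2_def)
    show "summable (\<lambda>j. vwp_term q a [b, c, d, e, f] (g / l) j)"
    proof (rule summable_comparison_test')
      show "summable (\<lambda>j. C * norm (g / l) ^ j)" using conv by (intro summable_mult summable_geometric) simp
      fix j
      have "vwp_term q a [b, c, d, e, f] (g / l) j = coeff6 j * (qpoch d q j * qpoch e q j * qpoch f q j * (inverse (qpoch (q * a / d) q j) *
        inverse (qpoch (q * a / e) q j) * inverse (qpoch (q * a / f) q j))) * (g / l) ^ j"
        unfolding coeff6_def vwp_term_def by (simp add: divide_inverse mult.assoc)
      then show "norm (vwp_term q a [b, c, d, e, f] (g / l) j) \<le> C * norm (g / l) ^ j"
        using mult_right_mono[OF C[of j], of "norm (g / l) ^ j"] by (simp only: norm_mult norm_power) simp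
    qed
  qed
  finally show ?thesis .
qed

section \<open>From residues to 4phi3 series\<close>

lemma theta_mult:
  assumes "t \<noteq> 0" "s \<noteq> 0"
  shows "theta (t * s) q = qpoch_inf (t * s) q * qpoch_inf (q / t / s) q"
    "theta (t / s) q = qpoch_inf (t / s) q * qpoch_inf (q * s / t) q"
  using assms by (simp_all add: theta_def)

context
  fixes h :: complex
  assumes h: "h \<noteq> 0"
begin

text \<open>Each theta function contributes one inner and one outer zero: theta (h z) gives q / h
  and h, and theta (h l / z) gives h * l and q / (h * l). The inner families enter as functions of 1
  / z, the outer ones as functions of z.\<close>

definition zeros_in :: "nat \<Rightarrow> complex" where "zeros_in i = [q / h, h * l, q * a / b, q * a / c] ! i"
definition poles_in :: "nat \<Rightarrow> complex" where "poles_in i = [d, e, f, g] ! i"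
definition zeros_out :: "nat \<Rightarrow> complex" where "zeros_out i = [h, q / (h * l)] ! i"
definition poles_out :: "nat \<Rightarrow> complex" where "poles_out i = [1, 1 / l] ! i"

lemma family_values:
  "zeros_in 0 = q / h" "zeros_in 1 = h * l" "zeros_in 2 = q * a / b" "zeros_in 3 = q * a / c"
  "poles_in 0 = d" "poles_in 1 = e" "poles_in 2 = f" "poles_in 3 = g"
  "zeros_out 0 = h" "zeros_out 1 = q / (h * l)" "poles_out 0 = 1" "poles_out 1 = 1 / l"
  by (simp_all add: zeros_in_def poles_in_def zeros_out_def poles_out_def numeral_eq_Suc)

lemma prod_lessThan_4: "(\<Prod>i<4. F i) = F 0 * F 1 * F 2 * F 3" for F :: "nat \<Rightarrow> complex"
  by (simp add: eval_nat_numeral)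

lemma prod_lessThan_2: "(\<Prod>i<2. F i) = F 0 * F 1" for F :: "nat \<Rightarrow> complex"
  by (simp add: eval_nat_numeral)

lemma less_4_cases: "i < (4 :: nat) \<Longrightarrow> i = 0 \<or> i = 1 \<or> i = 2 \<or> i = 3"
  by auto

lemma less_2_cases': "i < (2 :: nat) \<Longrightarrow> i = 0 \<or> i = 1"
  by auto

text \<open>The finite inner factors complete the outer tails, so the theta functions at
  \<open>s * q ^ k\<close> leave the sum as theta functions at \<open>s\<close>. The tails in the
  denominator become the numerator parameters s and s / l. The hypothesis \<open>others\<close>
  isolates the pole's own family, which lets one proof serve all four poles \<open>s\<close>, with
  \<open>o1\<close>, \<open>o2\<close>, \<open>o3\<close> the remaining ones.\<close>

lemma inner_residue_series:
  assumes p: "p < 4" and s: "s = poles_in p"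
    and others: "\<And>k. (\<Prod>i<4. inverse (qpoch (q * s / poles_in i) q k) *
        inverse (if i = p then qpoch_inf q q else qpoch_inf (poles_in i / s) q)) =
      inverse (qpochs [q, q * s / o1, q * s / o2, q * s / o3] q k) * inverse (qpochs_inf [q, o1 / s, o2 / s, o3 / s] q)"
    and den: "qpochs_inf [q * s / o1, q * s / o2, q * s / o3] q \<noteq> 0"
  shows "(\<Sum>k. residue_term q 4 zeros_in poles_in 2 zeros_out poles_out p k) =
    theta (h * s) q * theta (h * l / s) q * qpoch_inf (q * a / b / s) q * qpoch_inf (q * a / c / s) q *
      inverse (qpoch_inf s q * qpoch_inf (s / l) q) * inverse (qpochs_inf [q, o1 / s, o2 / s, o3 / s] q) *
      qhyp [s / l, b * s / a, c * s / a, s] [q * s / o1, q * s / o2, q * s / o3] q q"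
    (is "_ = ?C * _")
proof -
  note regd = reg[unfolded regular_def]
  have s0: "s \<noteq> 0" using less_4_cases[OF p] nz g_nz by (auto simp: s family_values simp del: One_nat_def)
  have sr: "qpoch_inf s q \<noteq> 0" "qpoch_inf (s / l) q \<noteq> 0" using less_4_cases[OF p] regd by (auto simp: s family_values simp del: One_nat_def)
  have eq: "residue_term q 4 zeros_in poles_in 2 zeros_out poles_out p k =
    ?C * (qpochs [s / l, b * s / a, c * s / a, s] q k / qpochs [q, q * s / o1, q * s / o2, q * s / o3] q k * q ^ k)" for k
  proof -
    have t1: "theta (h * s) q = qpoch (h * s) q k * qpoch_inf (h * s * q ^ k) q * qpoch_inf (q / h / s) q"
      unfolding theta_mult(1)[OF h s0] using qpoch_inf_split[OF q1, of "h * s" k] by simp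
    have "h * l \<noteq> 0" using h l_nz by simp
    then have t2: "theta (h * l / s) q = qpoch_inf (h * l / s) q * (qpoch (q * s / (h * l)) q k * qpoch_inf (q * s / (h * l) * q ^ k) q)"
      unfolding theta_mult(2)[OF \<open>h * l \<noteq> 0\<close> s0] using qpoch_inf_split[OF q1, of "q * s / (h * l)" k] by simp
    have inv: "inverse (qpoch_inf (x * q ^ k) q) = qpoch x q k * inverse (qpoch_inf x q)" if "qpoch_inf x q \<noteq> 0" for x
      using qpoch_inf_split[OF q1, of x k] that by (auto simp: field_simps)
    have i1: "inverse (qpoch_inf (1 * s * q ^ k) q) = qpoch s q k * inverse (qpoch_inf s q)"
      using inv[OF sr(1)] by simp
    have i2: "inverse (qpoch_inf (1 / l * s * q ^ k) q) = qpoch (s / l) q k * inverse (qpoch_inf (s / l) q)"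
      using inv[OF sr(2)] by simp
    have args: "q * s / (q / h) = h * s" "q * s / (q * a / b) = b * s / a" "q * s / (q * a / c) = c * s / a"
      "q / (h * l) * s = q * s / (h * l)"
      using q0 by simp_all
    have "residue_term q 4 zeros_in poles_in 2 zeros_out poles_out p k =
      q ^ k * ((\<Prod>i<4. qpoch (q * s / zeros_in i) q k * qpoch_inf (zeros_in i / s) q) *
        (\<Prod>i<4. inverse (qpoch (q * s / poles_in i) q k) *
          inverse (if i = p then qpoch_inf q q else qpoch_inf (poles_in i / s) q))) *
       (\<Prod>i<2. qpoch_inf (zeros_out i * s * q ^ k) q * inverse (qpoch_inf (poles_out i * s * q ^ k) q))"
      unfolding residue_term_def s[symmetric] prod.distrib ..
    also have "\<dots> = ?C * (qpochs [s / l, b * s / a, c * s / a, s] q k * inverse (qpochs [q, q * s / o1, q * s / o2, q * s / o3] q k) * q ^ k)"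
      unfolding others prod_lessThan_4[of "\<lambda>i. qpoch (q * s / zeros_in i) q k * qpoch_inf (zeros_in i / s) q"] prod_lessThan_2
        family_values args i1 i2 t1 t2
        qpochs_Cons[of "s / l"] qpochs_Cons[of "b * s / a"] qpochs_Cons[of "c * s / a"] qpochs_Cons[of s] qpochs_Nil
        inverse_mult_distrib[of "qpoch_inf s q"] mult_1_right
      by (simp only: mult_ac)
    finally show ?thesis unfolding divide_inverse[of "qpochs [s / l, b * s / a, c * s / a, s] q k"] .
  qed
  have sm: "summable (\<lambda>k. qpochs [s / l, b * s / a, c * s / a, s] q k / qpochs [q, q * s / o1, q * s / o2, q * s / o3] q k * q ^ k)"
    using qhyp_summable[OF q1 den q1] .
  show ?thesis
    unfolding eq qhyp_def by (rule suminf_mult[OF sm])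
qed

text \<open>The finite factors with \<open>h\<close> again complete the tails, which yields
  \<open>theta h q * theta (h * l) q\<close> at every pole of both lattices. What remains of each
  term is the weight and value of the integrand at w = q ^ k or w = q ^ k / l.\<close>

lemma outer_residue_series:
  "(\<Sum>k. residue_term q 2 zeros_out poles_out 4 zeros_in poles_in 0 k) +
   (\<Sum>k. residue_term q 2 zeros_out poles_out 4 zeros_in poles_in 1 k) =
   - (l * theta h q * theta (h * l) q / (qpoch_inf q q * qpoch_inf q q * qpoch_inf l q * qpoch_inf (q / l) q)) *
   jackson q l bailey_integrand"
proof -
  note regd = reg[unfolded regular_def]
  define T where "T = theta h q * theta (h * l) q"
  have split: "qpoch x q k * qpoch_inf (x * q ^ k) q = qpoch_inf x q" for x k
    using qpoch_inf_split[OF q1, of x k] by simp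
  have inv: "inverse (qpoch x q k) = qpoch_inf (x * q ^ k) q * inverse (qpoch_inf x q)" if "qpoch_inf x q \<noteq> 0" for x k
    using qpoch_inf_split[OF q1, of x k] that by (auto simp: field_simps)
  have th: "theta h q = qpoch_inf h q * qpoch_inf (q / h) q" "theta (h * l) q = qpoch_inf (h * l) q * qpoch_inf (q / (h * l)) q"
    by (simp_all add: theta_def)
  have lq: "qpoch_inf (q * l) q \<noteq> 0" using qpoch_inf_shift_nz(2)[OF q0 q1 ll(1), of 1] by simp
  \<comment> \<open>Reflecting 1 / l to q / l brings the constants of the two lattices to the same
    form. The sign appearing here turns the sum of the residues into the difference that defines the
    Jackson integral.\<close>
  have one_l: "qpoch_inf (1 / l) q * qpoch_inf (q * l) q = - (qpoch_inf l q * qpoch_inf (q / l) q / l)"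
  proof -
    have A: "qpoch_inf (1 / l) q = - ((1 - l) / l) * qpoch_inf (q / l) q"
      using qpoch_inf_step[OF q0 q1, of "1 / l"] l_nz by (simp add: field_simps)
    have B: "qpoch_inf l q = (1 - l) * qpoch_inf (q * l) q" by (rule qpoch_inf_step[OF q0 q1])
    show ?thesis unfolding A B by (simp add: mult_ac)
  qed
  have if_eqs: "(if (0::nat) = 0 then A else B) = A" "(if (1::nat) = 0 then A else B) = B"
    "(if (0::nat) = 1 then A else B) = B" "(if (1::nat) = 1 then A else B) = A" for A B :: complex by simp_all
  have e0: "residue_term q 2 zeros_out poles_out 4 zeros_in poles_in 0 k =
    T * inverse (qpoch_inf q q * qpoch_inf q q * (qpoch_inf (1 / l) q * qpoch_inf (q * l) q)) * (q ^ k * 1 * bailey_integrand (q ^ k * 1))" for k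
  proof -
    have args: "q * 1 / h = q / h" "q * 1 / (q / (h * l)) = h * l" "q * 1 / 1 = q" "q * 1 / (1 / l) = q * l" "h / 1 = h"
      "q / (h * l) / 1 = q / (h * l)" "1 / l / 1 = 1 / l" "\<And>x. x * 1 * q ^ k = x * q ^ k" "q ^ k * 1 = q ^ k"
      using q0 by simp_all
    have "residue_term q 2 zeros_out poles_out 4 zeros_in poles_in 0 k =
      q ^ k * (qpoch (q / h) q k * qpoch_inf h q * (inverse (qpoch q q k) * inverse (qpoch_inf q q)) *
         (qpoch (h * l) q k * qpoch_inf (q / (h * l)) q * (inverse (qpoch (q * l) q k) * inverse (qpoch_inf (1 / l) q)))) *
       (qpoch_inf (q / h * q ^ k) q * inverse (qpoch_inf (d * q ^ k) q) *
        (qpoch_inf (h * l * q ^ k) q * inverse (qpoch_inf (e * q ^ k) q)) *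
        (qpoch_inf (q * a / b * q ^ k) q * inverse (qpoch_inf (f * q ^ k) q)) *
        (qpoch_inf (q * a / c * q ^ k) q * inverse (qpoch_inf (g * q ^ k) q)))"
      unfolding residue_term_def prod_lessThan_4 prod_lessThan_2 family_values args if_eqs ..
    also have "\<dots> = T * inverse (qpoch_inf q q * qpoch_inf q q * (qpoch_inf (1 / l) q * qpoch_inf (q * l) q)) * (q ^ k * 1 * bailey_integrand (q ^ k * 1))"
      unfolding T_def th split[of "q / h" k, symmetric] split[of "h * l" k, symmetric] args bailey_integrand_def
        inv[OF qpoch_q_nz(1)[OF q1]] inv[OF lq] inverse_mult_distrib
      by (simp only: mult_ac)
    finally show ?thesis .
  qed
  have e1: "residue_term q 2 zeros_out poles_out 4 zeros_in poles_in 1 k =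
    T * l * inverse (qpoch_inf q q * qpoch_inf q q * (qpoch_inf l q * qpoch_inf (q / l) q)) * (q ^ k * (1 / l) * bailey_integrand (q ^ k * (1 / l)))" for k
  proof -
    have args: "q * (1 / l) / h = q / (h * l)" "q * (1 / l) / (q / (h * l)) = h" "q * (1 / l) / 1 = q / l" "q * (1 / l) / (1 / l) = q"
      "h / (1 / l) = h * l" "q / (h * l) / (1 / l) = q / h" "1 / (1 / l) = l"
      "\<And>x. x * (1 / l) * q ^ k = x * (q ^ k * (1 / l))" "q / h * (q ^ k * (1 / l)) = q / (h * l) * q ^ k" "h * l * (q ^ k * (1 / l)) = h * q ^ k"
      using q0 l_nz h by simp_all
    have il: "T * l * X * (q ^ k * (1 / l) * Y) = T * X * (q ^ k * Y)" for X Y using l_nz by simp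
    have b: "q * (q ^ k * (1 / l)) = q / l * q ^ k" "q * l * (q ^ k * (1 / l)) = q * q ^ k" using l_nz by simp_all
    have "residue_term q 2 zeros_out poles_out 4 zeros_in poles_in 1 k =
      q ^ k * (qpoch (q / (h * l)) q k * qpoch_inf (h * l) q * (inverse (qpoch (q / l) q k) * inverse (qpoch_inf l q)) *
         (qpoch h q k * qpoch_inf (q / h) q * (inverse (qpoch q q k) * inverse (qpoch_inf q q)))) *
       (qpoch_inf (q / (h * l) * q ^ k) q * inverse (qpoch_inf (d * (q ^ k * (1 / l))) q) *
        (qpoch_inf (h * q ^ k) q * inverse (qpoch_inf (e * (q ^ k * (1 / l))) q)) *
        (qpoch_inf (q * a / b * (q ^ k * (1 / l))) q * inverse (qpoch_inf (f * (q ^ k * (1 / l))) q)) *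
        (qpoch_inf (q * a / c * (q ^ k * (1 / l))) q * inverse (qpoch_inf (g * (q ^ k * (1 / l))) q)))"
      unfolding residue_term_def prod_lessThan_4 prod_lessThan_2 family_values args if_eqs ..
    also have "\<dots> = T * inverse (qpoch_inf q q * qpoch_inf q q * (qpoch_inf l q * qpoch_inf (q / l) q)) * (q ^ k * bailey_integrand (q ^ k * (1 / l)))"
      unfolding T_def th split[of "q / (h * l)" k, symmetric] split[of h k, symmetric] bailey_integrand_def b
        inv[OF qpoch_q_nz(1)[OF q1]] inv[OF ll(2)] inverse_mult_distrib
      by (simp only: mult_ac)
    finally show ?thesis unfolding il .
  qed
  have sm: "summable (\<lambda>k. q ^ k * x * bailey_integrand (q ^ k * x))"
    if "qpoch_inf (d * x) q \<noteq> 0" "qpoch_inf (e * x) q \<noteq> 0" "qpoch_inf (f * x) q \<noteq> 0" "qpoch_inf (g * x) q \<noteq> 0" for x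
  proof -
    have *: "(\<lambda>k. qpoch_inf (t * (q ^ k * x)) q) \<longlonglongrightarrow> 1" for t
      using qpoch_inf_power_tendsto[OF q0 q1, of t x] by (simp add: mult.assoc)
    have "(\<lambda>k. bailey_integrand (q ^ k * x)) \<longlonglongrightarrow> 1 * 1 * (1 * 1) * inverse (1 * 1 * 1 * 1)"
      unfolding bailey_integrand_def by (intro tendsto_mult tendsto_inverse *) simp
    then show ?thesis by (rule summable_power_mult_tendsto[OF q0 q1])
  qed
  have s0: "(\<Sum>k. residue_term q 2 zeros_out poles_out 4 zeros_in poles_in 0 k) =
    T * inverse (qpoch_inf q q * qpoch_inf q q * (qpoch_inf (1 / l) q * qpoch_inf (q * l) q)) * jackson_half q 1 bailey_integrand"
    unfolding e0 jackson_half_def by (rule suminf_mult[OF sm]) (use regd in simp_all)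
  have s1: "(\<Sum>k. residue_term q 2 zeros_out poles_out 4 zeros_in poles_in 1 k) =
    T * l * inverse (qpoch_inf q q * qpoch_inf q q * (qpoch_inf l q * qpoch_inf (q / l) q)) * jackson_half q (1 / l) bailey_integrand"
    unfolding e1 jackson_half_def by (rule suminf_mult[OF sm]) (use regd in simp_all)
  have "inverse (Q * Q * (- (L / l))) = - (l * inverse (Q * Q * L))" for Q L
    using l_nz by (simp add: inverse_mult_distrib divide_inverse)
  then have s0': "(\<Sum>k. residue_term q 2 zeros_out poles_out 4 zeros_in poles_in 0 k) =
    - (T * l * inverse (qpoch_inf q q * qpoch_inf q q * (qpoch_inf l q * qpoch_inf (q / l) q))) * jackson_half q 1 bailey_integrand"
    unfolding s0 one_l by simp
  show ?thesis
    unfolding s0' s1 jackson_def T_def[symmetric] mult.assoc[of l]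
    by (simp add: right_diff_distrib divide_inverse mult_ac T_def)
qed

text \<open>The inner residue sum equals the outer one, whose Jackson integral contains the
  very-well-poised series; the equation is solved for that series. The hypothesis
  \<open>dist\<close> keeps the four families of inner poles apart.\<close>

lemma combined_formula:
  assumes dist: "qpochs_inf [d / g, e / g, f / g] q \<noteq> 0" "qpochs_inf [g / f, d / f, e / f] q \<noteq> 0"
      "qpochs_inf [g / d, e / d, f / d] q \<noteq> 0" "qpochs_inf [g / e, d / e, f / e] q \<noteq> 0"
    and th: "theta h q \<noteq> 0" "theta (h * l) q \<noteq> 0"
  shows "(\<Sum>j. vwp_term q a [b, c, d, e, f] (g / l) j) = qpoch_inf (q * a) q /
     (theta h q * theta (h * l) q * qpochs_inf [q * a / b, q * a / c, q * a / d, q * a / e, q * a / f] q) *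
     (theta (h * g) q * theta (h * l / g) q *
        qpochs_inf [f / l, e / l, d / l, q * a / b / g, q * a / c / g, d, e, f] q /
        qpochs_inf [g / l, d / g, e / g, f / g] q *
        qhyp [g / l, b * g / a, c * g / a, g] [q * g / d, q * g / e, q * g / f] q q +
      theta (h * f) q * theta (h * l / f) q *
        qpochs_inf [g, q * a / b / f, q * a / c / f, e / l, d / l, d, e] q / qpochs_inf [g / f, d / f, e / f] q *
        qhyp [f / l, b * f / a, c * f / a, f] [q * f / g, q * f / d, q * f / e] q q +
      theta (h * d) q * theta (h * l / d) q *
        qpochs_inf [g, q * a / b / d, q * a / c / d, f / l, e / l, e, f] q / qpochs_inf [g / d, e / d, f / d] q *
        qhyp [d / l, b * d / a, c * d / a, d] [q * d / g, q * d / e, q * d / f] q q +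
      theta (h * e) q * theta (h * l / e) q *
        qpochs_inf [g, q * a / b / e, q * a / c / e, f / l, d / l, d, f] q / qpochs_inf [g / e, d / e, f / e] q *
        qhyp [e / l, b * e / a, c * e / a, e] [q * e / g, q * e / d, q * e / f] q q)"
proof -
  note regd = reg[unfolded regular_def]
  define W where "W = (\<Sum>j. vwp_term q a [b, c, d, e, f] (g / l) j)"
  define R where "R p = (\<Sum>k. residue_term q 4 zeros_in poles_in 2 zeros_out poles_out p k)" for p
  have sh: "qpoch_inf (q * x / y) q \<noteq> 0" "qpoch_inf (x * q / y) q \<noteq> 0" if "qpoch_inf (x / y) q \<noteq> 0" for x y
    using qpoch_inf_shift_nz[OF q0 q1 that, of 1] by simp_all
  have dist': "qpoch_inf (d / g) q \<noteq> 0" "qpoch_inf (e / g) q \<noteq> 0" "qpoch_inf (f / g) q \<noteq> 0"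
    "qpoch_inf (g / f) q \<noteq> 0" "qpoch_inf (d / f) q \<noteq> 0" "qpoch_inf (e / f) q \<noteq> 0"
    "qpoch_inf (g / d) q \<noteq> 0" "qpoch_inf (e / d) q \<noteq> 0" "qpoch_inf (f / d) q \<noteq> 0"
    "qpoch_inf (g / e) q \<noteq> 0" "qpoch_inf (d / e) q \<noteq> 0" "qpoch_inf (f / e) q \<noteq> 0"
    using dist by auto
  have if_eqs: "(if (0::nat) = 0 then A else B) = A" "(if (1::nat) = 0 then A else B) = B" "(if (2::nat) = 0 then A else B) = B" "(if (3::nat) = 0 then A else B) = B"
    "(if (0::nat) = 1 then A else B) = B" "(if (1::nat) = 1 then A else B) = A" "(if (2::nat) = 1 then A else B) = B" "(if (3::nat) = 1 then A else B) = B"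
    "(if (0::nat) = 2 then A else B) = B" "(if (1::nat) = 2 then A else B) = B" "(if (2::nat) = 2 then A else B) = A" "(if (3::nat) = 2 then A else B) = B"
    "(if (0::nat) = 3 then A else B) = B" "(if (1::nat) = 3 then A else B) = B" "(if (2::nat) = 3 then A else B) = B" "(if (3::nat) = 3 then A else B) = A" for A B :: complex by simp_all
  have self: "q * d / d = q" "q * e / e = q" "q * f / f = q" "q * g / g = q" using nz g_nz by simp_all
  note unroll = prod_lessThan_4 family_values if_eqs self qpochs_Cons qpochs_Nil qpochs_inf_Cons qpochs_inf_Nil
    inverse_mult_distrib mult_1_right inverse_1 mult_ac
  define C where "C s = theta (h * s) q * theta (h * l / s) q * qpoch_inf (q * a / b / s) q * qpoch_inf (q * a / c / s) q *
      inverse (qpoch_inf s q * qpoch_inf (s / l) q)" for s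
  have R3: "R 3 = C g * inverse (qpochs_inf [q, d / g, e / g, f / g] q) *
      qhyp [g / l, b * g / a, c * g / a, g] [q * g / d, q * g / e, q * g / f] q q"
    unfolding R_def C_def
    by (rule inner_residue_series) (simp_all only: unroll, use dist' sh g_nz nz in simp_all)
  have R2: "R 2 = C f * inverse (qpochs_inf [q, g / f, d / f, e / f] q) *
      qhyp [f / l, b * f / a, c * f / a, f] [q * f / g, q * f / d, q * f / e] q q"
    unfolding R_def C_def
    by (rule inner_residue_series) (simp_all only: unroll, use dist' sh g_nz nz in simp_all)
  have R0: "R 0 = C d * inverse (qpochs_inf [q, g / d, e / d, f / d] q) *
      qhyp [d / l, b * d / a, c * d / a, d] [q * d / g, q * d / e, q * d / f] q q"
    unfolding R_def C_def
    by (rule inner_residue_series) (simp_all only: unroll, use dist' sh g_nz nz in simp_all)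
  have R1: "R 1 = C e * inverse (qpochs_inf [q, g / e, d / e, f / e] q) *
      qhyp [e / l, b * e / a, c * e / a, e] [q * e / g, q * e / d, q * e / f] q q"
    unfolding R_def C_def
    by (rule inner_residue_series) (simp_all only: unroll, use dist' sh g_nz nz in simp_all)
  have "(\<Sum>p<4. \<Sum>k. residue_term q 4 zeros_in poles_in 2 zeros_out poles_out p k) =
    (\<Sum>p<2. \<Sum>k. residue_term q 2 zeros_out poles_out 4 zeros_in poles_in p k)"
  proof (rule sum_residue_series[OF q0 q1])
    show "zeros_in i \<noteq> 0 \<and> poles_in i \<noteq> 0" if "i < 4" for i
      using less_4_cases[OF that] nz g_nz q0 h l_nz by (auto simp: family_values simp del: One_nat_def)
    show "zeros_out i \<noteq> 0 \<and> poles_out i \<noteq> 0" if "i < 2" for i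
      using less_2_cases'[OF that] q0 h l_nz by (auto simp: family_values simp del: One_nat_def)
    show "prod zeros_in {..<4} = q * prod poles_in {..<4}"
      unfolding prod_lessThan_4 family_values using nz q0 h by (simp add: l g)
    show "prod zeros_out {..<2} = q * prod poles_out {..<2}"
      unfolding prod_lessThan_2 family_values using h by simp
    show "qpoch_inf (poles_in i / poles_in j) q \<noteq> 0" if "i < 4" "j < 4" "i \<noteq> j" for i j
      using less_4_cases[OF that(1)] less_4_cases[OF that(2)] that(3) dist'
      by (auto simp: family_values simp del: One_nat_def)
    show "qpoch_inf (poles_out i / poles_out j) q \<noteq> 0" if "i < 2" "j < 2" "i \<noteq> j" for i j
    proof -
      have "qpoch_inf (1 / l) q \<noteq> 0"
      proof
        assume "qpoch_inf (1 / l) q = 0"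
        then have "(1 - 1 / l) * qpoch_inf (q / l) q = 0" using qpoch_inf_step[OF q0 q1, of "1 / l"] by simp
        then have "l = 1" using ll(2) l_nz by simp
        then show False using ll(1) qpoch_inf_one[OF q1] by simp
      qed
      then show ?thesis
        using less_2_cases'[OF that(1)] less_2_cases'[OF that(2)] that(3) ll(1)
        by (auto simp: family_values simp del: One_nat_def)
    qed
    show "qpoch_inf (poles_out j * poles_in i) q \<noteq> 0" if "i < 4" "j < 2" for i j
      using less_4_cases[OF that(1)] less_2_cases'[OF that(2)] regd
      by (auto simp: family_values simp del: One_nat_def)
  qed
  moreover have "(\<Sum>p<4. R p) = R 0 + R 1 + R 2 + R 3" for R :: "nat \<Rightarrow> complex"
    by (simp add: eval_nat_numeral)
  moreover have "(\<Sum>p<2. R p) = R 0 + R 1" for R :: "nat \<Rightarrow> complex"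
    by (simp add: eval_nat_numeral)
  ultimately have "R 0 + R 1 + R 2 + R 3 = - (l * theta h q * theta (h * l) q / (qpoch_inf q q * qpoch_inf q q * qpoch_inf l q * qpoch_inf (q / l) q)) *
      (expansion_const * saal_const * W)"
    unfolding outer_residue_series[symmetric] jackson_bailey_integrand[symmetric] W_def R_def
    using outer_residue_series jackson_bailey_integrand by simp
  note total = this
  define D0 where "D0 = qpoch_inf d q * qpoch_inf (d / l) q * (qpoch_inf e q * qpoch_inf (e / l) q) * (qpoch_inf f q * qpoch_inf (f / l) q)"
  \<comment> \<open>Multiplying by \<open>M\<close> clears the denominators of
    \<open>saal_const\<close>, of \<open>expansion_const\<close> up to
    \<open>qpoch_inf (q * a) q\<close>, and of the outer residues. In each inner residue it cancels
    the matching factors and leaves the products displayed in the statement.\<close>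
  define M where "M = qpoch_inf q q * qpoch_inf g q * D0"
  have D0: "D0 \<noteq> 0" using regd by (simp add: D0_def)
  have qa: "qpoch_inf (q * a) q \<noteq> 0" using qpoch_inf_shift_nz(2)[OF q0 q1 a, of 1] by simp
  have qq: "qpoch_inf q q \<noteq> 0" by (rule qpoch_q_nz(1)[OF q1])
  define Q where "Q = qpochs_inf [q * a / b, q * a / c, q * a / d, q * a / e, q * a / f] q"
  have Q: "Q \<noteq> 0" using bcdef by (simp add: Q_def)
  have "M * (R 0 + R 1 + R 2 + R 3) * qpoch_inf (q * a) q = theta h q * theta (h * l) q * Q * W"
  proof -
    have alg: "s * G * D * (- (l * t * t' / (s * s * L * L')) * (B * B' / (A * G) * (- (F * F' * F'' * (s * L' * L / l)) / D) * W)) * A =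
      t * t' * (B * (B' * (F'' * (F' * (F * 1))))) * W"
      if "s \<noteq> 0" "G \<noteq> 0" "D \<noteq> 0" "L \<noteq> 0" "L' \<noteq> 0" "A \<noteq> 0" for s G D t t' L L' B B' A F F' F'' W :: complex
      using that l_nz by simp
    show ?thesis
      unfolding total M_def Q_def expansion_const_def saal_const_def D0_def[symmetric] qpochs_inf_Cons qpochs_inf_Nil
      by (rule alg) (use qq D0 ll qa regd in auto)
  qed
  then have W_eq: "W = qpoch_inf (q * a) q / (theta h q * theta (h * l) q * Q) * (M * R 3 + M * R 2 + M * R 0 + M * R 1)"
    using th Q by (simp add: field_simps)
  have cancel: "s * r * v * (t * inverse r * inverse (s * X) * y) = t * v / X * y"
    if "s \<noteq> 0" "r \<noteq> 0" for s r v t X y :: complex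
    using that by (simp add: divide_inverse) (simp add: field_simps)
  have cancel': "s * r * v * (t * inverse (r * r') * inverse (s * X) * y) = t * v / (r' * X) * y"
    if "s \<noteq> 0" "r \<noteq> 0" for s r r' v t X y :: complex
    using that by (simp add: divide_inverse) (simp add: field_simps)
  have M3: "M * R 3 = theta (h * g) q * theta (h * l / g) q *
        qpochs_inf [f / l, e / l, d / l, q * a / b / g, q * a / c / g, d, e, f] q /
        qpochs_inf [g / l, d / g, e / g, f / g] q *
        qhyp [g / l, b * g / a, c * g / a, g] [q * g / d, q * g / e, q * g / f] q q"
  proof -
    have "qpoch_inf g q \<noteq> 0" using regd by simp
    note c = cancel'[OF qq this]
    show ?thesis
      unfolding R3 C_def M_def qpochs_inf_Cons[of q] c qpochs_inf_Cons[of "g / l"]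
      by (simp add: D0_def mult_ac)
  qed
  have M_case: "M * (C s * inverse (qpochs_inf [q, x1, x2, x3] q) * y) = theta (h * s) q * theta (h * l / s) q *
        qpochs_inf [g, q * a / b / s, q * a / c / s, u1, u2, u3, u4] q / qpochs_inf [x1, x2, x3] q * y"
    if D: "D0 = qpoch_inf s q * qpoch_inf (s / l) q * (qpoch_inf u1 q * (qpoch_inf u2 q * (qpoch_inf u3 q * qpoch_inf u4 q)))"
      and s: "qpoch_inf s q * qpoch_inf (s / l) q \<noteq> 0" for s x1 x2 x3 y u1 u2 u3 u4
  proof -
    note c = cancel[OF qq s]
    have M: "M = qpoch_inf q q * (qpoch_inf s q * qpoch_inf (s / l) q) *
       (qpoch_inf g q * (qpoch_inf u1 q * (qpoch_inf u2 q * (qpoch_inf u3 q * qpoch_inf u4 q))))"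
      unfolding M_def D by (simp only: mult_ac)
    show ?thesis unfolding C_def M qpochs_inf_Cons[of q] c by (simp add: mult_ac)
  qed
  have M2: "M * R 2 = theta (h * f) q * theta (h * l / f) q *
        qpochs_inf [g, q * a / b / f, q * a / c / f, e / l, d / l, d, e] q / qpochs_inf [g / f, d / f, e / f] q *
        qhyp [f / l, b * f / a, c * f / a, f] [q * f / g, q * f / d, q * f / e] q q"
    unfolding R2 by (rule M_case) (use regd in \<open>simp_all add: D0_def mult_ac\<close>)
  have M0: "M * R 0 = theta (h * d) q * theta (h * l / d) q *
        qpochs_inf [g, q * a / b / d, q * a / c / d, f / l, e / l, e, f] q / qpochs_inf [g / d, e / d, f / d] q *
        qhyp [d / l, b * d / a, c * d / a, d] [q * d / g, q * d / e, q * d / f] q q"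
    unfolding R0 by (rule M_case) (use regd in \<open>simp_all add: D0_def mult_ac\<close>)
  have M1: "M * R 1 = theta (h * e) q * theta (h * l / e) q *
        qpochs_inf [g, q * a / b / e, q * a / c / e, f / l, d / l, d, f] q / qpochs_inf [g / e, d / e, f / e] q *
        qhyp [e / l, b * e / a, c * e / a, e] [q * e / g, q * e / d, q * e / f] q q"
    unfolding R1 by (rule M_case) (use regd in \<open>simp_all add: D0_def mult_ac\<close>)
  show ?thesis
    using W_eq unfolding M3 M2 M0 M1 W_def Q_def .
qed

end

end

end

subsection \<open>The four-term relation\<close>

text \<open>The right-hand side of the final identity, as a function whose limit along perturbed
  parameters can be taken.\<close>

definition four_term :: "complex \<Rightarrow> complex \<Rightarrow> complex \<Rightarrow> complex \<Rightarrow> complex \<Rightarrow> complex \<Rightarrow> complex \<Rightarrow> complex \<Rightarrow> complex" where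
  "four_term q a b c d e f h = qpoch_inf (q*a) q /
      (thetas [h, h * (d*e*f / (q*a))] q *
       qpochs_inf [q*a/b, q*a/c, q*a/d, q*a/e, q*a/f] q) *
    ( thetas [h * (q*a/(b*c)), h * (b*c*d*e*f / (q^2*a^2))] q *
        qpochs_inf [q*a/(d*e), q*a/(d*f), q*a/(e*f), b, c, d, e, f] q /
        qpochs_inf [q^2*a^2/(b*c*d*e*f), b*c*d/(q*a), b*c*e/(q*a), b*c*f/(q*a)] q *
        qhyp [q^2*a^2/(b*c*d*e*f), q*a/(b*c), q/b, q/c]
             [q^2*a/(b*c*d), q^2*a/(b*c*e), q^2*a/(b*c*f)] q q
    + thetas [h * f, h * (d*e/(q*a))] q *
        qpochs_inf [q*a/(b*c), q*a/(b*f), q*a/(c*f), q*a/(d*f), q*a/(e*f), d, e] q /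
        qpochs_inf [q*a/(b*c*f), d/f, e/f] q *
        qhyp [q*a/(d*e), b*f/a, c*f/a, f] [b*c*f/a, q*f/d, q*f/e] q q
    + thetas [h * d, h * (e*f/(q*a))] q *
        qpochs_inf [q*a/(b*c), q*a/(b*d), q*a/(c*d), q*a/(d*e), q*a/(d*f), e, f] q /
        qpochs_inf [q*a/(b*c*d), e/d, f/d] q *
        qhyp [q*a/(e*f), b*d/a, c*d/a, d] [b*c*d/a, q*d/e, q*d/f] q q
    + thetas [h * e, h * (d*f/(q*a))] q *
        qpochs_inf [q*a/(b*c), q*a/(b*e), q*a/(c*e), q*a/(d*e), q*a/(e*f), d, f] q /
        qpochs_inf [q*a/(b*c*e), d/e, f/e] q *
        qhyp [q*a/(d*f), b*e/a, c*e/a, e] [b*c*e/a, q*e/d, q*e/f] q q )"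

text \<open>\<open>combined_formula\<close> written in the original parameters. In terms of l and g,
  the genericity condition \<open>gen\<close> concerns a, d, e, f, d / l, e / l, f / l, g, q a / l
  and theta l; the final limit removes it.\<close>

lemma four_term_generic:
  fixes q a b c d e f h :: complex
  assumes nz: "q \<noteq> 0" "a \<noteq> 0" "b \<noteq> 0" "c \<noteq> 0" "d \<noteq> 0" "e \<noteq> 0" "f \<noteq> 0" "h \<noteq> 0"
    and q1: "norm q < 1"
    and conv: "norm (q^2 * a^2) < norm (b * c * d * e * f)"
    and th: "thetas [h, h * (d*e*f / (q*a))] q \<noteq> 0"
    and Q: "qpochs_inf [q*a/b, q*a/c, q*a/d, q*a/e, q*a/f] q \<noteq> 0"
    and D: "qpochs_inf [q^2*a^2/(b*c*d*e*f), b*c*d/(q*a), b*c*e/(q*a), b*c*f/(q*a)] q \<noteq> 0"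
      "qpochs_inf [q*a/(b*c*f), d/f, e/f] q \<noteq> 0"
      "qpochs_inf [q*a/(b*c*d), e/d, f/d] q \<noteq> 0"
      "qpochs_inf [q*a/(b*c*e), d/e, f/e] q \<noteq> 0"
    and gen: "qpochs_inf [a, d, e, f, q*a/(e*f), q*a/(d*f), q*a/(d*e), q*a/(b*c), q^2*a^2/(d*e*f)] q \<noteq> 0"
      "theta (d*e*f/(q*a)) q \<noteq> 0"
  shows "(\<Sum>j. vwp_term q a [b, c, d, e, f] (q^2*a^2/(b*c*d*e*f)) j) = four_term q a b c d e f h"
proof -
  define l where "l = d * e * f / (q * a)"
  define g where "g = q * a / (b * c)"
  have l0: "l \<noteq> 0" using nz by (simp add: l_def)
  have e1: "q^2*a^2/(b*c*d*e*f) = g / l" "q^2*a^2/(d*e*f) = q * a / l" "d*e*f/(q*a) = l" "q*a/(b*c) = g"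
    "q*a/(d*e) = f / l" "q*a/(d*f) = e / l" "q*a/(e*f) = d / l"
    using nz by (simp_all add: l_def g_def power2_eq_square mult_ac)
  have e2: "b*c*d/(q*a) = d / g" "b*c*e/(q*a) = e / g" "b*c*f/(q*a) = f / g"
    "q*a/(b*c*d) = g / d" "q*a/(b*c*e) = g / e" "q*a/(b*c*f) = g / f"
    "b*c*d/a = q * d / g" "b*c*e/a = q * e / g" "b*c*f/a = q * f / g"
    "q^2*a/(b*c*d) = q * g / d" "q^2*a/(b*c*e) = q * g / e" "q^2*a/(b*c*f) = q * g / f"
    using nz by (simp_all add: g_def power2_eq_square mult_ac)
  have e3: "h * (b*c*d*e*f / (q^2*a^2)) = h * l / g" "h * (d*e/(q*a)) = h * l / f" "h * (e*f/(q*a)) = h * l / d"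
    "h * (d*f/(q*a)) = h * l / e"
    using nz by (simp_all add: l_def g_def power2_eq_square mult_ac)
  have e4: "q*a/(b*d) = q * a / b / d" "q*a/(b*e) = q * a / b / e" "q*a/(b*f) = q * a / b / f"
    "q*a/(c*d) = q * a / c / d" "q*a/(c*e) = q * a / c / e" "q*a/(c*f) = q * a / c / f"
    by simp_all
  have bg: "q * a / c / g = b" "q * a / b / g = c" "b * g / a = q / c" "c * g / a = q / b"
    using nz by (simp_all add: g_def)
  have perm: "qhyp [g / l, q / c, q / b, g] ys q q = qhyp [g / l, g, q / b, q / c] ys q q" for ys
    unfolding qhyp_def by (simp add: mult_ac)
  have reg: "regular q l d" "regular q l e" "regular q l f" "regular q l g"
    using gen(1) D(1) unfolding regular_def e1 by simp_all
  have ll: "qpoch_inf l q \<noteq> 0" "qpoch_inf (q / l) q \<noteq> 0"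
    using gen(2) unfolding e1 by (simp_all add: theta_def)
  have gl: "norm (g / l) < 1"
    unfolding e1(1)[symmetric] norm_divide using conv nz by (subst divide_less_eq_1_pos) auto
  have Q': "qpoch_inf (q*a/b) q \<noteq> 0" "qpoch_inf (q*a/c) q \<noteq> 0" "qpoch_inf (q*a/d) q \<noteq> 0"
    "qpoch_inf (q*a/e) q \<noteq> 0" "qpoch_inf (q*a/f) q \<noteq> 0" using Q by simp_all
  have al: "qpoch_inf a q \<noteq> 0" "qpoch_inf (q * a / l) q \<noteq> 0" using gen(1) unfolding e1 by simp_all
  have dist: "qpochs_inf [d / g, e / g, f / g] q \<noteq> 0" "qpochs_inf [g / f, d / f, e / f] q \<noteq> 0"
      "qpochs_inf [g / d, e / d, f / d] q \<noteq> 0" "qpochs_inf [g / e, d / e, f / e] q \<noteq> 0"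
    using D unfolding e1 e2 by simp_all
  have th': "theta h q \<noteq> 0" "theta (h * l) q \<noteq> 0" using th unfolding e1 by (simp_all add: thetas_def)
  note C = combined_formula[OF nz(1) q1 nz(2-7) l_def g_def al(1) Q' reg al(2) ll gl nz(8) dist th']
  have thp: "thetas [x, y] q = theta x q * theta y q" for x y by (simp add: thetas_def)
  show ?thesis
    unfolding four_term_def e3 e1 e2 e4 C thp perm bg
    by (simp only: qpochs_inf_Cons qpochs_inf_Nil mult_ac)
qed

section \<open>Passage from generic to arbitrary parameters\<close>

lemma qpoch_sqrt:
  assumes "s^2 = a"
  shows "(1 - a) * (qpoch (q * s) q k * qpoch (- (q * s)) q k) = (1 - a * q ^ (2 * k)) * (qpoch s q k * qpoch (- s) q k)"
proof -
  have *: "(1 - u) * qpoch (q * u) q k = (1 - u * q ^ k) * qpoch u q k" for u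
    using qpoch_add[of u q 1 k] qpoch_Suc[of u q k] by (simp add: qpoch_Suc mult_ac)
  have "(1 - a) * (qpoch (q * s) q k * qpoch (- (q * s)) q k) =
    ((1 - s) * qpoch (q * s) q k) * ((1 - (- s)) * qpoch (q * (- s)) q k)"
    unfolding assms[symmetric] by (simp add: power2_eq_square algebra_simps)
  also have "\<dots> = (1 - s * q ^ k) * (1 - (- s) * q ^ k) * (qpoch s q k * qpoch (- s) q k)"
    unfolding * by (simp only: mult_ac)
  also have "(1 - s * q ^ k) * (1 - (- s) * q ^ k) = 1 - a * q ^ (2 * k)"
    unfolding assms[symmetric] power_mult power2_eq_square mult.commute[of 2] by (simp add: algebra_simps)
  finally show ?thesis .
qed

text \<open>The four parameters with square roots combine to the very-well-poised factor. A zero of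
  (s; q) or (- s; q) at step j would give a q ^ (2 j) = 1, so the condition on \<open>a\<close>
  excludes both.\<close>

lemma vwp_sum_eq_qhyp:
  assumes q: "q \<noteq> 0" "norm q < 1" and s: "s^2 = a" and a: "qpoch_inf a q \<noteq> 0"
  shows "(\<Sum>j. vwp_term q a bs z j) =
    qhyp (a # q * s # - (q * s) # bs) (s # - s # map (\<lambda>b. q * a / b) bs) q z"
proof -
  have nzk: "1 - a * q ^ k \<noteq> 0" for k using a qpoch_inf_eq_0_iff[OF q(2), of a] by auto
  have s0: "qpoch s q k * qpoch (- s) q k \<noteq> 0" for k
  proof -
    have "u * q ^ j \<noteq> 1" if "u^2 = a" for u j
    proof
      assume "u * q ^ j = 1"
      then have "(u * q ^ j)^2 = 1" by simp
      then have "a * q ^ (2 * j) = 1" unfolding power_mult_distrib that by (simp add: power_mult[symmetric] mult.commute)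
      then show False using nzk[of "2 * j"] by simp
    qed
    from this[of s] this[of "- s"] s show ?thesis by (auto simp: qpoch_eq_0_iff)
  qed
  have a1: "1 - a \<noteq> 0" using nzk[of 0] by simp
  have quot: "(qpoch (q * s) q k * qpoch (- (q * s)) q k) / (qpoch s q k * qpoch (- s) q k) = (1 - a * q ^ (2 * k)) / (1 - a)" for k
    using qpoch_sqrt[OF s, of q k] s0[of k] a1 by (simp add: field_simps)
  show ?thesis
    unfolding qhyp_def
  proof (rule suminf_cong)
    fix k
    show "vwp_term q a bs z k = qpochs (a # q * s # - (q * s) # bs) q k / qpochs (q # s # - s # map (\<lambda>b. q * a / b) bs) q k * z ^ k"
      unfolding vwp_term_def quot[symmetric] qpochs_Cons by (simp add: mult_ac)
  qed
qed

text \<open>Taking norms in a forbidden equation leaves at most one admissible value of the real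
  number t > 1. So countably many values are excluded from an uncountable interval. The four forms
  occur because the parameters below scale with t, 1 / t, t^2 or 1 / t^2.\<close>

lemma perturbation_exists:
  fixes X :: "complex set" and q :: complex
  assumes "finite X" "\<epsilon> > (0::real)"
  shows "\<exists>t. 1 < t \<and> t < 1 + \<epsilon> \<and> (\<forall>x\<in>X. \<forall>k. x * of_real t * q ^ k \<noteq> 1 \<and> x / of_real t * q ^ k \<noteq> 1 \<and>
     x * of_real t ^ 2 * q ^ k \<noteq> 1 \<and> x / of_real t ^ 2 * q ^ k \<noteq> 1)"
proof -
  define B where "B = (\<Union>x\<in>X. \<Union>k::nat. {1 / (norm x * norm q ^ k), norm x * norm q ^ k,
      sqrt (1 / (norm x * norm q ^ k)), sqrt (norm x * norm q ^ k)})"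
  have "countable B" unfolding B_def by (intro countable_UN countable_finite[OF assms(1)] countableI_type) auto
  moreover have "uncountable {1<..<1 + \<epsilon>}" using assms(2) by (simp add: uncountable_open_interval)
  ultimately have "{1<..<1 + \<epsilon>} - B \<noteq> {}"
    using uncountable_minus_countable[of "{1<..<1 + \<epsilon>}" B] by (metis countable_empty)
  then obtain t where "t \<in> {1<..<1 + \<epsilon>} - B" by blast
  then have t: "1 < t" "t < 1 + \<epsilon>" "t \<notin> B" by simp_all
  have "x * of_real t * q ^ k \<noteq> 1 \<and> x / of_real t * q ^ k \<noteq> 1 \<and>
     x * of_real t ^ 2 * q ^ k \<noteq> 1 \<and> x / of_real t ^ 2 * q ^ k \<noteq> 1" if "x \<in> X" for x k
  proof -
    define n where "n = norm x * norm q ^ k"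
    have tB: "t \<noteq> 1 / n" "t \<noteq> n" "t \<noteq> sqrt (1 / n)" "t \<noteq> sqrt n"
      using t(3) that by (auto simp: B_def n_def)
    have norms: "norm (x * of_real t * q ^ k) = n * t" "norm (x / of_real t * q ^ k) = n / t"
      "norm (x * of_real t ^ 2 * q ^ k) = n * t ^ 2" "norm (x / of_real t ^ 2 * q ^ k) = n / t ^ 2"
      using t(1) by (simp_all add: norm_mult norm_power norm_divide n_def)
    have "n * t \<noteq> 1"
    proof
      assume "n * t = 1"
      then have "t = 1 / n" by (cases "n = 0") (simp_all add: field_simps)
      then show False using tB by simp
    qed
    moreover have "n / t \<noteq> 1" using tB(2) t(1) by (auto simp: field_simps)
    moreover have "n * t ^ 2 \<noteq> 1"
    proof
      assume "n * t ^ 2 = 1"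
      then have "t ^ 2 = 1 / n" by (cases "n = 0") (simp_all add: field_simps)
      then have "t = sqrt (1 / n)" using t(1) by (metis real_sqrt_unique less_eq_real_def less_trans zero_less_one)
      then show False using tB by simp
    qed
    moreover have "n / t ^ 2 \<noteq> 1"
    proof
      assume "n / t ^ 2 = 1"
      then have "t ^ 2 = n" using t(1) by (auto simp: field_simps)
      then have "t = sqrt n" using t(1) by (metis real_sqrt_unique less_eq_real_def less_trans zero_less_one)
      then show False using tB by simp
    qed
    ultimately show ?thesis using norms by (metis norm_one)
  qed
  then show ?thesis using t by blast
qed

lemma tendsto_theta:
  assumes "norm q < 1" "X \<longlonglongrightarrow> x" "x \<noteq> 0"
  shows "(\<lambda>n. theta (X n) q) \<longlonglongrightarrow> theta x q"
  unfolding theta_def qpochs_inf_Cons qpochs_inf_Nil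
  by (intro tendsto_intros assms)

lemma tendsto_thetas_pair:
  assumes "norm q < 1" "X \<longlonglongrightarrow> x" "x \<noteq> 0" "Y \<longlonglongrightarrow> y" "y \<noteq> 0"
  shows "(\<lambda>n. thetas [X n, Y n] q) \<longlonglongrightarrow> thetas [x, y] q"
  unfolding thetas_def list.map prod_list.Cons prod_list.Nil
  by (intro tendsto_mult tendsto_const tendsto_theta assms)

lemma admissible_den_iff:
  assumes "norm q < 1" "q \<noteq> 0"
  shows "admissible_den bs q \<longleftrightarrow> qpochs_inf bs q \<noteq> 0"
  using assms(2) by (induction bs) (auto simp: admissible_den_def qpoch_inf_eq_0_iff[OF assms(1)] field_simps)

theorem theorem6p3:
  fixes q a b c d e f h :: complex
  assumes "q \<noteq> 0" "a \<noteq> 0" "b \<noteq> 0" "c \<noteq> 0" "d \<noteq> 0" "e \<noteq> 0" "f \<noteq> 0" "h \<noteq> 0"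
    and "norm q < 1"
    and "norm (q^2 * a^2) < norm (b * c * d * e * f)"
    \<comment> \<open>no vanishing infinite products in denominators\<close>
    and "thetas [h, h * (d*e*f / (q*a))] q \<noteq> 0"
    and "qpochs_inf [q*a/b, q*a/c, q*a/d, q*a/e, q*a/f] q \<noteq> 0"
    and "qpochs_inf [q^2*a^2/(b*c*d*e*f), b*c*d/(q*a), b*c*e/(q*a), b*c*f/(q*a)] q \<noteq> 0"
    and "qpochs_inf [q*a/(b*c*f), d/f, e/f] q \<noteq> 0"
    and "qpochs_inf [q*a/(b*c*d), e/d, f/d] q \<noteq> 0"
    and "qpochs_inf [q*a/(b*c*e), d/e, f/e] q \<noteq> 0"
    \<comment> \<open>no vanishing denominator factors in the series\<close>
    and "admissible_den (W87_den a b c d e f q) q"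
    and "admissible_den [q^2*a/(b*c*d), q^2*a/(b*c*e), q^2*a/(b*c*f)] q"
    and "admissible_den [b*c*f/a, q*f/d, q*f/e] q"
    and "admissible_den [b*c*d/a, q*d/e, q*d/f] q"
    and "admissible_den [b*c*e/a, q*e/d, q*e/f] q"
  shows "W87 a b c d e f q (q^2*a^2 / (b*c*d*e*f)) =
    qpoch_inf (q*a) q /
      (thetas [h, h * (d*e*f / (q*a))] q *
       qpochs_inf [q*a/b, q*a/c, q*a/d, q*a/e, q*a/f] q) *
    ( thetas [h * (q*a/(b*c)), h * (b*c*d*e*f / (q^2*a^2))] q *
        qpochs_inf [q*a/(d*e), q*a/(d*f), q*a/(e*f), b, c, d, e, f] q /
        qpochs_inf [q^2*a^2/(b*c*d*e*f), b*c*d/(q*a), b*c*e/(q*a), b*c*f/(q*a)] q *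
        qhyp [q^2*a^2/(b*c*d*e*f), q*a/(b*c), q/b, q/c]
             [q^2*a/(b*c*d), q^2*a/(b*c*e), q^2*a/(b*c*f)] q q
    + thetas [h * f, h * (d*e/(q*a))] q *
        qpochs_inf [q*a/(b*c), q*a/(b*f), q*a/(c*f), q*a/(d*f), q*a/(e*f), d, e] q /
        qpochs_inf [q*a/(b*c*f), d/f, e/f] q *
        qhyp [q*a/(d*e), b*f/a, c*f/a, f] [b*c*f/a, q*f/d, q*f/e] q q
    + thetas [h * d, h * (e*f/(q*a))] q *
        qpochs_inf [q*a/(b*c), q*a/(b*d), q*a/(c*d), q*a/(d*e), q*a/(d*f), e, f] q /
        qpochs_inf [q*a/(b*c*d), e/d, f/d] q *
        qhyp [q*a/(e*f), b*d/a, c*d/a, d] [b*c*d/a, q*d/e, q*d/f] q q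
    + thetas [h * e, h * (d*f/(q*a))] q *
        qpochs_inf [q*a/(b*c), q*a/(b*e), q*a/(c*e), q*a/(d*e), q*a/(e*f), d, f] q /
        qpochs_inf [q*a/(b*c*e), d/e, f/e] q *
        qhyp [q*a/(d*f), b*e/a, c*e/a, e] [b*c*e/a, q*e/d, q*e/f] q q )"
proof -
  note nz = assms(1-8)
  note q1 = \<open>norm q < 1\<close>
  note adm = assms(17-21)[unfolded admissible_den_iff[OF q1 nz(1)]]
  \<comment> \<open>These are the parameters of the infinite products in the genericity conditions
    of \<open>four_term_generic\<close>, including both factors of the theta function.\<close>
  define X where "X = {a, d, e, f, q*a/(e*f), q*a/(d*f), q*a/(d*e), q*a/(b*c), q^2*a^2/(d*e*f), d*e*f/(q*a), q/(d*e*f/(q*a))}"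
  have "\<exists>t. 1 < t \<and> t < 1 + inverse (real (Suc n)) \<and> (\<forall>x\<in>X. \<forall>k. x * of_real t * q ^ k \<noteq> 1 \<and> x / of_real t * q ^ k \<noteq> 1 \<and>
     x * of_real t ^ 2 * q ^ k \<noteq> 1 \<and> x / of_real t ^ 2 * q ^ k \<noteq> 1)" for n
    by (rule perturbation_exists) (auto simp: X_def)
  then obtain T where T: "\<And>n. 1 < T n" "\<And>n. T n < 1 + inverse (real (Suc n))"
    "\<And>n x k. x \<in> X \<Longrightarrow> x * of_real (T n) * q ^ k \<noteq> 1 \<and> x / of_real (T n) * q ^ k \<noteq> 1 \<and>
     x * of_real (T n) ^ 2 * q ^ k \<noteq> 1 \<and> x / of_real (T n) ^ 2 * q ^ k \<noteq> 1"
    by metis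
  have T1: "T \<longlonglongrightarrow> 1"
  proof (rule tendsto_sandwich[of "\<lambda>_. 1" T sequentially "\<lambda>n. 1 + inverse (real (Suc n))"])
    have "(\<lambda>n. 1 + inverse (real (Suc n))) \<longlonglongrightarrow> 1 + 0" by (intro tendsto_intros LIMSEQ_inverse_real_of_nat)
    then show "(\<lambda>n. 1 + inverse (real (Suc n))) \<longlonglongrightarrow> 1" by simp
  qed (use T(1,2) in \<open>auto intro!: always_eventually less_imp_le\<close>)
  define t where "t n = complex_of_real (T n)" for n
  have t1: "t \<longlonglongrightarrow> 1" unfolding t_def using tendsto_of_real[OF T1] by simp
  have t0: "t n \<noteq> 0" for n using T(1)[of n] by (simp add: t_def)
  have X_nz: "qpoch_inf (x * t n) q \<noteq> 0" "qpoch_inf (x / t n) q \<noteq> 0" "qpoch_inf (x * t n ^ 2) q \<noteq> 0"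
    "qpoch_inf (x / t n ^ 2) q \<noteq> 0" if "x \<in> X" for x n
    unfolding qpoch_inf_eq_0_iff[OF q1] t_def using T(3)[OF that, of n] by blast+
  \<comment> \<open>With b, c and h fixed, l scales with t^2 and g with t. The quotients of d, e, f
    and g are unchanged, as are a / d, a / e and a / f, whereas d / l, e / l, f / l and g / l shrink
    by the factor t. Poles are thus separated without touching the denominators of the 4phi3
    series.\<close>
  define A D E F where "A n = a * t n" and "D n = d * t n" and "E n = e * t n" and "F n = f * t n" for n
  have lim: "A \<longlonglongrightarrow> a" "D \<longlonglongrightarrow> d" "E \<longlonglongrightarrow> e" "F \<longlonglongrightarrow> f"
    using tendsto_mult[OF tendsto_const t1] unfolding A_def D_def E_def F_def by force+
  have nzn: "A n \<noteq> 0" "D n \<noteq> 0" "E n \<noteq> 0" "F n \<noteq> 0" for n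
    using nz t0[of n] by (simp_all add: A_def D_def E_def F_def)
  note L = tendsto_intros lim
  have lth: "(\<lambda>n. thetas [h, h * (D n*E n*F n / (q*A n))] q) \<longlonglongrightarrow> thetas [h, h * (d*e*f / (q*a))] q"
    by (intro tendsto_thetas_pair q1 L) (use nz in simp_all)
  have lQ: "(\<lambda>n. qpochs_inf [q*A n/b, q*A n/c, q*A n/D n, q*A n/E n, q*A n/F n] q) \<longlonglongrightarrow> qpochs_inf [q*a/b, q*a/c, q*a/d, q*a/e, q*a/f] q"
    unfolding qpochs_inf_Cons qpochs_inf_Nil by (intro L q1 nz)
  have lG: "(\<lambda>n. qpochs_inf [q^2*(A n)^2/(b*c*D n*E n*F n), b*c*D n/(q*A n), b*c*E n/(q*A n), b*c*F n/(q*A n)] q) \<longlonglongrightarrow>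
     qpochs_inf [q^2*a^2/(b*c*d*e*f), b*c*d/(q*a), b*c*e/(q*a), b*c*f/(q*a)] q"
    unfolding qpochs_inf_Cons qpochs_inf_Nil by (intro L q1) (use nz in simp_all)
  have lF: "(\<lambda>n. qpochs_inf [q*A n/(b*c*F n), D n/F n, E n/F n] q) \<longlonglongrightarrow> qpochs_inf [q*a/(b*c*f), d/f, e/f] q"
    unfolding qpochs_inf_Cons qpochs_inf_Nil by (intro L q1) (use nz in simp_all)
  have lD: "(\<lambda>n. qpochs_inf [q*A n/(b*c*D n), E n/D n, F n/D n] q) \<longlonglongrightarrow> qpochs_inf [q*a/(b*c*d), e/d, f/d] q"
    unfolding qpochs_inf_Cons qpochs_inf_Nil by (intro L q1) (use nz in simp_all)
  have lE: "(\<lambda>n. qpochs_inf [q*A n/(b*c*E n), D n/E n, F n/E n] q) \<longlonglongrightarrow> qpochs_inf [q*a/(b*c*e), d/e, f/e] q"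
    unfolding qpochs_inf_Cons qpochs_inf_Nil by (intro L q1) (use nz in simp_all)
  \<comment> \<open>A square root of \<open>A n\<close> whose convergence to \<open>csqrt a\<close>
    is visible from its form.\<close>
  define s where "s n = csqrt a * of_real (sqrt (T n))" for n
  have s2: "(s n)^2 = A n" for n
    using T(1)[of n] by (simp add: s_def power_mult_distrib A_def t_def flip: of_real_power)
  have ls: "s \<longlonglongrightarrow> csqrt a"
  proof -
    have "s \<longlonglongrightarrow> csqrt a * of_real (sqrt 1)" unfolding s_def by (intro tendsto_intros T1)
    then show ?thesis by simp
  qed
  have W: "(\<lambda>n. \<Sum>j. vwp_term q (A n) [b, c, D n, E n, F n] (q^2*(A n)^2/(b*c*D n*E n*F n)) j) \<longlonglongrightarrow>
    W87 a b c d e f q (q^2*a^2 / (b*c*d*e*f))"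
  proof -
    have a_nz: "qpoch_inf (A n) q \<noteq> 0" for n unfolding A_def by (rule X_nz) (simp add: X_def)
    have "(\<lambda>n. qhyp (map (\<lambda>X. X n) [A, \<lambda>n. q * s n, \<lambda>n. - (q * s n), \<lambda>_. b, \<lambda>_. c, D, E, F])
       (map (\<lambda>X. X n) [s, \<lambda>n. - s n, \<lambda>n. q * A n / b, \<lambda>n. q * A n / c, \<lambda>n. q * A n / D n, \<lambda>n. q * A n / E n, \<lambda>n. q * A n / F n]) q
       (q^2*(A n)^2/(b*c*D n*E n*F n))) \<longlonglongrightarrow> qhyp (W87_num a b c d e f q) (W87_den a b c d e f q) q (q^2*a^2 / (b*c*d*e*f))"
    proof (rule tendsto_qhyp[OF q1])
      show "norm (q^2*a^2 / (b*c*d*e*f)) < 1"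
        unfolding norm_divide using assms(10) nz by (subst divide_less_eq_1_pos) auto
    qed (use nz adm in \<open>auto simp: W87_num_def W87_den_def intro!: L ls\<close>)
    then show ?thesis
      unfolding W87_def vwp_sum_eq_qhyp[OF nz(1) q1 s2 a_nz] list.map .
  qed
  have "(\<lambda>n. four_term q (A n) b c (D n) (E n) (F n) h) \<longlonglongrightarrow> four_term q a b c d e f h"
  proof -
    note qt = tendsto_qhyp[OF q1 _ _ _ tendsto_const q1]
    have G: "(\<lambda>n. qhyp (map (\<lambda>X. X n) [\<lambda>n. q^2*(A n)^2/(b*c*D n*E n*F n), \<lambda>n. q*A n/(b*c), \<lambda>n. q/b, \<lambda>n. q/c])
             (map (\<lambda>X. X n) [\<lambda>n. q^2*A n/(b*c*D n), \<lambda>n. q^2*A n/(b*c*E n), \<lambda>n. q^2*A n/(b*c*F n)]) q q) \<longlonglongrightarrow>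
      qhyp [q^2*a^2/(b*c*d*e*f), q*a/(b*c), q/b, q/c] [q^2*a/(b*c*d), q^2*a/(b*c*e), q^2*a/(b*c*f)] q q"
      by (rule qt) (use nz adm in \<open>auto intro!: L\<close>)
    \<comment> \<open>One statement for the series belonging to f, d and e: \<open>S\<close> follows
      the parameter of the pole, while \<open>U\<close>, \<open>V\<close> and likewise
      \<open>O1\<close>, \<open>O2\<close> follow the other two.\<close>
    have Q: "(\<lambda>n. qhyp (map (\<lambda>X. X n) [\<lambda>n. q*A n/(U n * V n), \<lambda>n. b * S n/A n, \<lambda>n. c * S n/A n, S])
             (map (\<lambda>X. X n) [\<lambda>n. b*c * S n/A n, \<lambda>n. q * S n/O1 n, \<lambda>n. q * S n/O2 n]) q q) \<longlonglongrightarrow>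
        qhyp [q*a/(u * v), b * s/a, c * s/a, s] [b*c * s/a, q * s/o1, q * s/o2] q q"
      if "U \<longlonglongrightarrow> u" "V \<longlonglongrightarrow> v" "S \<longlonglongrightarrow> s" "O1 \<longlonglongrightarrow> o1" "O2 \<longlonglongrightarrow> o2" "u * v \<noteq> 0" "o1 \<noteq> 0" "o2 \<noteq> 0"
        "qpochs_inf [b*c * s/a, q * s/o1, q * s/o2] q \<noteq> 0" for U V S O1 O2 u v s o1 o2
      by (rule qt) (use nz that in \<open>auto intro!: L\<close>)
    note QQ = G Q[OF lim(2,3,4,2,3)] Q[OF lim(3,4,2,3,4)] Q[OF lim(2,4,3,2,4)]
    have qinf: "(\<lambda>n. qpochs_inf (X n # Xs n) q) \<longlonglongrightarrow> qpochs_inf (x # xs) q"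
      if "X \<longlonglongrightarrow> x" "(\<lambda>n. qpochs_inf (Xs n) q) \<longlonglongrightarrow> qpochs_inf xs q" for X Xs x xs
      unfolding qpochs_inf_Cons by (intro tendsto_mult tendsto_qpoch_inf q1 that)
    have lqa: "(\<lambda>n. qpoch_inf (q * A n) q) \<longlonglongrightarrow> qpoch_inf (q * a) q" by (intro L q1)
    show ?thesis
      unfolding four_term_def
      by (intro tendsto_mult tendsto_add tendsto_divide lqa tendsto_thetas_pair qinf lth lQ lG lF lD lE
            QQ[unfolded list.map] assms no_zero_divisors L q1) (use nz adm in simp_all)
  qed
  moreover have "eventually (\<lambda>n. (\<Sum>j. vwp_term q (A n) [b, c, D n, E n, F n] (q^2*(A n)^2/(b*c*D n*E n*F n)) j) = four_term q (A n) b c (D n) (E n) (F n) h) sequentially"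
    \<comment> \<open>The denominators of the four-term expression have non-zero limits by
      assumption, so they are non-zero for all large \<open>n\<close>.\<close>
    using tendsto_imp_eventually_ne[OF lth assms(11)] tendsto_imp_eventually_ne[OF lQ assms(12)]
      tendsto_imp_eventually_ne[OF lG assms(13)] tendsto_imp_eventually_ne[OF lF assms(14)]
      tendsto_imp_eventually_ne[OF lD assms(15)] tendsto_imp_eventually_ne[OF lE assms(16)]
  proof eventually_elim
    case (elim n)
    show ?case
    proof (rule four_term_generic)
      \<comment> \<open>The left-hand side grows by t^2 and the right-hand side by t^3, so t > 1
        preserves the condition for convergence.\<close>
      have "norm (q^2 * (A n)^2) = norm (q^2 * a^2) * (T n)^2"
        using T(1)[of n] by (simp add: A_def t_def norm_mult norm_power power_mult_distrib)
      also have "\<dots> < norm (b * c * d * e * f) * (T n)^2"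
        using assms(10) T(1)[of n] by (intro mult_strict_right_mono) auto
      also have "\<dots> \<le> norm (b * c * d * e * f) * (T n)^3"
        using T(1)[of n] by (intro mult_left_mono power_increasing) auto
      also have "\<dots> = norm (b * c * D n * E n * F n)"
        using T(1)[of n] by (simp add: D_def E_def F_def t_def norm_mult power3_eq_cube)
      finally show "norm (q^2 * (A n)^2) < norm (b * c * D n * E n * F n)" .
      have e: "q*A n/(E n*F n) = q*a/(e*f) / t n" "q*A n/(D n*F n) = q*a/(d*f) / t n" "q*A n/(D n*E n) = q*a/(d*e) / t n"
        "q*A n/(b*c) = q*a/(b*c) * t n" "q^2*(A n)^2/(D n*E n*F n) = q^2*a^2/(d*e*f) / t n"
        "D n*E n*F n/(q*A n) = d*e*f/(q*a) * t n ^ 2" "q / (d*e*f/(q*a) * t n ^ 2) = q / (d*e*f/(q*a)) / t n ^ 2"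
        using nz t0[of n] by (simp_all add: A_def D_def E_def F_def power2_eq_square mult_ac)
      have mem: "a \<in> X" "d \<in> X" "e \<in> X" "f \<in> X" "q*a/(e*f) \<in> X" "q*a/(d*f) \<in> X" "q*a/(d*e) \<in> X"
        "q*a/(b*c) \<in> X" "q^2*a^2/(d*e*f) \<in> X" by (simp_all add: X_def)
      show "qpochs_inf [A n, D n, E n, F n, q*A n/(E n*F n), q*A n/(D n*F n), q*A n/(D n*E n), q*A n/(b*c), q^2*(A n)^2/(D n*E n*F n)] q \<noteq> 0"
        unfolding e unfolding A_def D_def E_def F_def qpochs_inf_Cons qpochs_inf_Nil
        by (intro no_zero_divisors one_neq_zero X_nz mem)
      show "theta (D n*E n*F n/(q*A n)) q \<noteq> 0"
        unfolding theta_def e qpochs_inf_Cons qpochs_inf_Nil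
        using X_nz(3)[of "d*e*f/(q*a)" n] X_nz(4)[of "q/(d*e*f/(q*a))" n] by (simp add: X_def)
    qed (use nz nzn q1 elim in simp_all)
  qed
  ultimately have "(\<lambda>n. \<Sum>j. vwp_term q (A n) [b, c, D n, E n, F n] (q^2*(A n)^2/(b*c*D n*E n*F n)) j) \<longlonglongrightarrow> four_term q a b c d e f h"
    by (rule Lim_transform_eventually[OF _ eventually_mono[OF _ sym]])
  with W have "W87 a b c d e f q (q^2*a^2 / (b*c*d*e*f)) = four_term q a b c d e f h"
    by (rule LIMSEQ_unique)
  then show ?thesis unfolding four_term_def .
qed

end
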